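(* Any discrete solution $u_h=(v_h,p_h)$ of the space-discrete Navier–Stokes problem $$\rho\int_\Omega\frac{\partial v_h}{\partial t}\cdot\phi_h+a^{\rm NaSt}(u_h)(\psi_h)+a_{\rm stab}(u_h)(\psi_h)=l^{\rm NaSt}(u_h)(\psi_h)+l_{\rm stab}(u_h)(\psi_h)\quad\forall\psi_h=(\phi_h,\chi_h)\in\mathbb V_h\times\mathbb W_h$$ satisfies $$ \begin{aligned} \frac{d}{dt}\int_\Omega\frac\rho2v_h^2=&-\mu\int_\Omega|\nabla v_h|^2+\int_\Omega f\cdot v_h-\big(a_{\rm stab}(u_h)(u_h)-l_{\rm stab}(u_h)(u_h)\big)\\ &-\int_{\Gamma_{\rm char}}\Big(\frac12|A_n(u_h)|_\Theta u_h+A_n(u_h)^{-_\Theta}u^{\rm D}\Big)\cdot u_h\\ &-\mu\int_{\Gamma_{\rm wall}\cup\Gamma_{\rm in}}\Big((v_h-v^{\rm D})\cdot\big(\frac\gamma{d_K}v_h-\frac{\partial v_h}{\partial n}\big)-v_h\cdot\frac{\partial v_h}{\partial n}\Big)-\mu\int_{\Gamma_{\rm sym}}v_{h,n}\Big(\frac\gamma{d_K}v_{h,n}-2\frac{\partial v_h}{\partial n}\cdot n\Big)\\ &-\frac12\int_{\Gamma_{\rm wall}\cup\Gamma_{\rm sym}\cup\Gamma_{\rm in}}|A_n(u_h)|_\Theta(v_h,0)\cdot(v_h,0)-\int_{\Gamma_{\rm in}}\Big(\rho v_{h,n}^-v^{\rm D}\cdot v_h+v^{\rm D}_n(p_h-\alpha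 v_{h,n})\Big)\\ &-\int_{\Gamma_{\rm out}}\Big(\frac\rho2|v_{h,n}|(v_h)_n^\perp\cdot(v_h)_n^\perp+Q\big(v_h,p_h-\mu\tfrac{\partial v_h}{\partial n}\cdot n,1\big)\Big)\\ &+\int_{\Gamma_{\rm out}}\Big(\frac1\theta\big(p_h-\mu\frac{\partial v_h}{\partial n}\cdot n\big)-v_{h,n}\Big)p^{\rm D}, \end{aligned} $$ where $v^{\rm D}=0$ on $\Gamma_{\rm wall}$. For vanishing data $f$, $v^{\rm D}$, $p^{\rm D}$ (and hence $u^{\rm D}=0$) one gets $$\frac{d}{dt}\int_\Omega\frac\rho2v_h^2=-a^{\rm NaSt}(u_h)(u_h)-a_{\rm stab}(u_h)(u_h),$$ so $\frac{d}{dt}\int_\Omega\frac\rho2v_h^2\le0$ for $\theta$ given by $\theta^2=(\rho v_h)^2+c_{\rm dt}^2(\rho d_K/d_t)^2+c_{\rm St}^2(\mu/d_K)^2$ and for $\gamma$ sufficiently large.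
   Context: Setting. $\Omega\subset\mathbb R^d$ ($d=2,3$) is a bounded domain with outward unit normal $n$; $\partial\Omega=\Gamma_{\rm wall}\cup\Gamma_{\rm in}\cup\Gamma_{\rm out}\cup\Gamma_{\rm sym}\cup\Gamma_{\rm char}$ (a subdivision of the boundary, $\Gamma_{\rm sym}$ lying in a hyperplane). $\rho>0$ and $\mu\ge0$ are constants and $\gamma$ is a stabilization parameter. $\mathbb V_h$ (vector-valued) and $\mathbb W_h$ (scalar) are finite element spaces of continuous functions on a simplicial, quadrilateral or hexahedral mesh with set of cells $\mathcal K_h$; $d_K$ is the diameter of the cell $K$ (on a boundary face, of the adjacent cell); $d_t>0$ is the time discretization parameter; time is continuous, $u_h(t)=(v_h(t),p_h(t))\in\mathbb V_h\times\mathbb W_h$, and test functions may depend (differentiably) on $t$. Data: source $f$, inflow velocity $v^{\rm D}$, outflow pressure $p^{\rm D}$, and characteristic data $u^{\rm D}=(v^{\rm D},p^{\rm D})$ on $\Gamma_{\rm char}$. Notation. $\phi_n=\phi\cdot n$, $\phi_n^\perp=\phi-\phi_nn$, $v_{h,n}=v_h\cdot n$, $v_h^2=v_h\cdot v_h$, $x^+=\max\{x,0\}$, $x^-=x-x^+$. For $u=(v,p)$, $A_n(u)=\begin{bmatrix}\rho v_nI&n\\ n^T&0\end{bmatrix}$. For symmetric $A=R\Lambda R^T$ ($\Lambda$ diagonal, $R$ orthogonal), $|A|=R|\Lambda|R^T$, $A^-=R\Lambda^-R^T$. With $\Theta=\begin{bmatrix}I&0\\0&\theta\end{bmatrix}$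 ($I$ the $d\times d$ identity): $|A|_\Theta=\Theta^{-1}|\Theta A\Theta|\Theta^{-1}$, $A^{-_\Theta}=\Theta^{-1}(\Theta A\Theta)^-\Theta^{-1}$. Here $\theta>0$ is a positive function defined cell by cell, which may depend on $u_h$; the choice in the last assertion uses constants $c_{\rm dt},c_{\rm St}$ with $c_{\rm dt}^2+c_{\rm St}^2>0$. Also $$\alpha=\alpha(v)=\frac{\big(\rho|v_n|-\sqrt{4\theta^2+\rho^2v_n^2}\big)^2}{4\sqrt{4\theta^2+\rho^2v_n^2}},\qquad Q(v,p,\delta)=\rho\Big(\tfrac12v_n^++(\tfrac12-\delta)v_n^-\Big)v_n^2+\frac1\theta(\delta\rho v_n^-v_n+p)\,p .$$ Inviscid forms (with $\alpha=\alpha(v_h)$): $$ \begin{aligned} a^{\rm Eu}(u_h)(\psi_h)=&\int_\Omega\frac\rho2\big((v_h\cdot\nabla v_h)\cdot\phi_h-v_h\cdot(v_h\cdot\nabla\phi_h)\big)+\int_\Omega(\chi_h\operatorname{div}v_h-p_h\operatorname{div}\phi_h)\\ &+\int_{\Gamma_{\rm char}}\Big(\frac\rho2v_{h,n}v_h\cdot\phi_h+p_h\phi_{h,n}-A_n(u_h)^{-_\Theta}u_h\cdot\psi_h\Big)\\ &+\int_{\Gamma_{\rm wall}\cup\Gamma_{\rm sym}\cup\Gamma_{\rm in}}\Big(\frac\rho2|v_{h,n}|v_h\cdot\phi_h+\alpha v_{h,n}\phi_{h,n}-\chi_hv_{h,n}+p_h\phi_{h,n}\Big)\\ &+\int_{\Gamma_{\rm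 out}}\Big(\frac\rho2|v_{h,n}|v_h\cdot\phi_h+\frac1\theta(\rho v_{h,n}^-v_{h,n}+p_h)\chi_h\Big),\\ l^{\rm Eu}(u_h)(\psi_h)=&\int_\Omega f\cdot\phi_h-\int_{\Gamma_{\rm char}}A_n(u_h)^{-_\Theta}u^{\rm D}\cdot\psi_h+\int_{\Gamma_{\rm in}}\big(-\rho v_{h,n}^-v^{\rm D}\cdot\phi_h+\alpha v^{\rm D}_n\phi_{h,n}-\chi_hv^{\rm D}_n\big)\\ &+\int_{\Gamma_{\rm out}}\Big(\frac1\theta p^{\rm D}\chi_h-p^{\rm D}\phi_{h,n}\Big). \end{aligned} $$ Viscous forms: $$ \begin{aligned} a^{\rm visc}(u_h,\psi_h)=&\int_\Omega\nabla v_h:\nabla\phi_h-\int_{\Gamma_{\rm wall}\cup\Gamma_{\rm in}}\Big(\frac{\partial v_h}{\partial n}\cdot\phi_h+v_h\cdot\big(\frac{\partial\phi_h}{\partial n}-\frac\gamma{d_K}\phi_h\big)\Big)\\ &-\int_{\Gamma_{\rm sym}}\Big(\frac{\partial v_h}{\partial n}\cdot n\,\phi_{h,n}+v_{h,n}\big(\frac{\partial\phi_h}{\partial n}\cdot n-\frac\gamma{d_K}\phi_{h,n}\big)\Big)\\ &-\int_{\Gamma_{\rm out}}\frac1\theta\Big(\frac{\partial v_h}{\partial n}\cdot n\,\chi_h+\frac{\partial\phi_h}{\partial n}\cdot n\,p_h-\mu\frac{\partial v_h}{\partial n}\cdot n\,\frac{\partial\phi_h}{\partial n}\cdot n\Big),\\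 l^{\rm visc}(\phi_h)=&-\int_{\Gamma_{\rm in}}v^{\rm D}\cdot\Big(\frac{\partial\phi_h}{\partial n}-\frac\gamma{d_K}\phi_h\Big)-\int_{\Gamma_{\rm out}}\frac1\theta\frac{\partial\phi_h}{\partial n}\cdot n\,p^{\rm D}. \end{aligned} $$ Navier–Stokes forms: $$a^{\rm NaSt}(u_h)(\psi_h)=a^{\rm Eu}(u_h)(\psi_h)+\mu a^{\rm visc}(u_h,\psi_h),\qquad l^{\rm NaSt}(u_h)(\psi_h)=l^{\rm Eu}(u_h)(\psi_h)+\mu l^{\rm visc}(\phi_h).$$ Stabilization (SUPG): with $E^{u_h}(\psi_h)=\rho\frac{\partial\phi_h}{\partial t}+\rho v_h\cdot\nabla\phi_h-\mu\Delta\phi_h+\nabla\chi_h$ (evaluated cell by cell), $$a_{\rm stab}(u_h)(\psi_h)=\sum_{K\in\mathcal K_h}\Big(\int_K\gamma_{K,1}E^{u_h}(u_h)\cdot E^{u_h}(\psi_h)+\int_K\gamma_{K,2}\operatorname{div}v_h\operatorname{div}\phi_h\Big),\quad l_{\rm stab}(u_h)(\psi_h)=\sum_{K\in\mathcal K_h}\int_K\gamma_{K,1}f\cdot E^{u_h}(\psi_h),$$ with $\gamma_{K,1}=\gamma_1d_K/\theta$, $\gamma_{K,2}=\gamma_2d_K\theta$, $\gamma_1,\gamma_2>0$.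
   Formalization: The displayed identity fails for μ>0 with backflow on Γ_out: it lacks −∫(μ/θ)ρv_n⁻v_n(∂_n v·n). Proved with this term added, or verbatim once a^visc includes the missing convective outflow part. For the displayed forms, d/dt≤0 needs μ=0, no backflow, or also c_St large. *)

theory Defs
  imports "HOL-Analysis.Analysis"
begin

section \<open>Surface measure\<close>

text \<open>The \<open>m\<close>-dimensional Hausdorff measure, normalised to agree with \<open>m\<close>-dimensional area.
  The lemma \<open>emeasure_hausdorff\<close> below shows that the outer measure is indeed a measure on the
  Borel sets.\<close>

definition hausdorff_cost :: "nat \<Rightarrow> 'a::metric_space set \<Rightarrow> ennreal" where
  "hausdorff_cost m S = (if S = {} then 0 else ennreal (unit_ball_vol (real m) * (diameter S / 2) ^ m))"

definition hausdorff_pre :: "nat \<Rightarrow> real \<Rightarrow> 'a::metric_space set \<Rightarrow> ennreal" where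
  "hausdorff_pre m \<delta> A =
     (INF U \<in> {U :: nat \<Rightarrow> 'a set. A \<subseteq> (\<Union>i. U i) \<and> (\<forall>i. bounded (U i) \<and> diameter (U i) \<le> \<delta>)}.
        \<Sum>i. hausdorff_cost m (U i))"

definition hausdorff_outer :: "nat \<Rightarrow> 'a::metric_space set \<Rightarrow> ennreal" where
  "hausdorff_outer m A = (SUP \<delta> \<in> {0<..}. hausdorff_pre m \<delta> A)"

definition hausdorff :: "nat \<Rightarrow> 'a::metric_space measure" where
  "hausdorff m = measure_of UNIV (sets borel) (hausdorff_outer m)"

lemma hausdorff_pre_le:
  assumes "A \<subseteq> (\<Union>i. U i)" "\<And>i. bounded (U i)" "\<And>i. diameter (U i) \<le> \<delta>"
  shows "hausdorff_pre m \<delta> A \<le> (\<Sum>i. hausdorff_cost m (U i))"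
  unfolding hausdorff_pre_def using assms by (intro INF_lower) auto

lemma hausdorff_pre_mono: "A \<subseteq> B \<Longrightarrow> hausdorff_pre m \<delta> A \<le> hausdorff_pre m \<delta> B"
  unfolding hausdorff_pre_def by (intro INF_superset_mono) auto

lemma hausdorff_pre_antimono: "\<delta> \<le> \<delta>' \<Longrightarrow> hausdorff_pre m \<delta>' A \<le> hausdorff_pre m \<delta> A"
  unfolding hausdorff_pre_def by (intro INF_superset_mono) (auto intro: order_trans)

lemma hausdorff_pre_empty: "0 < \<delta> \<Longrightarrow> hausdorff_pre m \<delta> {} = 0"
  using hausdorff_pre_le[of "{}" "\<lambda>_. {}" \<delta> m] by (simp add: hausdorff_cost_def)

lemma hausdorff_pre_UN:
  "hausdorff_pre m \<delta> (\<Union>i. A i) \<le> (\<Sum>i. hausdorff_pre m \<delta> (A (i::nat)))"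
proof (cases "(\<Sum>i. hausdorff_pre m \<delta> (A i)) = \<infinity>")
  case True then show ?thesis by simp
next
  case False
  have fin: "hausdorff_pre m \<delta> (A i) < \<infinity>" for i
    using False ennreal_suminf_lessD[of "\<lambda>i. hausdorff_pre m \<delta> (A i)" "\<infinity>" i] by (simp add: top.not_eq_extremum)
  show ?thesis
  proof (rule ennreal_le_epsilon)
    fix e :: real assume e: "e > 0"
    have "\<exists>U. A i \<subseteq> (\<Union>j. U j) \<and> (\<forall>j. bounded (U j) \<and> diameter (U j) \<le> \<delta>) \<and>
        (\<Sum>j. hausdorff_cost m (U j)) \<le> hausdorff_pre m \<delta> (A i) + ennreal (e * (1/2)^Suc i)" for i
    proof -
      have "hausdorff_pre m \<delta> (A i) < hausdorff_pre m \<delta> (A i) + ennreal (e * (1/2)^Suc i)"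
        using fin[of i] e by (simp add: ennreal_add_left_cancel_less[where c=0, simplified] less_top)
      from this[unfolded hausdorff_pre_def[of _ _ "A i"] INF_less_iff] show ?thesis
        unfolding hausdorff_pre_def[of _ _ "A i", symmetric] by (auto intro!: less_imp_le)
    qed
    then obtain U where U: "\<And>i. A i \<subseteq> (\<Union>j. U i j)" "\<And>i j. bounded (U i j)" "\<And>i j. diameter (U i j) \<le> \<delta>"
      "\<And>i. (\<Sum>j. hausdorff_cost m (U i j)) \<le> hausdorff_pre m \<delta> (A i) + ennreal (e * (1/2)^Suc i)"
      by metis
    define V where "V k = (case prod_decode k of (i, j) \<Rightarrow> U i j)" for k
    have "(\<Union>i. A i) \<subseteq> (\<Union>k. V k)"
    proof
      fix x assume "x \<in> (\<Union>i. A i)"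
      then obtain i j where "x \<in> U i j" using U(1) by blast
      then have "x \<in> V (prod_encode (i,j))" by (simp add: V_def)
      then show "x \<in> (\<Union>k. V k)" by blast
    qed
    then have "hausdorff_pre m \<delta> (\<Union>i. A i) \<le> (\<Sum>k. hausdorff_cost m (V k))"
      by (rule hausdorff_pre_le) (auto simp: V_def U split: prod.split)
    also have "\<dots> = (\<Sum>k. (case prod_decode k of (i,j) \<Rightarrow> hausdorff_cost m (U i j)))"
      by (rule arg_cong[where f=suminf]) (auto simp: V_def split: prod.split)
    also have "\<dots> = (\<Sum>i. \<Sum>j. hausdorff_cost m (U i j))"
      using suminf_ennreal_2dimen[of "\<lambda>i. \<Sum>j. hausdorff_cost m (U i j)" "\<lambda>(i,j). hausdorff_cost m (U i j)"] by simp
    also have "\<dots> \<le> (\<Sum>i. hausdorff_pre m \<delta> (A i) + ennreal (e * (1/2)^Suc i))"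
      by (intro suminf_le U summableI)
    also have "\<dots> = (\<Sum>i. hausdorff_pre m \<delta> (A i)) + (\<Sum>i. ennreal (e * (1/2)^Suc i))"
      by (intro suminf_add[symmetric] summableI)
    also have "(\<Sum>i. ennreal (e * (1/2)^Suc i)) = ennreal e"
      using e by (intro suminf_ennreal_eq) (auto intro!: sums_mult[OF power_half_series, of e, simplified])
    finally show "hausdorff_pre m \<delta> (\<Union>i. A i) \<le> (\<Sum>i. hausdorff_pre m \<delta> (A i)) + ennreal e" .
  qed
qed

lemma hausdorff_pre_separated:
  assumes "\<And>x y. x \<in> A \<Longrightarrow> y \<in> B \<Longrightarrow> r \<le> dist x y" "\<delta> < r"
  shows "hausdorff_pre m \<delta> A + hausdorff_pre m \<delta> B \<le> hausdorff_pre m \<delta> (A \<union> B)"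
  unfolding hausdorff_pre_def[of _ _ "A \<union> B"]
proof (rule INF_greatest, clarify)
  fix U :: "nat \<Rightarrow> 'a set"
  assume cov: "A \<union> B \<subseteq> \<Union> (range U)" and U: "\<forall>i. bounded (U i) \<and> diameter (U i) \<le> \<delta>"
  define F where "F S i = (if U i \<inter> S = {} then {} else U i)" for S i
  have d: "0 \<le> \<delta>" using U diameter_ge_0[of "U 0"] by (metis order_trans)
  have ne: "U i \<inter> A = {} \<or> U i \<inter> B = {}" for i
  proof (rule ccontr)
    assume "\<not> ?thesis"
    then obtain x y where "x \<in> U i" "x \<in> A" "y \<in> U i" "y \<in> B" by blast
    then have "dist x y \<le> \<delta>" using U diameter_bounded_bound[of "U i" x y] by (meson order_trans)
    then show False using assms \<open>x \<in> A\<close> \<open>y \<in> B\<close> by force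
  qed
  have le: "hausdorff_pre m \<delta> S \<le> (\<Sum>i. hausdorff_cost m (F S i))" if "S \<subseteq> A \<union> B" for S
    by (rule hausdorff_pre_le) (use that cov U d in \<open>auto simp: F_def, blast\<close>)
  have "hausdorff_pre m \<delta> A + hausdorff_pre m \<delta> B \<le> (\<Sum>i. hausdorff_cost m (F A i)) + (\<Sum>i. hausdorff_cost m (F B i))"
    by (intro add_mono le) auto
  also have "\<dots> = (\<Sum>i. hausdorff_cost m (F A i) + hausdorff_cost m (F B i))"
    by (intro suminf_add summableI)
  also have "\<dots> \<le> (\<Sum>i. hausdorff_cost m (U i))"
    using ne by (intro suminf_le summableI) (auto simp: F_def hausdorff_cost_def)
  finally show "hausdorff_pre m \<delta> A + hausdorff_pre m \<delta> B \<le> (\<Sum>i. hausdorff_cost m (U i))" .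
qed

lemma hausdorff_pre_le_outer: "0 < \<delta> \<Longrightarrow> hausdorff_pre m \<delta> A \<le> hausdorff_outer m A"
  unfolding hausdorff_outer_def by (rule SUP_upper) simp

lemma outer_measure_space_hausdorff: "outer_measure_space (UNIV :: 'a::metric_space set set) (hausdorff_outer m)"
  unfolding outer_measure_space_def
proof (intro conjI)
  show "positive UNIV (hausdorff_outer m)"
    unfolding positive_def hausdorff_outer_def by (simp add: hausdorff_pre_empty)
  show "increasing UNIV (hausdorff_outer m)"
    unfolding increasing_def hausdorff_outer_def by (auto intro!: SUP_mono hausdorff_pre_mono)
  show "countably_subadditive (UNIV :: 'a set set) (hausdorff_outer m)"
  proof -
    have "hausdorff_outer m (\<Union>i. A i) \<le> (\<Sum>i. hausdorff_outer m (A i))" for A :: "nat \<Rightarrow> 'a set"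
      unfolding hausdorff_outer_def[of m "\<Union>i. A i"]
    proof (rule SUP_least)
      fix \<delta> :: real assume "\<delta> \<in> {0<..}"
      then show "hausdorff_pre m \<delta> (\<Union>i. A i) \<le> (\<Sum>i. hausdorff_outer m (A i))"
        by (intro order_trans[OF hausdorff_pre_UN] suminf_le summableI hausdorff_pre_le_outer) auto
    qed
    then show ?thesis by (auto simp: countably_subadditive_def)
  qed
qed

lemma hausdorff_outer_separated:
  assumes "\<And>x y. x \<in> A \<Longrightarrow> y \<in> B \<Longrightarrow> r \<le> dist x y" "0 < r"
  shows "hausdorff_outer m A + hausdorff_outer m B \<le> hausdorff_outer m (A \<union> B)"
proof -
  have *: "hausdorff_pre m \<delta> A + hausdorff_pre m \<delta>' B \<le> hausdorff_outer m (A \<union> B)" if "\<delta> > 0" "\<delta>' > 0" for \<delta> \<delta>'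
  proof -
    define e where "e = min (r/2) (min \<delta> \<delta>')"
    have e: "0 < e" "e < r" "e \<le> \<delta>" "e \<le> \<delta>'" using that assms(2) by (auto simp: e_def min_def)
    have "hausdorff_pre m \<delta> A + hausdorff_pre m \<delta>' B \<le> hausdorff_pre m e A + hausdorff_pre m e B"
      using e by (intro add_mono hausdorff_pre_antimono)
    also have "\<dots> \<le> hausdorff_pre m e (A \<union> B)" by (rule hausdorff_pre_separated[OF assms(1) e(2)])
    also have "\<dots> \<le> hausdorff_outer m (A \<union> B)" using e by (intro hausdorff_pre_le_outer)
    finally show ?thesis .
  qed
  have "hausdorff_outer m A + hausdorff_outer m B
      = (SUP \<delta>\<in>{0<..}. hausdorff_pre m \<delta> A + hausdorff_outer m B)"
    unfolding hausdorff_outer_def[of m A] by (rule ennreal_SUP_add_left[symmetric]) auto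
  also have "\<dots> \<le> hausdorff_outer m (A \<union> B)"
  proof (rule SUP_least)
    fix \<delta> :: real assume d: "\<delta> \<in> {0<..}"
    have "hausdorff_pre m \<delta> A + hausdorff_outer m B
        = (SUP \<delta>'\<in>{0<..}. hausdorff_pre m \<delta> A + hausdorff_pre m \<delta>' B)"
      unfolding hausdorff_outer_def[of m B] by (rule ennreal_SUP_add_right) auto
    also have "\<dots> \<le> hausdorff_outer m (A \<union> B)" using d by (intro SUP_least *) auto
    finally show "hausdorff_pre m \<delta> A + hausdorff_outer m B \<le> hausdorff_outer m (A \<union> B)" .
  qed
  finally show ?thesis .
qed

lemma metric_outer_measure_closed:
  fixes f :: "'a::metric_space set \<Rightarrow> ennreal"
  assumes om: "outer_measure_space UNIV f"
    and sep: "\<And>A B r. 0 < r \<Longrightarrow> (\<And>x y. x \<in> A \<Longrightarrow> y \<in> B \<Longrightarrow> r \<le> dist x y) \<Longrightarrow> f A + f B \<le> f (A \<union> B)"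
    and C: "closed C"
  shows "f (C \<inter> X) + f (X - C) \<le> f X"
proof (cases "C = {} \<or> f X = \<infinity>")
  case True
  with om show ?thesis by (auto simp: outer_measure_space_def positive_def)
next
  case False
  have ne: "C \<noteq> {}" and fin: "f X < \<infinity>" using False by (auto simp: less_top)
  have mono: "A \<subseteq> B \<Longrightarrow> f A \<le> f B" for A B
    using om by (auto simp: outer_measure_space_def increasing_def)
  define A where "A k = {x \<in> X - C. 1 / real (Suc k) \<le> infdist x C}" for k
  define R where "R k = A (Suc k) - A k" for k
  have A_mono: "A k \<subseteq> A l" if "k \<le> l" for k l
    using that frac_le[of 1 1 "real (Suc k)" "real (Suc l)"] by (auto simp: A_def)
  have A_sep: "f S + f (A k) \<le> f (S \<union> A k)" if S: "\<And>x. x \<in> S \<Longrightarrow> infdist x C < 1 / real (Suc (Suc k))" for S k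
  proof (rule sep)
    show "0 < 1 / real (Suc k) - 1 / real (Suc (Suc k))" by (simp add: frac_less2)
    fix x y assume x: "x \<in> S" and y: "y \<in> A k"
    have "infdist y C \<le> infdist x C + dist y x" by (rule infdist_triangle)
    then show "1 / real (Suc k) - 1 / real (Suc (Suc k)) \<le> dist x y"
      using S[OF x] y by (simp add: A_def dist_commute)
  qed
  have CA: "f (C \<inter> X) + f (A k) \<le> f X" for k
    by (rule order_trans[OF A_sep mono]) (auto simp: A_def)
  have R_sep: "f (R (Suc k)) + f (A k) \<le> f (A (Suc (Suc k)))" for k
    by (rule order_trans[OF A_sep mono]) (use A_mono[of k "Suc (Suc k)"] in \<open>auto simp: R_def A_def\<close>)
  have R_le: "f (R k) \<le> f (A (Suc k))" for k by (rule mono) (auto simp: R_def)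
  have sum_R: "(\<Sum>k<Suc n. f (R k)) \<le> f (A (Suc n)) + f (A n)" for n
  proof (induction n)
    case 0
    show ?case using R_le[of 0] by (auto intro: order_trans)
  next
    case (Suc n)
    have "(\<Sum>k<Suc (Suc n). f (R k)) \<le> f (A (Suc n)) + f (A n) + f (R (Suc n))"
      using Suc by (simp add: add_right_mono)
    also have "\<dots> = f (A (Suc n)) + (f (R (Suc n)) + f (A n))" by (simp add: ac_simps)
    also have "\<dots> \<le> f (A (Suc n)) + f (A (Suc (Suc n)))" by (intro add_left_mono R_sep)
    finally show ?case by (simp add: ac_simps)
  qed
  have A_le: "f (A k) \<le> f X" for k by (rule mono) (auto simp: A_def)
  have "(\<Sum>k. f (R k)) \<le> f X + f X"
  proof (rule suminf_le_const)
    fix n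
    have "(\<Sum>k<n. f (R k)) \<le> (\<Sum>k<Suc n. f (R k))" by (simp add: sum_mono2)
    also have "\<dots> \<le> f (A (Suc n)) + f (A n)" by (rule sum_R)
    also have "\<dots> \<le> f X + f X" by (intro add_mono A_le)
    finally show "(\<Sum>k<n. f (R k)) \<le> f X + f X" .
  qed (rule summableI)
  also have "\<dots> < \<infinity>" using fin by simp
  finally have fin_R: "(\<Sum>k. f (R k)) < \<infinity>" .
  have D: "X - C \<subseteq> A n \<union> (\<Union>k. R (k + n))" for n
  proof
    fix x assume x: "x \<in> X - C"
    then have "infdist x C > 0" using C ne
      by (metis DiffD2 in_closed_iff_infdist_zero infdist_nonneg less_eq_real_def)
    then obtain k where "1 / real (Suc k) < infdist x C" using nat_approx_posE by metis
    then have ex: "\<exists>k. x \<in> A k" using x by (auto simp: A_def intro!: exI[of _ k])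
    define l where "l = (LEAST k. x \<in> A k)"
    have l: "x \<in> A l" "\<And>k. k < l \<Longrightarrow> x \<notin> A k"
      using LeastI_ex[OF ex] not_less_Least unfolding l_def by blast+
    show "x \<in> A n \<union> (\<Union>k. R (k + n))"
    proof (cases "l \<le> n")
      case True then show ?thesis using l A_mono by blast
    next
      case False
      then have "x \<in> R ((l - 1 - n) + n)" using l by (auto simp: R_def)
      then show ?thesis by blast
    qed
  qed
  have sub2: "f (S \<union> T) \<le> f S + f T" for S T
  proof -
    have sa: "subadditive UNIV f"
      using ring_of_sets.countably_subadditive_subadditive[of UNIV UNIV f] om
      unfolding outer_measure_space_def by (metis Pow_UNIV ring_of_sets_Pow)
    show ?thesis
    proof -
      have "f (S \<union> (T - S)) \<le> f S + f (T - S)" using sa[unfolded subadditive_def, rule_format, of S "T - S"] by simp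
      also have "\<dots> \<le> f S + f T" by (intro add_left_mono mono) auto
      finally show ?thesis by simp
    qed
  qed
  have *: "f (C \<inter> X) + f (X - C) + (\<Sum>k<n. f (R k)) \<le> f X + (\<Sum>k. f (R k))" for n
  proof -
    have "f (X - C) \<le> f (A n) + f (\<Union>k. R (k + n))" by (rule order_trans[OF mono[OF D] sub2])
    also have "f (\<Union>k. R (k + n)) \<le> (\<Sum>k. f (R (k + n)))"
    proof -
      have "disjoint_family (\<lambda>k. R (k + n))"
      proof -
        have "R i \<inter> R j = {}" if "i < j" for i j using A_mono[of "Suc i" j] that by (auto simp: R_def)
        then have "R i \<inter> R j = {}" if "i \<noteq> j" for i j
          using that by (cases i j rule: linorder_cases) (auto simp: Int_commute)
        then show ?thesis unfolding disjoint_family_on_def by simp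
      qed
      then show ?thesis using om by (auto simp: outer_measure_space_def countably_subadditive_def)
    qed
    finally have "f (C \<inter> X) + f (X - C) + (\<Sum>k<n. f (R k))
        \<le> f (C \<inter> X) + (f (A n) + (\<Sum>k. f (R (k + n)))) + (\<Sum>k<n. f (R k))"
      by (simp add: add_left_mono add_right_mono)
    also have "\<dots> = (f (C \<inter> X) + f (A n)) + ((\<Sum>k. f (R (k + n))) + (\<Sum>k<n. f (R k)))"
      by (simp add: ac_simps)
    also have "(\<Sum>k. f (R (k + n))) + (\<Sum>k<n. f (R k)) = (\<Sum>k. f (R k))"
      by (rule suminf_offset[OF summableI, symmetric])
    finally show ?thesis using CA[of n] by (meson add_right_mono order_trans)
  qed
  have "f (C \<inter> X) + f (X - C) + (\<Sum>k. f (R k)) \<le> f X + (\<Sum>k. f (R k))"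
  proof -
    have "f (C \<inter> X) + f (X - C) + (\<Sum>k. f (R k)) = (SUP n. f (C \<inter> X) + f (X - C) + (\<Sum>k<n. f (R k)))"
      unfolding suminf_eq_SUP by (rule ennreal_SUP_add_right) simp
    also have "\<dots> \<le> f X + (\<Sum>k. f (R k))" by (intro SUP_least *)
    finally show ?thesis .
  qed
  then show ?thesis using fin_R
    by (metis add.commute ennreal_add_left_cancel_le less_irrefl infinity_ennreal_def)
qed

lemma emeasure_hausdorff:
  fixes S :: "'a::metric_space set"
  assumes "S \<in> sets borel"
  shows "emeasure (hausdorff m) S = hausdorff_outer m S"
proof -
  let ?f = "hausdorff_outer m :: 'a set \<Rightarrow> ennreal"
  let ?L = "lambda_system UNIV UNIV ?f"
  interpret sigma_algebra UNIV "UNIV :: 'a set set" by (metis Pow_UNIV sigma_algebra_Pow)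
  have L: "measure_space UNIV ?L ?f"
    by (rule caratheodory_lemma[OF outer_measure_space_hausdorff])
  then have sL: "sigma_algebra UNIV ?L" by (simp add: measure_space_def)
  have "C \<in> ?L" if "closed C" for C :: "'a set"
    unfolding lambda_system_def
  proof safe
    fix X :: "'a set"
    have "X - C = (UNIV - C) \<inter> X" by auto
    then have 1: "?f (C \<inter> X) + ?f ((UNIV - C) \<inter> X) \<le> ?f X"
      using metric_outer_measure_closed[OF outer_measure_space_hausdorff _ that, of m X]
        hausdorff_outer_separated by metis
    have "subadditive UNIV ?f"
      using countably_subadditive_subadditive outer_measure_space_hausdorff
      unfolding outer_measure_space_def by blast
    from this[unfolded subadditive_def, rule_format, of "C \<inter> X" "(UNIV - C) \<inter> X"]
    have "?f ((C \<inter> X) \<union> ((UNIV - C) \<inter> X)) \<le> ?f (C \<inter> X) + ?f ((UNIV - C) \<inter> X)" by auto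
    moreover have "(C \<inter> X) \<union> ((UNIV - C) \<inter> X) = X" by auto
    ultimately show "?f (C \<inter> X) + ?f ((UNIV - C) \<inter> X) = ?f X" using 1 by (metis antisym)
  qed simp
  then have "sigma_sets UNIV (Collect closed) \<subseteq> ?L"
    using sigma_algebra.sigma_sets_subset[OF sL] by (metis mem_Collect_eq subsetI)
  then have sub: "sets borel \<subseteq> ?L" by (simp add: borel_eq_closed)
  have "measure_space UNIV (sets borel) ?f"
    using L sub unfolding measure_space_def positive_def countably_additive_def
    by (auto simp: sets.sigma_algebra_axioms[of borel, simplified space_borel])
  then show ?thesis using assms
    by (intro emeasure_measure_of[OF hausdorff_def])
      (auto simp: measure_space_def sets.sigma_sets_eq[of borel, simplified space_borel]
        hausdorff_def sets_measure_of)
qed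

section \<open>Positive and negative parts of symmetric matrices\<close>

definition neg_part :: "real \<Rightarrow> real" where
  "neg_part x = x - max x 0"

definition diag_mat :: "real ^ 'n \<Rightarrow> real ^ 'n ^ 'n" where
  "diag_mat d = (\<chi> i j. if i = j then d $ i else 0)"

text \<open>\<open>R g(\<Lambda>) R\<^sup>T\<close> for a symmetric \<open>A = R \<Lambda> R\<^sup>T\<close>; the value does not depend on the choice
  of the orthogonal diagonalisation.\<close>

definition spectral_fun :: "(real \<Rightarrow> real) \<Rightarrow> real ^ 'n ^ 'n \<Rightarrow> real ^ 'n ^ 'n" where
  "spectral_fun g A = (THE B. \<exists>R d. orthogonal_matrix R \<and>
      A = R ** diag_mat d ** transpose R \<and> B = R ** diag_mat (\<chi> i. g (d $ i)) ** transpose R)"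

lemma diag_mat_right: "(M ** diag_mat d) $ i $ j = M $ i $ j * d $ j"
  by (simp add: matrix_matrix_mult_def diag_mat_def if_distrib[of "(*) _"] cong: if_cong)

lemma diag_mat_left: "(diag_mat d ** M) $ i $ j = d $ i * M $ i $ j"
  by (simp add: matrix_matrix_mult_def diag_mat_def if_distribR if_distrib[of "\<lambda>x. x * _"] cong: if_cong)

lemma spectral_fun_unique:
  fixes R S :: "real ^ 'n ^ 'n"
  assumes R: "orthogonal_matrix R" and S: "orthogonal_matrix S"
    and eq: "R ** diag_mat d ** transpose R = S ** diag_mat e ** transpose S"
  shows "R ** diag_mat (\<chi> i. g (d $ i)) ** transpose R = S ** diag_mat (\<chi> i. g (e $ i)) ** transpose S"
proof -
  define P where "P = transpose S ** R"
  have R': "transpose R ** R = mat 1" "R ** transpose R = mat 1"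
    and S': "transpose S ** S = mat 1" "S ** transpose S = mat 1"
    using R S by (auto simp: orthogonal_matrix_def)
  have "transpose S ** (R ** diag_mat d ** transpose R) ** R
      = transpose S ** (S ** diag_mat e ** transpose S) ** R"
    by (simp add: eq)
  moreover have "transpose S ** (R ** diag_mat d ** transpose R) ** R = P ** diag_mat d"
    unfolding P_def by (metis R'(1) matrix_mul_assoc matrix_mul_rid)
  moreover have "transpose S ** (S ** diag_mat e ** transpose S) ** R = diag_mat e ** P"
    unfolding P_def by (metis S'(1) matrix_mul_assoc matrix_mul_lid)
  ultimately have PD: "P ** diag_mat d = diag_mat e ** P" by simp
  have entry: "P $ i $ j * g (d $ j) = g (e $ i) * P $ i $ j" for i j
    using arg_cong[OF PD, of "\<lambda>M. M $ i $ j"] by (auto simp: diag_mat_right diag_mat_left)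
  have PG: "P ** diag_mat (\<chi> i. g (d $ i)) = diag_mat (\<chi> i. g (e $ i)) ** P"
    by (simp add: vec_eq_iff diag_mat_right diag_mat_left entry)
  have "R ** diag_mat (\<chi> i. g (d $ i)) ** transpose R
      = S ** (P ** diag_mat (\<chi> i. g (d $ i))) ** transpose R"
    unfolding P_def by (metis S'(2) matrix_mul_assoc matrix_mul_lid)
  also have "\<dots> = S ** diag_mat (\<chi> i. g (e $ i)) ** transpose S"
    unfolding PG unfolding P_def by (metis R'(2) matrix_mul_assoc matrix_mul_rid)
  finally show ?thesis .
qed

lemma spectral_fun_eq:
  assumes "orthogonal_matrix R" "A = R ** diag_mat d ** transpose R"
  shows "spectral_fun g A = R ** diag_mat (\<chi> i. g (d $ i)) ** transpose R"
  unfolding spectral_fun_def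
  by (rule the_equality) (use assms spectral_fun_unique in \<open>blast+\<close>)

definition scaled_spectral_fun ::
    "(real \<Rightarrow> real) \<Rightarrow> real ^ 'n ^ 'n \<Rightarrow> real ^ 'n ^ 'n \<Rightarrow> real ^ 'n ^ 'n" where
  "scaled_spectral_fun g T A = matrix_inv T ** spectral_fun g (T ** A ** T) ** matrix_inv T"

text \<open>States live in \<open>\<real>\<^sup>d \<times> \<real>\<close>, identified with vectors indexed by the type \<open>'d option\<close>: the
  index \<open>Some i\<close> is the \<open>i\<close>-th velocity component and \<open>None\<close> is the pressure.\<close>

definition vp :: "real ^ 'd \<Rightarrow> real \<Rightarrow> real ^ 'd option" where
  "vp v p = (\<chi> k. case k of Some i \<Rightarrow> v $ i | None \<Rightarrow> p)"

definition A_n :: "real \<Rightarrow> real ^ 'd \<Rightarrow> real ^ 'd \<Rightarrow> real ^ 'd option ^ 'd option" where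
  "A_n \<rho> n v = (\<chi> k l. case k of
       Some i \<Rightarrow> (case l of Some j \<Rightarrow> (if i = j then \<rho> * (v \<bullet> n) else 0) | None \<Rightarrow> n $ i)
     | None \<Rightarrow> (case l of Some j \<Rightarrow> n $ j | None \<Rightarrow> 0))"

definition Theta_mat :: "real \<Rightarrow> real ^ ('d::finite) option ^ 'd option" where
  "Theta_mat \<theta> = diag_mat (vp (\<chi> i. 1) \<theta>)"

definition A_abs :: "real \<Rightarrow> real \<Rightarrow> real ^ 'd \<Rightarrow> real ^ 'd \<Rightarrow> real ^ 'd option ^ 'd option" where
  "A_abs \<rho> \<theta> n v = scaled_spectral_fun abs (Theta_mat \<theta>) (A_n \<rho> n v)"

definition A_neg :: "real \<Rightarrow> real \<Rightarrow> real ^ 'd \<Rightarrow> real ^ 'd \<Rightarrow> real ^ 'd option ^ 'd option" where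
  "A_neg \<rho> \<theta> n v = scaled_spectral_fun neg_part (Theta_mat \<theta>) (A_n \<rho> n v)"

definition alpha :: "real \<Rightarrow> real \<Rightarrow> real ^ 'd \<Rightarrow> real ^ 'd \<Rightarrow> real" where
  "alpha \<rho> \<theta> n v =
     (\<rho> * \<bar>v \<bullet> n\<bar> - sqrt (4 * \<theta>\<^sup>2 + \<rho>\<^sup>2 * (v \<bullet> n)\<^sup>2))\<^sup>2 / (4 * sqrt (4 * \<theta>\<^sup>2 + \<rho>\<^sup>2 * (v \<bullet> n)\<^sup>2))"

definition Q_out :: "real \<Rightarrow> real \<Rightarrow> real ^ 'd \<Rightarrow> real ^ 'd \<Rightarrow> real \<Rightarrow> real \<Rightarrow> real" where
  "Q_out \<rho> \<theta> n v p \<delta> =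
     \<rho> * (1/2 * max (v \<bullet> n) 0 + (1/2 - \<delta>) * neg_part (v \<bullet> n)) * (v \<bullet> n)\<^sup>2
     + 1 / \<theta> * (\<delta> * \<rho> * neg_part (v \<bullet> n) * (v \<bullet> n) + p) * p"

section \<open>Domain and mesh\<close>

record ('d::finite) geometry =
  Omega :: "(real ^ 'd) set"
  mesh :: "(real ^ 'd) set set"
  G_wall :: "(real ^ 'd) set"
  G_in :: "(real ^ 'd) set"
  G_out :: "(real ^ 'd) set"
  G_sym :: "(real ^ 'd) set"
  G_char :: "(real ^ 'd) set"
  nrm :: "real ^ 'd \<Rightarrow> real ^ 'd"

definition surface :: "(real ^ 'd) measure" where
  "surface = hausdorff (CARD('d) - 1)"

text \<open>\<open>\<nu>\<close> is the outward unit normal at \<open>x\<close>: near \<open>x\<close>, the set \<open>\<Omega>\<close> contains every cone around \<open>-\<nu>\<close>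
  and avoids every cone around \<open>\<nu>\<close> that is strictly smaller than a half space.\<close>

definition outward_unit_normal :: "(real ^ 'd) set \<Rightarrow> real ^ 'd \<Rightarrow> real ^ 'd \<Rightarrow> bool" where
  "outward_unit_normal \<Omega> x \<nu> \<longleftrightarrow> norm \<nu> = 1 \<and>
     (\<forall>\<epsilon>>0. \<exists>r>0. \<forall>y \<in> ball x r.
        ((y - x) \<bullet> \<nu> < - \<epsilon> * norm (y - x) \<longrightarrow> y \<in> \<Omega>) \<and>
        ((y - x) \<bullet> \<nu> > \<epsilon> * norm (y - x) \<longrightarrow> y \<notin> \<Omega>))"

text \<open>The \<open>d\<close>-linear map of the unit cube with prescribed images \<open>a S\<close> of the vertices,
  a vertex being identified with the set \<open>S\<close> of its coordinates equal to \<open>1\<close>.\<close>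

definition multilinear_map :: "('d set \<Rightarrow> real ^ 'd) \<Rightarrow> real ^ 'd \<Rightarrow> real ^ 'd" where
  "multilinear_map a \<xi> = (\<Sum>S\<in>UNIV. (\<Prod>i\<in>UNIV. if i \<in> S then \<xi> $ i else 1 - \<xi> $ i) *\<^sub>R a S)"

definition simplicial_cell :: "(real ^ 'd) set \<Rightarrow> bool" where
  "simplicial_cell K \<longleftrightarrow> int CARD('d) simplex K"

text \<open>Quadrilaterals for \<open>d = 2\<close> and hexahedra for \<open>d = 3\<close>.\<close>

definition cubic_cell :: "(real ^ 'd) set \<Rightarrow> bool" where
  "cubic_cell K \<longleftrightarrow> (\<exists>a. K = multilinear_map a ` cbox 0 1 \<and> inj_on (multilinear_map a) (cbox 0 1)
      \<and> (\<forall>\<xi>\<in>cbox 0 1. det (jacobian (multilinear_map a) (at \<xi>)) \<noteq> 0))"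

definition is_mesh :: "(real ^ 'd) set \<Rightarrow> (real ^ 'd) set set \<Rightarrow> bool" where
  "is_mesh \<Omega> \<K> \<longleftrightarrow> finite \<K> \<and> \<Union>\<K> = closure \<Omega>
     \<and> (\<forall>K\<in>\<K>. interior K \<subseteq> \<Omega>)
     \<and> (\<forall>K\<in>\<K>. \<forall>K'\<in>\<K>. K \<noteq> K' \<longrightarrow> interior K \<inter> interior K' = {})
     \<and> ((\<forall>K\<in>\<K>. simplicial_cell K) \<or> (\<forall>K\<in>\<K>. cubic_cell K))"

text \<open>The normal field is outward almost everywhere; on the null set without a tangent plane
  it is any unit vector. Finiteness of the surface measure is automatic for such meshes.\<close>

definition meshed_domain :: "('d::finite) geometry \<Rightarrow> bool" where
  "meshed_domain G \<longleftrightarrow>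
     Omega G \<noteq> {} \<and> open (Omega G) \<and> connected (Omega G) \<and> bounded (Omega G)
     \<and> is_mesh (Omega G) (mesh G)
     \<and> emeasure surface (frontier (Omega G)) < \<infinity>
     \<and> nrm G \<in> borel_measurable borel \<and> (\<forall>x\<in>frontier (Omega G). norm (nrm G x) = 1)
     \<and> (AE x in surface. x \<in> frontier (Omega G) \<longrightarrow> outward_unit_normal (Omega G) x (nrm G x))
     \<and> (\<forall>\<Gamma> \<in> {G_wall G, G_in G, G_out G, G_sym G, G_char G}. \<Gamma> \<in> sets borel)
     \<and> G_wall G \<union> G_in G \<union> G_out G \<union> G_sym G \<union> G_char G = frontier (Omega G)
     \<and> disjoint_family_on (\<lambda>k. [G_wall G, G_in G, G_out G, G_sym G, G_char G] ! k) {..<5}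
     \<and> (\<exists>a b. a \<noteq> 0 \<and> G_sym G \<subseteq> {x. a \<bullet> x = b})"

section \<open>Finite element functions\<close>

definition pd :: "'d \<Rightarrow> (real ^ 'd \<Rightarrow> 'b::real_normed_vector) \<Rightarrow> real ^ 'd \<Rightarrow> 'b" where
  "pd i f x = frechet_derivative f (at x) (axis i 1)"

text \<open>One-sided trace from the cell \<open>K\<close>.\<close>

definition cell_trace :: "(real ^ 'd) set \<Rightarrow> (real ^ 'd \<Rightarrow> 'b::t2_space) \<Rightarrow> real ^ 'd \<Rightarrow> 'b" where
  "cell_trace K g x = Lim (at x within interior K) g"

definition extends_continuously :: "(real ^ 'd) set \<Rightarrow> (real ^ 'd \<Rightarrow> 'b::t2_space) \<Rightarrow> bool" where
  "extends_continuously K g \<longleftrightarrow> (\<exists>h. continuous_on K h \<and> (\<forall>x\<in>interior K. h x = g x))"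

definition smooth_up_to :: "(real ^ 'd) set \<Rightarrow> (real ^ 'd \<Rightarrow> 'b::real_normed_vector) \<Rightarrow> bool" where
  "smooth_up_to K f \<longleftrightarrow>
     (\<forall>x\<in>interior K. f differentiable (at x) \<and> (\<forall>i. pd i f differentiable (at x)))
     \<and> (\<forall>i. extends_continuously K (pd i f))
     \<and> (\<forall>i j. extends_continuously K (pd i (pd j f)))"

definition lincomb :: "('a \<Rightarrow> 'b::real_vector) set \<Rightarrow> (('a \<Rightarrow> 'b) \<Rightarrow> real) \<Rightarrow> 'a \<Rightarrow> 'b" where
  "lincomb B c = (\<lambda>x. \<Sum>b\<in>B. c b *\<^sub>R b x)"

text \<open>A finite-dimensional space of continuous functions that are twice continuously
  differentiable on each closed cell. Continuous piecewise (mapped) polynomials of any degree,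
  with or without bubble functions, are of this kind.\<close>

definition fe_space :: "('d::finite) geometry \<Rightarrow> (real ^ 'd \<Rightarrow> 'b::real_normed_vector) set \<Rightarrow> bool" where
  "fe_space G V \<longleftrightarrow> (\<exists>B. finite B \<and> V = range (lincomb B)
     \<and> (\<forall>b\<in>B. continuous_on (closure (Omega G)) b \<and> (\<forall>K\<in>mesh G. smooth_up_to K b)))"

text \<open>Functions of time with values in \<open>V\<close>, differentiable in the sense that the
  coefficients are differentiable.\<close>

definition fe_curve :: "real set \<Rightarrow> ('a \<Rightarrow> 'b::real_vector) set \<Rightarrow> (real \<Rightarrow> 'a \<Rightarrow> 'b) \<Rightarrow> bool" where
  "fe_curve I V \<phi> \<longleftrightarrow> (\<exists>B c. finite B \<and> B \<subseteq> V \<and> (\<forall>t\<in>I. \<phi> t = lincomb B (c t))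
     \<and> (\<forall>b\<in>B. \<forall>t\<in>I. (\<lambda>s. c s b) differentiable (at t)))"

definition dt :: "(real \<Rightarrow> 'a \<Rightarrow> 'b::real_normed_vector) \<Rightarrow> real \<Rightarrow> 'a \<Rightarrow> 'b" where
  "dt \<phi> t x = vector_derivative (\<lambda>s. \<phi> s x) (at t)"

definition dv :: "(real ^ 'd \<Rightarrow> real ^ 'd) \<Rightarrow> real ^ 'd \<Rightarrow> real" where
  "dv \<phi> x = (\<Sum>i\<in>UNIV. pd i \<phi> x $ i)"

definition grad :: "(real ^ 'd \<Rightarrow> real) \<Rightarrow> real ^ 'd \<Rightarrow> real ^ 'd" where
  "grad q x = (\<chi> i. pd i q x)"

definition adv :: "real ^ 'd \<Rightarrow> (real ^ 'd \<Rightarrow> 'b::real_normed_vector) \<Rightarrow> real ^ 'd \<Rightarrow> 'b" where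
  "adv w \<phi> x = (\<Sum>i\<in>UNIV. w $ i *\<^sub>R pd i \<phi> x)"

definition lap :: "(real ^ 'd \<Rightarrow> 'b::real_normed_vector) \<Rightarrow> real ^ 'd \<Rightarrow> 'b" where
  "lap \<phi> x = (\<Sum>i\<in>UNIV. pd i (pd i \<phi>) x)"

definition grad_prod :: "(real ^ 'd \<Rightarrow> real ^ 'd) \<Rightarrow> (real ^ 'd \<Rightarrow> real ^ 'd) \<Rightarrow> real ^ 'd \<Rightarrow> real" where
  "grad_prod v \<phi> x = (\<Sum>i\<in>UNIV. pd i v x \<bullet> pd i \<phi> x)"

text \<open>Normal derivative on the boundary, and its normal component, as seen from the cell \<open>K\<close>.\<close>

definition dn :: "('d::finite) geometry \<Rightarrow> (real ^ 'd) set \<Rightarrow> (real ^ 'd \<Rightarrow> real ^ 'd) \<Rightarrow> real ^ 'd \<Rightarrow> real ^ 'd" where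
  "dn G K \<phi> x = (\<Sum>i\<in>UNIV. nrm G x $ i *\<^sub>R cell_trace K (pd i \<phi>) x)"

definition dnn :: "('d::finite) geometry \<Rightarrow> (real ^ 'd) set \<Rightarrow> (real ^ 'd \<Rightarrow> real ^ 'd) \<Rightarrow> real ^ 'd \<Rightarrow> real" where
  "dnn G K \<phi> x = dn G K \<phi> x \<bullet> nrm G x"

text \<open>Boundary integrals, split over the boundary faces of the cells: the integrand may depend
  on the adjacent cell.\<close>

definition bdint :: "('d::finite) geometry \<Rightarrow> (real ^ 'd) set \<Rightarrow> ((real ^ 'd) set \<Rightarrow> real ^ 'd \<Rightarrow> real) \<Rightarrow> real" where
  "bdint G \<Gamma> g = (\<Sum>K\<in>mesh G. LINT x:(\<Gamma> \<inter> K)|surface. g K x)"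

section \<open>The discrete problem\<close>

record flow_par =
  rho :: real
  mu :: real
  gam :: real
  gam1 :: real
  gam2 :: real

record ('d::finite) flow_data =
  src :: "real \<Rightarrow> real ^ 'd \<Rightarrow> real ^ 'd"
  vD :: "real \<Rightarrow> real ^ 'd \<Rightarrow> real ^ 'd"
  pD :: "real \<Rightarrow> real ^ 'd \<Rightarrow> real"

type_synonym 'd state = "(real ^ 'd \<Rightarrow> real ^ 'd) \<times> (real ^ 'd \<Rightarrow> real)"

text \<open>The weight \<open>\<theta>\<close> is given cell by cell and may depend on the discrete state.\<close>

type_synonym 'd weight = "'d state \<Rightarrow> (real ^ 'd) set \<Rightarrow> real ^ 'd \<Rightarrow> real"

definition a_Eu :: "('d::finite) geometry \<Rightarrow> flow_par \<Rightarrow> 'd weight \<Rightarrow> 'd state \<Rightarrow> 'd state \<Rightarrow> real" where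
  "a_Eu G P \<theta> u \<psi> =
    (let \<rho> = rho P; n = nrm G; v = fst u; p = snd u; \<phi> = fst \<psi>; q = snd \<psi> in
      (LINT x:Omega G|lebesgue. \<rho> / 2 * (adv (v x) v x \<bullet> \<phi> x - v x \<bullet> adv (v x) \<phi> x))
    + (LINT x:Omega G|lebesgue. q x * dv v x - p x * dv \<phi> x)
    + bdint G (G_char G) (\<lambda>K x. \<rho> / 2 * (v x \<bullet> n x) * (v x \<bullet> \<phi> x) + p x * (\<phi> x \<bullet> n x)
        - (A_neg \<rho> (\<theta> u K x) (n x) (v x) *v vp (v x) (p x)) \<bullet> vp (\<phi> x) (q x))
    + bdint G (G_wall G \<union> G_sym G \<union> G_in G) (\<lambda>K x. \<rho> / 2 * \<bar>v x \<bullet> n x\<bar> * (v x \<bullet> \<phi> x)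
        + alpha \<rho> (\<theta> u K x) (n x) (v x) * (v x \<bullet> n x) * (\<phi> x \<bullet> n x)
        - q x * (v x \<bullet> n x) + p x * (\<phi> x \<bullet> n x))
    + bdint G (G_out G) (\<lambda>K x. \<rho> / 2 * \<bar>v x \<bullet> n x\<bar> * (v x \<bullet> \<phi> x)
        + 1 / \<theta> u K x * (\<rho> * neg_part (v x \<bullet> n x) * (v x \<bullet> n x) + p x) * q x))"

definition l_Eu :: "('d::finite) geometry \<Rightarrow> flow_par \<Rightarrow> 'd weight \<Rightarrow> 'd flow_data \<Rightarrow> real
    \<Rightarrow> 'd state \<Rightarrow> 'd state \<Rightarrow> real" where
  "l_Eu G P \<theta> D t u \<psi> =
    (let \<rho> = rho P; n = nrm G; v = fst u; \<phi> = fst \<psi>; q = snd \<psi> in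
      (LINT x:Omega G|lebesgue. src D t x \<bullet> \<phi> x)
    - bdint G (G_char G) (\<lambda>K x.
        (A_neg \<rho> (\<theta> u K x) (n x) (v x) *v vp (vD D t x) (pD D t x)) \<bullet> vp (\<phi> x) (q x))
    + bdint G (G_in G) (\<lambda>K x. - \<rho> * neg_part (v x \<bullet> n x) * (vD D t x \<bullet> \<phi> x)
        + alpha \<rho> (\<theta> u K x) (n x) (v x) * (vD D t x \<bullet> n x) * (\<phi> x \<bullet> n x)
        - q x * (vD D t x \<bullet> n x))
    + bdint G (G_out G) (\<lambda>K x. 1 / \<theta> u K x * pD D t x * q x - pD D t x * (\<phi> x \<bullet> n x)))"

definition a_visc :: "('d::finite) geometry \<Rightarrow> flow_par \<Rightarrow> 'd weight \<Rightarrow> 'd state \<Rightarrow> 'd state \<Rightarrow> real" where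
  "a_visc G P \<theta> u \<psi> =
    (let n = nrm G; v = fst u; p = snd u; \<phi> = fst \<psi>; q = snd \<psi> in
      (LINT x:Omega G|lebesgue. grad_prod v \<phi> x)
    - bdint G (G_wall G \<union> G_in G) (\<lambda>K x. dn G K v x \<bullet> \<phi> x
        + v x \<bullet> (dn G K \<phi> x - (gam P / diameter K) *\<^sub>R \<phi> x))
    - bdint G (G_sym G) (\<lambda>K x. dnn G K v x * (\<phi> x \<bullet> n x)
        + (v x \<bullet> n x) * (dnn G K \<phi> x - gam P / diameter K * (\<phi> x \<bullet> n x)))
    - bdint G (G_out G) (\<lambda>K x. 1 / \<theta> u K x *
        (dnn G K v x * q x + dnn G K \<phi> x * p x - mu P * dnn G K v x * dnn G K \<phi> x)))"

definition l_visc :: "('d::finite) geometry \<Rightarrow> flow_par \<Rightarrow> 'd weight \<Rightarrow> 'd flow_data \<Rightarrow> real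
    \<Rightarrow> 'd state \<Rightarrow> (real ^ 'd \<Rightarrow> real ^ 'd) \<Rightarrow> real" where
  "l_visc G P \<theta> D t u \<phi> =
    - bdint G (G_in G) (\<lambda>K x. vD D t x \<bullet> (dn G K \<phi> x - (gam P / diameter K) *\<^sub>R \<phi> x))
    - bdint G (G_out G) (\<lambda>K x. 1 / \<theta> u K x * dnn G K \<phi> x * pD D t x)"

text \<open>The outflow condition imposed by \<open>a_Eu\<close> and \<open>l_Eu\<close> has the residual
  \<open>\<rho> v\<^sub>n\<^sup>- v\<^sub>n + p - pD\<close> (and \<open>- \<mu> \<partial>\<^sub>n v \<cdot> n\<close> is added by the viscous forms). In \<open>a_visc\<close>,
  however, the test function \<open>\<partial>\<^sub>n \<phi> \<cdot> n\<close> is applied to \<open>p - \<mu> \<partial>\<^sub>n v \<cdot> n - pD\<close> only. The following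
  form is the missing convective part; it vanishes unless there is backflow
  (\<open>v\<^sub>n < 0\<close>) at the outflow boundary.\<close>

definition backflow :: "('d::finite) geometry \<Rightarrow> flow_par \<Rightarrow> 'd weight \<Rightarrow> 'd state \<Rightarrow> 'd state \<Rightarrow> real" where
  "backflow G P \<theta> u \<psi> =
    (let v = fst u; \<phi> = fst \<psi>; n = nrm G in
      bdint G (G_out G) (\<lambda>K x. 1 / \<theta> u K x * dnn G K \<phi> x
        * (rho P * neg_part (v x \<bullet> n x) * (v x \<bullet> n x))))"

text \<open>\<open>\<kappa> = 0\<close> is the form without the convective part in the viscous outflow term,
  \<open>\<kappa> = 1\<close> the one with it.\<close>

definition a_NaSt :: "real \<Rightarrow> ('d::finite) geometry \<Rightarrow> flow_par \<Rightarrow> 'd weight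
    \<Rightarrow> 'd state \<Rightarrow> 'd state \<Rightarrow> real" where
  "a_NaSt \<kappa> G P \<theta> u \<psi> = a_Eu G P \<theta> u \<psi> + mu P * (a_visc G P \<theta> u \<psi> - \<kappa> * backflow G P \<theta> u \<psi>)"

definition l_NaSt :: "('d::finite) geometry \<Rightarrow> flow_par \<Rightarrow> 'd weight \<Rightarrow> 'd flow_data \<Rightarrow> real
    \<Rightarrow> 'd state \<Rightarrow> 'd state \<Rightarrow> real" where
  "l_NaSt G P \<theta> D t u \<psi> = l_Eu G P \<theta> D t u \<psi> + mu P * l_visc G P \<theta> D t u (fst \<psi>)"

text \<open>The stabilisation contains time derivatives of the test functions; its arguments are
  therefore functions of time, and the forms are evaluated at time \<open>t\<close>.\<close>

definition E_op :: "flow_par \<Rightarrow> (real \<Rightarrow> 'd state) \<Rightarrow> (real \<Rightarrow> 'd state) \<Rightarrow> real \<Rightarrow> real ^ 'd \<Rightarrow> real ^ 'd" where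
  "E_op P u \<psi> t x = rho P *\<^sub>R dt (\<lambda>s. fst (\<psi> s)) t x + rho P *\<^sub>R adv (fst (u t) x) (fst (\<psi> t)) x
     - mu P *\<^sub>R lap (fst (\<psi> t)) x + grad (snd (\<psi> t)) x"

definition a_stab :: "('d::finite) geometry \<Rightarrow> flow_par \<Rightarrow> 'd weight \<Rightarrow> real
    \<Rightarrow> (real \<Rightarrow> 'd state) \<Rightarrow> (real \<Rightarrow> 'd state) \<Rightarrow> real" where
  "a_stab G P \<theta> t u \<psi> = (\<Sum>K\<in>mesh G.
      (LINT x:K|lebesgue. gam1 P * diameter K / \<theta> (u t) K x * (E_op P u u t x \<bullet> E_op P u \<psi> t x))
    + (LINT x:K|lebesgue. gam2 P * diameter K * \<theta> (u t) K x * (dv (fst (u t)) x * dv (fst (\<psi> t)) x)))"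

definition l_stab :: "('d::finite) geometry \<Rightarrow> flow_par \<Rightarrow> 'd weight \<Rightarrow> 'd flow_data \<Rightarrow> real
    \<Rightarrow> (real \<Rightarrow> 'd state) \<Rightarrow> (real \<Rightarrow> 'd state) \<Rightarrow> real" where
  "l_stab G P \<theta> D t u \<psi> = (\<Sum>K\<in>mesh G.
      LINT x:K|lebesgue. gam1 P * diameter K / \<theta> (u t) K x * (src D t x \<bullet> E_op P u \<psi> t x))"

definition admissible_par :: "flow_par \<Rightarrow> bool" where
  "admissible_par P \<longleftrightarrow> rho P > 0 \<and> mu P \<ge> 0 \<and> gam1 P > 0 \<and> gam2 P > 0"

text \<open>The characteristic data are the restriction of \<open>(vD, pD)\<close> to \<open>G_char\<close>.\<close>

definition admissible_data :: "('d::finite) geometry \<Rightarrow> real set \<Rightarrow> 'd flow_data \<Rightarrow> bool" where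
  "admissible_data G I D \<longleftrightarrow> (\<forall>t\<in>I.
      set_integrable lebesgue (Omega G) (src D t)
    \<and> set_integrable surface (G_in G \<union> G_char G) (vD D t)
    \<and> set_integrable surface (G_out G \<union> G_char G) (pD D t)
    \<and> (\<forall>x\<in>G_wall G. vD D t x = 0))"

definition vanishing_data :: "('d::finite) geometry \<Rightarrow> real set \<Rightarrow> 'd flow_data \<Rightarrow> bool" where
  "vanishing_data G I D \<longleftrightarrow> (\<forall>t\<in>I.
      (\<forall>x\<in>Omega G. src D t x = 0)
    \<and> (\<forall>x\<in>G_in G \<union> G_char G \<union> G_wall G. vD D t x = 0)
    \<and> (\<forall>x\<in>G_out G \<union> G_char G. pD D t x = 0))"

text \<open>Positivity and regularity of the weight are only needed along the discrete solution.\<close>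

definition admissible_weight :: "('d::finite) geometry \<Rightarrow> real set \<Rightarrow> (real \<Rightarrow> 'd state) \<Rightarrow> 'd weight \<Rightarrow> bool" where
  "admissible_weight G I u \<theta> \<longleftrightarrow> (\<forall>t\<in>I. \<forall>K\<in>mesh G.
      continuous_on K (\<theta> (u t) K) \<and> (\<forall>x\<in>K. \<theta> (u t) K x > 0))"

definition discrete_solution :: "real \<Rightarrow> ('d::finite) geometry \<Rightarrow> (real ^ 'd \<Rightarrow> real ^ 'd) set
    \<Rightarrow> (real ^ 'd \<Rightarrow> real) set \<Rightarrow> flow_par \<Rightarrow> 'd weight \<Rightarrow> 'd flow_data \<Rightarrow> real set
    \<Rightarrow> (real \<Rightarrow> 'd state) \<Rightarrow> bool" where
  "discrete_solution \<kappa> G V W P \<theta> D I u \<longleftrightarrow>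
     open I \<and> is_interval I \<and> admissible_par P \<and> admissible_data G I D \<and> admissible_weight G I u \<theta>
   \<and> fe_curve I V (\<lambda>t. fst (u t)) \<and> (\<forall>t\<in>I. snd (u t) \<in> W)
   \<and> (\<forall>\<psi>. fe_curve I V (\<lambda>t. fst (\<psi> t)) \<and> fe_curve I W (\<lambda>t. snd (\<psi> t)) \<longrightarrow> (\<forall>t\<in>I.
        rho P * (LINT x:Omega G|lebesgue. dt (\<lambda>s. fst (u s)) t x \<bullet> fst (\<psi> t) x)
          + a_NaSt \<kappa> G P \<theta> (u t) (\<psi> t) + a_stab G P \<theta> t u \<psi>
        = l_NaSt G P \<theta> D t (u t) (\<psi> t) + l_stab G P \<theta> D t u \<psi>))"

definition kinetic_energy :: "('d::finite) geometry \<Rightarrow> flow_par \<Rightarrow> (real \<Rightarrow> 'd state) \<Rightarrow> real \<Rightarrow> real" where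
  "kinetic_energy G P u t = (LINT x:Omega G|lebesgue. rho P / 2 * (fst (u t) x \<bullet> fst (u t) x))"

end

theory Submission
  imports Defs
begin

text \<open>Testing with \<open>u\<^sub>h\<close> itself makes all volume terms of the Euler form cancel by skew-symmetry, so no
  integration by parts is needed and the energy identity is an algebraic identity between the
  boundary integrands. The matrix terms follow from an explicit spectral decomposition of
  \<open>\<Theta> A\<^sub>n \<Theta>\<close>, whose eigenvectors lie in \<open>n\<^sup>\<bottom>\<close> and in the plane of \<open>(n, 0)\<close> and \<open>(0, 1)\<close>.
  Since the pressure need not be differentiable in time, the test function freezes it at time \<open>t\<close>.

  For the stability assertion, an inverse trace inequality on the finite-dimensional velocity space
  (from Gram-Schmidt in \<open>L\<^sup>2(K)\<close>) bounds the normal derivatives on the boundary by the viscous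
  dissipation, so a large
  penalty \<open>\<gamma>\<close> absorbs the consistency terms by Young's inequality. At the outflow the choice of
  \<open>\<theta>\<close> gives \<open>\<theta> \<ge> \<rho> \<bar>v\<^sub>n\<bar>\<close>, which makes the quadratic function \<open>Q\<close> of the pressure nonnegative.\<close>

section \<open>Mesh cells\<close>

text \<open>The parameter \<kappa> records an algebraic mismatch. \<open>Q_out\<close> at \<delta> =
  1 multiplies the convective outflow term by all of \<open>p - \<mu> * d\<close>, with
  \<open>d\<close> the normal component of the normal derivative, while \<open>a_visc\<close> tested
  with the solution contains no product of that term with \<open>d\<close>. The difference is
  exactly \<open>backflow\<close>: it cancels for \<kappa> = 1 and remains in the identity for
  \<kappa> = 0. A Bochner integral that does not exist is 0 and not additive, so every splitting of
  a boundary integral needs the integrability of its pieces. Discrete functions and weights are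
  bounded and measurable on each face, whereas the data are only integrable and must stay linear
  against a bounded factor. The thresholds for \<gamma> and \<open>c_St\<close> have to be chosen
  before parameters, weight and solution. They come from a trace constant of the geometry and the
  velocity space alone.\<close>

lemma interior_simplicial:
  assumes "simplicial_cell K"
  shows "convex K" "compact K" "interior K \<noteq> {}"
proof -
  obtain C where C: "\<not> affine_dependent C" "card C = CARD('a) + 1" "K = convex hull C"
    using assms unfolding simplicial_cell_def simplex_def by auto
  show "convex K" using C by simp
  show "compact K" using assms unfolding simplicial_cell_def by (rule compact_simplex)
  have "aff_dim K = int CARD('a)"
    using assms unfolding simplicial_cell_def by (rule aff_dim_simplex)
  then have "aff_dim K = int DIM(real^'a)" by simp
  \<comment> \<open>With full affine dimension the interior is the relative interior, which is
    nonempty for a nonempty convex set.\<close>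
  then show "interior K \<noteq> {}"
    using \<open>convex K\<close> aff_dim_eq_full[of K] rel_interior_interior[of K] rel_interior_eq_empty[of K]
    by (metis aff_dim_empty_eq of_nat_0_le_iff not_one_le_zero neg_0_le_iff_le)
qed

lemma differentiable_multilinear_map:
  "multilinear_map a differentiable (at \<xi> within S)"
  proof -
  have *: "(\<lambda>\<xi>. if i \<in> T then \<xi> $ i else 1 - \<xi> $ i) differentiable (at \<xi> within S)" for i :: 'a and T
    by (cases "i \<in> T") (simp_all add: bounded_linear_imp_differentiable bounded_linear_vec_nth)
  have "(\<lambda>\<xi>. \<Prod>i\<in>F. if i \<in> T then \<xi> $ i else 1 - \<xi> $ i) differentiable (at \<xi> within S)"
    if "finite F" for F T :: "'a set"
    using that by (induction F rule: finite_induct) (auto intro!: differentiable_mult *)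
  then show ?thesis unfolding multilinear_map_def[abs_def] by (intro derivative_intros) auto
qed

text \<open>The analysis rests on these facts about cells: a dense interior makes one-sided traces
  unique, and a null cell boundary makes integrals over a cell and over its interior agree.
  Simplices obtain them from convexity; images of the cube may be nonconvex and require a separate
  argument.\<close>

lemma cell_properties:
  assumes "simplicial_cell K \<or> cubic_cell K"
  shows "compact K" and "K \<subseteq> closure (interior K)"
    and "negligible (K - interior K)" and "interior K \<noteq> {}"
proof -
  have "compact K \<and> K \<subseteq> closure (interior K) \<and> negligible (K - interior K) \<and> interior K \<noteq> {}"
  proof (cases "simplicial_cell K")
    case True
    note S = interior_simplicial[OF True]
    have "negligible (frontier K)" using S by (rule_tac negligible_convex_frontier)
    then have "negligible (K - interior K)"
      by (rule negligible_subset) (use S(2) in \<open>auto simp: frontier_def dest: compact_imp_closed\<close>)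
    moreover have "K \<subseteq> closure (interior K)"
      using convex_closure_interior[OF S(1,3)] closure_subset by auto
    ultimately show ?thesis using S by blast
  next
    case False
    then obtain a where K: "K = multilinear_map a ` cbox 0 1" "inj_on (multilinear_map a) (cbox 0 1)"
      using assms unfolding cubic_cell_def by blast
    let ?f = "multilinear_map a"
    have cont: "continuous_on S ?f" for S
      by (intro differentiable_imp_continuous_on) (simp add: differentiable_on_def differentiable_multilinear_map)
    have ne: "box (0::real^'a) 1 \<noteq> {}" 
      by (auto simp: box_ne_empty Basis_vec_def inner_axis)
    \<comment> \<open>Invariance of domain: an injective continuous map between spaces of equal
      dimension is open. What the open cube misses lies in the image of its faces, a null set under
      a differentiable map.\<close>
    have "open (?f ` box 0 1)"
      by (rule invariance_of_domain[OF cont open_box]) (meson K(2) box_subset_cbox inj_on_subset)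
    then have int: "?f ` box 0 1 \<subseteq> interior K"
      by (rule interior_maximal[rotated]) (auto simp: K(1) intro: subsetD[OF box_subset_cbox])
    have "K = ?f ` closure (box 0 1)" using ne by (simp add: K(1) closure_box)
    also have "\<dots> \<subseteq> closure (?f ` box 0 1)" by (rule image_closure_subset[OF cont]) (auto simp: closure_subset)
    also have "\<dots> \<subseteq> closure (interior K)" using int by (rule closure_mono)
    finally have 1: "K \<subseteq> closure (interior K)" .
    have "negligible (?f ` (cbox 0 1 - box 0 1))"
      by (rule negligible_differentiable_image_negligible)
        (auto simp: negligible_frontier_interval differentiable_on_def differentiable_multilinear_map)
    then have 2: "negligible (K - interior K)" by (rule negligible_subset) (use int K(1) in auto)
    show ?thesis using 1 2 ne int K(1) cont by (auto intro: compact_continuous_image)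
  qed
  then show "compact K" "K \<subseteq> closure (interior K)" "negligible (K - interior K)" "interior K \<noteq> {}" by auto
qed

lemma diameter_pos:
  fixes K :: "'a::euclidean_space set"
  assumes "bounded K" "interior K \<noteq> {}"
  shows "diameter K > 0"
proof -
  obtain x e where e: "e > 0" "ball x e \<subseteq> K" using assms(2) by (metis ex_in_conv mem_interior)
  then have "diameter (ball x e) \<le> diameter K" by (intro diameter_subset assms)
  then show ?thesis using e by simp
qed

section \<open>The normal flux matrix\<close>

lemma inner_option: "(x :: real ^ ('d::finite) option) \<bullet> y = (\<chi> i. x $ Some i) \<bullet> (\<chi> i. y $ Some i) + x $ None * y $ None"
  by (simp add: inner_vec_def UNIV_option_conv sum.reindex)

lemma vp_nth [simp]: "vp v p $ Some i = v $ i" "vp v p $ None = p"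
  by (simp_all add: vp_def)

lemma vp_inner [simp]: "vp v p \<bullet> vp w q = v \<bullet> w + p * q"
  by (simp add: inner_option)

lemma vp_eqI: "(\<And>i. x $ Some i = v $ i) \<Longrightarrow> x $ None = p \<Longrightarrow> x = vp v p"
  by (simp add: vec_eq_iff vp_def split: option.split)

lemma vp_cases: obtains v p where "x = vp v p"
  using vp_eqI[of x "\<chi> i. x $ Some i" "x $ None"] by simp

lemma vp_scale: "c *\<^sub>R vp v p = vp (c *\<^sub>R v) (c * p)"
  by (rule vp_eqI) simp_all

lemma diag_vec: "diag_mat d *v x = (\<chi> i. d $ i * x $ i)"
  by (simp add: vec_eq_iff matrix_vector_mult_def diag_mat_def if_distribR if_distrib[of "\<lambda>x. x * _"] cong: if_cong)

lemma A_n_vp: "A_n \<rho> n v *v vp w p = vp ((\<rho> * (v \<bullet> n)) *\<^sub>R w + p *\<^sub>R n) (w \<bullet> n)"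
  by (rule vp_eqI) (simp_all add: A_n_def matrix_vector_mult_def UNIV_option_conv sum.reindex
      if_distribR if_distrib[of "\<lambda>x. x * _"] inner_vec_def mult_ac if_distrib[of "(*) _"] cong: if_cong)

lemma Theta_vp: "Theta_mat \<theta> *v vp w p = vp w (\<theta> * p)"
  unfolding Theta_mat_def diag_vec by (rule vp_eqI) simp_all

lemma Theta_inv_vp:
  assumes "\<theta> \<noteq> 0"
  shows "matrix_inv (Theta_mat \<theta>) *v vp (w :: real ^ 'd::finite) p = vp w (p / \<theta>)"
proof -
  let ?T = "Theta_mat :: real \<Rightarrow> real ^ 'd option ^ 'd option"
  have 1: "?T \<theta> ** ?T (1/\<theta>) = mat 1" "?T (1/\<theta>) ** ?T \<theta> = mat 1" if "\<theta> \<noteq> 0" for \<theta> :: real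
    using that by (simp_all add: matrix_eq) (metis (no_types, lifting) Theta_vp vp_cases matrix_vector_mul_assoc matrix_vector_mul_lid times_divide_eq_right mult.assoc mult_1 nonzero_mult_div_cancel_left divide_inverse_commute)+
  have "?T \<theta> ** matrix_inv (?T \<theta>) = mat 1"
    unfolding matrix_inv_def by (rule someI2[of _ "?T (1/\<theta>)"]) (use 1[OF assms] in auto)
  then have "matrix_inv (?T \<theta>) = ?T (1/\<theta>)"
    using 1[OF assms] by (metis matrix_mul_assoc matrix_mul_lid matrix_mul_rid)
  then show ?thesis by (simp add: Theta_vp)
qed

lemma Theta_inv_sym:
  assumes "\<theta> \<noteq> 0"
  shows "(matrix_inv (Theta_mat \<theta>) *v x) \<bullet> y = x \<bullet> (matrix_inv (Theta_mat \<theta>) *v y)"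
  by (cases x rule: vp_cases, cases y rule: vp_cases) (simp add: Theta_inv_vp assms)

text \<open>Orthonormal eigenvectors already form a diagonalisation, and
  \<open>spectral_fun_eq\<close> then resolves the definite description. Only the bilinear form is
  recorded, because \<open>A_abs\<close> and \<open>A_neg\<close> always occur paired with a
  vector.\<close>

lemma spectral_fun_inner:
  fixes R :: "real ^ 'n ^ 'n"
  assumes R: "orthogonal_matrix R" and ev: "\<And>k. A *v column k R = (d $ k) *\<^sub>R column k R"
  shows "(spectral_fun g A *v x) \<bullet> y = (\<Sum>k\<in>UNIV. g (d $ k) * (column k R \<bullet> x) * (column k R \<bullet> y))"
proof -
  have RR: "transpose R ** R = mat 1" "R ** transpose R = mat 1" using R by (auto simp: orthogonal_matrix_def)
  have "(A ** R) $ i $ k = (R ** diag_mat d) $ i $ k" for i k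
    using arg_cong[OF ev[of k], of "\<lambda>z. z $ i"]
    by (simp add: diag_mat_right) (simp add: column_def matrix_vector_mult_def matrix_matrix_mult_def mult.commute)
  then have "A ** R = R ** diag_mat d" by (simp add: vec_eq_iff)
  then have "A = R ** diag_mat d ** transpose R"
    by (metis RR(2) matrix_mul_assoc matrix_mul_rid)
  then have "spectral_fun g A = R ** diag_mat (\<chi> i. g (d $ i)) ** transpose R" by (rule spectral_fun_eq[OF R])
  then have "(spectral_fun g A *v x) \<bullet> y = (diag_mat (\<chi> i. g (d $ i)) *v (transpose R *v x)) \<bullet> (transpose R *v y)"
    by (simp add: matrix_vector_mul_assoc[symmetric]) (metis dot_lmul_matrix inner_commute)
  also have "\<dots> = (\<Sum>k\<in>UNIV. g (d $ k) * (column k R \<bullet> x) * (column k R \<bullet> y))"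
    unfolding diag_vec by (simp add: inner_vec_def matrix_vector_mult_def transpose_def column_def)
  finally show ?thesis .
qed
lemma orthogonal_matrix_of_columns:
  fixes r :: "'n::finite \<Rightarrow> real ^ 'n"
  assumes "\<And>j k. r j \<bullet> r k = (if j = k then 1 else 0)"
  shows "orthogonal_matrix (\<chi> i j. r j $ i)"
  using assms by (simp add: orthogonal_matrix vec_eq_iff matrix_matrix_mult_def transpose_def mat_def inner_vec_def)

text \<open>On the plane of \<open>(n, 0)\<close> and \<open>(0, 1)\<close> the matrix \<open>\<Theta> A\<^sub>n \<Theta>\<close> acts as \<open>((a, \<theta>), (\<theta>, 0))\<close>, with
  eigenvalues \<open>l1 > 0 > l2\<close> and eigenvectors \<open>(l1, \<theta>)\<close>, \<open>(l2, \<theta>)\<close>; on \<open>n\<^sup>\<bottom>\<close> it is \<open>a I\<close>.\<close>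

context
  fixes \<rho> \<theta> :: real and n v :: "real ^ 'd::finite" and a s l1 l2 :: real
  assumes n: "norm n = 1" and \<theta>: "\<theta> > 0"
  defines "a \<equiv> \<rho> * (v \<bullet> n)" and "s \<equiv> sqrt (4 * \<theta>\<^sup>2 + \<rho>\<^sup>2 * (v \<bullet> n)\<^sup>2)"
    and "l1 \<equiv> (a + s) / 2" and "l2 \<equiv> (a - s) / 2"
begin

lemma discriminant_facts: "s > 0" "s\<^sup>2 = 4 * \<theta>\<^sup>2 + a\<^sup>2" "\<bar>a\<bar> < s"
proof -
  have *: "0 < 4 * \<theta>\<^sup>2 + \<rho>\<^sup>2 * (v \<bullet> n)\<^sup>2" using \<theta> by (simp add: add_pos_nonneg)
  then show "s > 0" "s\<^sup>2 = 4 * \<theta>\<^sup>2 + a\<^sup>2" by (simp_all add: s_def a_def power_mult_distrib)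
  then show "\<bar>a\<bar> < s" using \<theta> by (intro power2_less_imp_less[of "\<bar>a\<bar>" s]) auto
qed

text \<open>Vieta's formulas for \<open>\<lambda>^2 - a \<lambda> - \<theta>^2\<close>, the
  characteristic polynomial of the planar block. The last two equations are the squared lengths of
  the eigenvectors.\<close>

lemma eigenvalue_facts: "l1 > 0" "l2 < 0" "l1 * l2 = - \<theta>\<^sup>2" "l1 - l2 = s" "l1 + l2 = a" "l1\<^sup>2 = a * l1 + \<theta>\<^sup>2" "l2\<^sup>2 = a * l2 + \<theta>\<^sup>2"
  "l1\<^sup>2 + \<theta>\<^sup>2 = l1 * s" "l2\<^sup>2 + \<theta>\<^sup>2 = - l2 * s"
  using discriminant_facts by (auto simp: l1_def l2_def power2_eq_square field_simps)

lemma scaled_A_n_vp: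
  "(Theta_mat \<theta> ** A_n \<rho> n v ** Theta_mat \<theta>) *v vp w p = vp (a *\<^sub>R w + (\<theta> * p) *\<^sub>R n) (\<theta> * (w \<bullet> n))"
  by (simp add: matrix_vector_mul_assoc[symmetric] Theta_vp A_n_vp a_def)

text \<open>The quotients \<open>g l / l\<close> come from normalisation: the planar eigenvectors
  have squared lengths \<open>l1 * s\<close> and \<open>- l2 * s\<close>, whence the minus sign. On
  the complement of \<open>n\<close> every eigenvalue is \<open>a\<close>, so there only the inner
  product of the projections enters.\<close>

lemma spectral_fun_A_n:
  "(spectral_fun g (Theta_mat \<theta> ** A_n \<rho> n v ** Theta_mat \<theta>) *v vp x r) \<bullet> vp y q
    = g a * (x \<bullet> y - (x \<bullet> n) * (y \<bullet> n))
      + (g l1 / l1 * (l1 * (x \<bullet> n) + \<theta> * r) * (l1 * (y \<bullet> n) + \<theta> * q)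
         - g l2 / l2 * (l2 * (x \<bullet> n) + \<theta> * r) * (l2 * (y \<bullet> n) + \<theta> * q)) / s"
proof -
  note sf = discriminant_facts and lf = eigenvalue_facts
  have nn: "n \<bullet> n = 1" using n by (simp add: dot_square_norm)
  \<comment> \<open>An orthogonal matrix with \<open>n\<close> as its \<open>k\<close>-th column
    supplies an orthonormal basis of the complement of \<open>n\<close>.\<close>
  obtain U k where U: "orthogonal_matrix U" "U *v axis k 1 = n"
    using orthogonal_matrix_exists_basis[OF n] by metis
  define u where "u j = column j U" for j
  have uk: "u k = n" using U(2) by (simp add: u_def matrix_vector_mul_component column_def vec_eq_iff matrix_vector_mult_basis)
  have UU: "transpose U ** U = mat 1" "U ** transpose U = mat 1" using U(1) by (auto simp: orthogonal_matrix_def)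
  have uu: "u i \<bullet> u j = (if i = j then 1 else 0)" for i j
    using arg_cong[OF UU(1), of "\<lambda>M. M $ i $ j"]
    by (simp add: u_def column_def inner_vec_def matrix_matrix_mult_def transpose_def mat_def)
  have parseval: "(\<Sum>j\<in>UNIV. (u j \<bullet> x) * (u j \<bullet> y)) = x \<bullet> y" for x y
  proof -
    have "(\<Sum>j\<in>UNIV. (u j \<bullet> x) * (u j \<bullet> y)) = (transpose U *v x) \<bullet> (transpose U *v y)"
      by (simp add: u_def inner_vec_def matrix_vector_mult_def transpose_def column_def)
    also have "\<dots> = x \<bullet> y"
      by (metis UU(2) dot_lmul_matrix matrix_vector_mul_assoc matrix_vector_mul_lid transpose_matrix_vector transpose_transpose)
    finally show ?thesis .
  qed
  define N1 where "N1 = sqrt (l1 * s)"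
  define N2 where "N2 = sqrt (- l2 * s)"
  have N: "N1 > 0" "N2 > 0" "N1 * N1 = l1 * s" "N2 * N2 = - l2 * s"
    using sf lf mult_neg_pos[of l2 s] by (simp_all add: N1_def N2_def)
  \<comment> \<open>The planar eigenvectors take the indices \<open>None\<close> and
    \<open>Some k\<close>; the slot of \<open>u k = n\<close> is free because \<open>n\<close> lies
    in that plane.\<close>
  define e where "e j = (case j of None \<Rightarrow> vp ((l1 / N1) *\<^sub>R n) (\<theta> / N1)
      | Some i \<Rightarrow> if i = k then vp ((l2 / N2) *\<^sub>R n) (\<theta> / N2) else vp (u i) 0)" for j
  define d where "d = vp (\<chi> i. if i = k then l2 else a) l1"
  define R where "R = (\<chi> i j. e j $ i)"
  have col: "column j R = e j" for j by (simp add: R_def column_def vec_eq_iff)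
  have un: "u i \<bullet> n = 0" "n \<bullet> u i = 0" if "i \<noteq> k" for i using uu[of i k] uu[of k i] uk that by auto
  have n1: "l1 / N1 * (l1 / N1) + \<theta> / N1 * (\<theta> / N1) = 1"
    using N lf sf by (simp add: add_divide_distrib[symmetric] power2_eq_square)
  have n2: "l2 / N2 * (l2 / N2) + \<theta> / N2 * (\<theta> / N2) = 1"
  proof -
    have "l2 * l2 + \<theta> * \<theta> = N2 * N2" using N(4) lf(9) by (simp add: power2_eq_square)
    then show ?thesis using N(2) by (simp add: add_divide_distrib[symmetric])
  qed
  have n3: "l1 * l2 / (N1 * N2) + \<theta> * \<theta> / (N1 * N2) = 0" "l2 * l1 / (N2 * N1) + \<theta> * \<theta> / (N1 * N2) = 0"
    "l1 * l2 / (N1 * N2) + \<theta> * \<theta> / (N2 * N1) = 0"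
    using lf(3) by (simp_all add: power2_eq_square mult.commute)
  have "e i \<bullet> e j = (if i = j then 1 else 0)" for i j
    using n1 n2 n3 nn un uu by (auto simp: e_def split: option.split)
  then have ortho: "orthogonal_matrix R" unfolding R_def by (rule orthogonal_matrix_of_columns)
  have ev: "(Theta_mat \<theta> ** A_n \<rho> n v ** Theta_mat \<theta>) *v column j R = (d $ j) *\<^sub>R column j R" for j
    unfolding col using nn un lf
    by (cases j) (auto simp: mult.commute[of \<theta> l1] mult.commute[of \<theta> l2]  e_def d_def scaled_A_n_vp vp_scale scaleR_add_left[symmetric] power2_eq_square add_divide_distrib[symmetric])
  have "(spectral_fun g (Theta_mat \<theta> ** A_n \<rho> n v ** Theta_mat \<theta>) *v vp x r) \<bullet> vp y q
      = (\<Sum>j\<in>UNIV. g (d $ j) * (e j \<bullet> vp x r) * (e j \<bullet> vp y q))"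
    using spectral_fun_inner[OF ortho ev, of g] by (simp add: col)
  also have "\<dots> = g l1 * (e None \<bullet> vp x r) * (e None \<bullet> vp y q)
      + (\<Sum>i\<in>UNIV. g (d $ Some i) * (e (Some i) \<bullet> vp x r) * (e (Some i) \<bullet> vp y q))"
    by (simp add: UNIV_option_conv sum.reindex d_def)
  also have "(\<Sum>i\<in>UNIV. g (d $ Some i) * (e (Some i) \<bullet> vp x r) * (e (Some i) \<bullet> vp y q))
      = g l2 * (e (Some k) \<bullet> vp x r) * (e (Some k) \<bullet> vp y q)
       + (\<Sum>i\<in>UNIV-{k}. g a * ((u i \<bullet> x) * (u i \<bullet> y)))"
    by (subst sum.remove[of _ k]) (auto simp: d_def e_def intro!: sum.cong)
  also have "(\<Sum>i\<in>UNIV-{k}. g a * ((u i \<bullet> x) * (u i \<bullet> y))) = g a * (x \<bullet> y - (x \<bullet> n) * (y \<bullet> n))"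
    using parseval[of x y] sum.remove[of UNIV k "\<lambda>j. (u j \<bullet> x) * (u j \<bullet> y)"]
    by (simp add: sum_distrib_left[symmetric] uk inner_commute)
  also have "g l1 * (e None \<bullet> vp x r) * (e None \<bullet> vp y q)
      = g l1 / l1 * (l1 * (x \<bullet> n) + \<theta> * r) * (l1 * (y \<bullet> n) + \<theta> * q) / s"
  proof -
    have "(e None \<bullet> vp z t) = (l1 * (z \<bullet> n) + \<theta> * t) / N1" for z t
      by (simp add: e_def add_divide_distrib inner_commute)
    then show ?thesis using N(3) by (simp add: mult.commute mult.left_commute)
  qed
  also have "g l2 * (e (Some k) \<bullet> vp x r) * (e (Some k) \<bullet> vp y q)
      = - (g l2 / l2 * (l2 * (x \<bullet> n) + \<theta> * r) * (l2 * (y \<bullet> n) + \<theta> * q) / s)"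
  proof -
    have "(e (Some k) \<bullet> vp z t) = (l2 * (z \<bullet> n) + \<theta> * t) / N2" for z t
      by (simp add: e_def add_divide_distrib inner_commute)
    then show ?thesis using N(4) by (simp add: mult.commute mult.left_commute)
  qed
  finally show ?thesis by (simp add: add_divide_distrib diff_divide_distrib)
qed

text \<open>The outer inverses divide the scalar components by \<theta>, which cancels the \<theta>
  of the eigenvectors; it survives only inside \<open>l1\<close>, \<open>l2\<close> and
  \<open>s\<close>.\<close>

lemma scaled_spectral_fun_A_n:
  "(scaled_spectral_fun g (Theta_mat \<theta>) (A_n \<rho> n v) *v vp x r) \<bullet> vp y q
    = g a * (x \<bullet> y - (x \<bullet> n) * (y \<bullet> n))
      + (g l1 / l1 * (l1 * (x \<bullet> n) + r) * (l1 * (y \<bullet> n) + q)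
         - g l2 / l2 * (l2 * (x \<bullet> n) + r) * (l2 * (y \<bullet> n) + q)) / s"
proof -
  have "\<theta> \<noteq> 0" using \<theta> by simp
  then show ?thesis
    by (simp add: scaled_spectral_fun_def matrix_vector_mul_assoc[symmetric] Theta_inv_sym Theta_inv_vp spectral_fun_A_n)
qed

lemma A_abs_form:
  "(A_abs \<rho> \<theta> n v *v vp x r) \<bullet> vp y q
    = \<bar>a\<bar> * (x \<bullet> y - (x \<bullet> n) * (y \<bullet> n))
      + ((a\<^sup>2 + 2 * \<theta>\<^sup>2) * (x \<bullet> n) * (y \<bullet> n) + a * ((x \<bullet> n) * q + r * (y \<bullet> n)) + 2 * r * q) / s"
proof -
  have 1: "\<bar>l1\<bar> / l1 = 1" "\<bar>l2\<bar> / l2 = -1" using eigenvalue_facts by auto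
  have 2: "l1\<^sup>2 + l2\<^sup>2 = a\<^sup>2 + 2 * \<theta>\<^sup>2" using eigenvalue_facts(3,5) by algebra
  have "(l1 * X + r) * (l1 * Y + q) + (l2 * X + r) * (l2 * Y + q) = (l1\<^sup>2 + l2\<^sup>2) * X * Y + (l1 + l2) * (X * q + r * Y) + 2 * r * q" for X Y
    by (simp add: algebra_simps power2_eq_square)
  from this[of "x \<bullet> n" "y \<bullet> n"] show ?thesis
    unfolding A_abs_def scaled_spectral_fun_A_n 1 by (simp add: 2 eigenvalue_facts(5) algebra_simps)
qed

lemma A_neg_form:
  "(A_neg \<rho> \<theta> n v *v vp x r) \<bullet> vp y q
    = neg_part a * (x \<bullet> y - (x \<bullet> n) * (y \<bullet> n)) - (l2 * (x \<bullet> n) + r) * (l2 * (y \<bullet> n) + q) / s"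
proof -
  have 1: "neg_part l1 = 0" "neg_part l2 / l2 = 1" using eigenvalue_facts by (auto simp: neg_part_def)
  show ?thesis unfolding A_neg_def scaled_spectral_fun_A_n 1 by simp
qed

text \<open>The quadratic form of \<open>|A| = A - 2 A^-\<close>: the first two terms on the right
  are half the form of \<open>A_n\<close> on \<open>(v, r)\<close>. The right-hand side is the
  \<open>G_char\<close> integrand of \<open>a_Eu\<close> tested with the solution.\<close>

lemma A_abs_A_neg:
  "1/2 * ((A_abs \<rho> \<theta> n v *v vp v r) \<bullet> vp v r) = \<rho> / 2 * (v \<bullet> n) * (v \<bullet> v) + r * (v \<bullet> n) - (A_neg \<rho> \<theta> n v *v vp v r) \<bullet> vp v r"
proof -
  define X where "X = v \<bullet> n"
  have np: "neg_part a = (a - \<bar>a\<bar>) / 2" by (simp add: neg_part_def)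
  have "((a\<^sup>2 + 2 * \<theta>\<^sup>2) * X * X + 2 * a * X * r + 2 * r * r) - 2 * (l2 * X + r) * (l2 * X + r)
      = s * (a * X\<^sup>2 + 2 * r * X)"
  proof -
    have "a\<^sup>2 + 2 * \<theta>\<^sup>2 - 2 * l2\<^sup>2 = s * a" "a - 2 * l2 = s"
      using discriminant_facts by (simp_all add: l2_def power2_eq_square field_simps)
    then show ?thesis by algebra
  qed
  then have "((a\<^sup>2 + 2 * \<theta>\<^sup>2) * X * X + a * (X * r + r * X) + 2 * r * r) / s
      = a * X\<^sup>2 + 2 * r * X + 2 * ((l2 * X + r) * (l2 * X + r) / s)"
    using discriminant_facts by (simp add: field_simps)
  then show ?thesis unfolding A_abs_form A_neg_form np
    by (simp add: X_def[symmetric] a_def field_simps power2_eq_square)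
qed

text \<open>This explains the formula for \<open>alpha\<close>: it is half the excess of the normal
  coefficient \<open>(a^2 + 2 * \<theta>^2) / s\<close> of \<open>A_abs\<close> over its tangential
  coefficient \<open>\<bar>a\<bar>\<close>.\<close>

lemma A_abs_velocity:
  assumes "\<rho> \<ge> 0"
  shows "1/2 * ((A_abs \<rho> \<theta> n v *v vp v 0) \<bullet> vp v 0)
    = \<rho> / 2 * \<bar>v \<bullet> n\<bar> * (v \<bullet> v) + alpha \<rho> \<theta> n v * (v \<bullet> n) * (v \<bullet> n)"
proof -
  define X where "X = v \<bullet> n"
  have aX: "\<bar>a\<bar> = \<rho> * \<bar>X\<bar>" using assms by (simp add: a_def X_def abs_mult)
  have al: "alpha \<rho> \<theta> n v = (\<bar>a\<bar> - s)\<^sup>2 / (4 * s)"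
    by (simp add: alpha_def s_def aX X_def)
  have "(\<bar>a\<bar> - s)\<^sup>2 = 2 * (a\<^sup>2 + 2 * \<theta>\<^sup>2) - 2 * s * \<bar>a\<bar>"
    using discriminant_facts(2) by (simp add: power2_eq_square algebra_simps)
  moreover define K where "K = (a\<^sup>2 + 2 * \<theta>\<^sup>2) / s"
  ultimately have al': "alpha \<rho> \<theta> n v = K / 2 - \<bar>a\<bar> / 2"
    unfolding al using discriminant_facts(1) by (simp add: field_simps)
  have "((a\<^sup>2 + 2 * \<theta>\<^sup>2) * X * X + a * (X * 0 + 0 * X) + 2 * 0 * 0) / s = K * X * X"
    by (simp add: K_def)
  then show ?thesis unfolding A_abs_form X_def[symmetric] aX al' by (simp add: algebra_simps)
qed

lemma A_abs_nonneg: "(A_abs \<rho> \<theta> n v *v vp x r) \<bullet> vp x r \<ge> 0"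
proof -
  define X where "X = x \<bullet> n"
  have "(x \<bullet> n)\<^sup>2 \<le> (x \<bullet> x) * (n \<bullet> n)" by (rule Cauchy_Schwarz_ineq)
  then have 1: "x \<bullet> x - X * X \<ge> 0" using n by (simp add: X_def dot_square_norm power2_eq_square)
  have "(a\<^sup>2 + 2 * \<theta>\<^sup>2) * X * X + a * (X * r + r * X) + 2 * r * r
      = (a * X + r)\<^sup>2 + r\<^sup>2 + 2 * (\<theta> * X)\<^sup>2" by (simp add: power2_eq_square algebra_simps)
  then have 2: "(a\<^sup>2 + 2 * \<theta>\<^sup>2) * X * X + a * (X * r + r * X) + 2 * r * r \<ge> 0" by simp
  show ?thesis unfolding A_abs_form X_def[symmetric] using 1 2 discriminant_facts(1) by simp
qed
end

section \<open>Traces of gradients\<close>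

text \<open>The first-order part of \<open>smooth_up_to\<close>, the part that gradient traces and
  the viscous integral involve.\<close>

definition C1_up_to :: "(real ^ 'd::finite) set \<Rightarrow> (real ^ 'd \<Rightarrow> 'b::real_normed_vector) \<Rightarrow> bool" where
  "C1_up_to K f \<longleftrightarrow> (\<forall>x\<in>interior K. f differentiable (at x)) \<and> (\<forall>i. extends_continuously K (pd i f))"

lemma smooth_up_to_imp_C1_up_to: "smooth_up_to K f \<Longrightarrow> C1_up_to K f"
  by (auto simp: smooth_up_to_def C1_up_to_def)

text \<open>Density of the interior makes every point of \<open>K\<close> a limit point of it, so
  the limit is unique and any continuous extension computes it. On the frontier of the domain
  \<open>pd\<close> depends on values outside, so boundary terms go through such traces.\<close>

lemma cell_trace_eq:
  fixes g :: "real ^ 'd::finite \<Rightarrow> 'b::t2_space"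
  assumes K: "K \<subseteq> closure (interior K)" and h: "continuous_on K h" "\<And>x. x \<in> interior K \<Longrightarrow> h x = g x"
    and x: "x \<in> K"
  shows "cell_trace K g x = h x"
proof -
  have lp: "x islimpt interior K"
  proof (cases "x \<in> interior K")
    case True then show ?thesis by (simp add: interior_limit_point interior_open)
  next
    case False then show ?thesis using K x by (auto simp: closure_def)
  qed
  have "(h \<longlongrightarrow> h x) (at x within interior K)"
    using h(1) x by (meson continuous_on tendsto_within_subset interior_subset)
  moreover have "\<forall>\<^sub>F y in at x within interior K. h y = g y"
    using h(2) by (auto simp: eventually_at_filter)
  ultimately have "(g \<longlongrightarrow> h x) (at x within interior K)"
    by (rule Lim_transform_eventually)
  then show ?thesis unfolding cell_trace_def
    by (intro tendsto_Lim) (use lp in \<open>simp_all add: trivial_limit_within\<close>)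
qed

lemma cell_trace_continuous_on:
  assumes K: "K \<subseteq> closure (interior K)" and g: "extends_continuously K g"
  shows "continuous_on K (cell_trace K g)" and "x \<in> interior K \<Longrightarrow> cell_trace K g x = g x"
proof -
  obtain h where h: "continuous_on K h" "\<And>x. x \<in> interior K \<Longrightarrow> h x = g x"
    using g by (auto simp: extends_continuously_def)
  note eq = cell_trace_eq[OF K h]
  show "continuous_on K (cell_trace K g)" using h(1) by (rule continuous_on_eq) (simp add: eq)
  show "cell_trace K g x = g x" if "x \<in> interior K" using that eq h(2) interior_subset[of K] by auto
qed

lemma pd_lincomb:
  assumes "\<And>b. b \<in> B \<Longrightarrow> b differentiable (at x)"
  shows "pd i (lincomb B c) x = (\<Sum>b\<in>B. c b *\<^sub>R pd i b x)"
proof -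
  have "(lincomb B c has_derivative (\<lambda>y. \<Sum>b\<in>B. c b *\<^sub>R frechet_derivative b (at x) y)) (at x)"
    unfolding lincomb_def using assms
    by (intro has_derivative_sum has_derivative_scaleR_right) (simp add: frechet_derivative_works[symmetric])
  from frechet_derivative_at[OF this, symmetric] show ?thesis unfolding pd_def by (rule fun_cong)
qed

lemma C1_up_to_lincomb:
  assumes "\<And>b. b \<in> B \<Longrightarrow> C1_up_to K b"
  shows "C1_up_to K (lincomb B c)"
  unfolding C1_up_to_def
proof (intro conjI ballI allI)
  fix x assume x: "x \<in> interior K"
  show "lincomb B c differentiable (at x)"
    unfolding lincomb_def using assms x
    by (cases "finite B") (auto intro!: differentiable_sum differentiable_scaleR simp: C1_up_to_def)
next
  fix i
  have "\<forall>b\<in>B. \<exists>h. continuous_on K h \<and> (\<forall>x\<in>interior K. h x = pd i b x)"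
    using assms by (auto simp: C1_up_to_def extends_continuously_def)
  then obtain h where h: "\<And>b. b \<in> B \<Longrightarrow> continuous_on K (h b)" "\<And>b x. b \<in> B \<Longrightarrow> x \<in> interior K \<Longrightarrow> h b x = pd i b x"
    by metis
  have "\<forall>x\<in>interior K. (\<Sum>b\<in>B. c b *\<^sub>R h b x) = pd i (lincomb B c) x"
    using assms h(2) by (auto simp: C1_up_to_def pd_lincomb)
  moreover have "continuous_on K (\<lambda>x. \<Sum>b\<in>B. c b *\<^sub>R h b x)"
    by (intro continuous_intros h)
  ultimately show "extends_continuously K (pd i (lincomb B c))"
    unfolding extends_continuously_def by (intro exI conjI) auto
qed

text \<open>The transposed Jacobian extended to the closed cell. Its norm as an element of
  \<open>real ^ 'd ^ 'd\<close> is the Frobenius norm, which matches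
  \<open>grad_prod\<close>.\<close>

definition grad_trace :: "(real ^ 'd::finite) set \<Rightarrow> (real ^ 'd \<Rightarrow> real ^ 'd) \<Rightarrow> real ^ 'd \<Rightarrow> real ^ 'd ^ 'd" where
  "grad_trace K v x = (\<chi> i. cell_trace K (pd i v) x)"

lemma grad_trace_continuous_on:
  assumes "K \<subseteq> closure (interior K)" "C1_up_to K v"
  shows "continuous_on K (grad_trace K v)"
  unfolding grad_trace_def[abs_def] using assms
  by (intro continuous_on_vec_lambda cell_trace_continuous_on) (auto simp: C1_up_to_def)

lemma grad_trace_norm:
  assumes "K \<subseteq> closure (interior K)" "C1_up_to K v" "x \<in> interior K"
  shows "(norm (grad_trace K v x))\<^sup>2 = grad_prod v v x"
  using assms unfolding power2_norm_eq_inner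
  by (simp add: grad_trace_def inner_vec_def[of "vec_lambda _"] grad_prod_def cell_trace_continuous_on(2) C1_up_to_def)

text \<open>The right-hand side is continuous on \<open>K\<close> and agrees with the partial
  derivatives in the interior, so \<open>cell_trace_eq\<close> identifies it without any limit
  arithmetic.\<close>

lemma grad_trace_lincomb:
  assumes K: "K \<subseteq> closure (interior K)" and B: "\<And>b. b \<in> B \<Longrightarrow> C1_up_to K b" and x: "x \<in> K"
  shows "grad_trace K (lincomb B c) x = (\<Sum>b\<in>B. c b *\<^sub>R grad_trace K b x)"
proof -
  have "cell_trace K (pd i (lincomb B c)) x = (\<Sum>b\<in>B. c b *\<^sub>R cell_trace K (pd i b) x)" for i
  proof (rule cell_trace_eq[OF K _ _ x])
    show "continuous_on K (\<lambda>x. \<Sum>b\<in>B. c b *\<^sub>R cell_trace K (pd i b) x)"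
      using B by (intro continuous_intros cell_trace_continuous_on K) (auto simp: C1_up_to_def)
    show "(\<Sum>b\<in>B. c b *\<^sub>R cell_trace K (pd i b) y) = pd i (lincomb B c) y" if "y \<in> interior K" for y
      using B that by (subst pd_lincomb) (auto simp: C1_up_to_def intro!: sum.cong cell_trace_continuous_on(2)[OF K])
  qed
  then show ?thesis by (simp add: grad_trace_def vec_eq_iff)
qed

lemma norm_dn_le:
  assumes "norm (nrm G x) = 1"
  shows "norm (dn G K v x) \<le> norm (grad_trace K v x)"
proof -
  have "norm (dn G K v x) \<le> (\<Sum>i\<in>UNIV. \<bar>nrm G x $ i\<bar> * norm (cell_trace K (pd i v) x))"
    unfolding dn_def by (rule order_trans[OF norm_sum]) simp
  also have "\<dots> \<le> L2_set (\<lambda>i. nrm G x $ i) UNIV * L2_set (\<lambda>i. norm (cell_trace K (pd i v) x)) UNIV"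
    using L2_set_mult_ineq[of "\<lambda>i. nrm G x $ i" "\<lambda>i. norm (cell_trace K (pd i v) x)" UNIV] by simp
  also have "\<dots> = norm (grad_trace K v x)"
    using assms by (simp add: norm_vec_def grad_trace_def L2_set_def)
  finally show ?thesis .
qed

section \<open>Integrals over a cell and equivalence of norms in finite dimension\<close>

lemma set_integral_sum:
  fixes f :: "'i \<Rightarrow> 'a \<Rightarrow> 'b::{banach, second_countable_topology}"
  assumes "\<And>i. i \<in> I \<Longrightarrow> set_integrable M A (f i)"
  shows "set_integrable M A (\<lambda>x. \<Sum>i\<in>I. f i x)" "(LINT x:A|M. (\<Sum>i\<in>I. f i x)) = (\<Sum>i\<in>I. LINT x:A|M. f i x)"
  using assms by (simp_all add: set_integrable_def set_lebesgue_integral_def scaleR_sum_right)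

lemma set_integrable_compact_lebesgue:
  fixes f :: "'a::euclidean_space \<Rightarrow> 'b::euclidean_space"
  assumes "compact K" "continuous_on K f"
  shows "set_integrable lebesgue K f"
proof -
  have *: "integrable lborel (\<lambda>x. indicator K x *\<^sub>R f x)" by (rule borel_integrable_compact[OF assms])
  then have "(\<lambda>x. indicator K x *\<^sub>R f x) \<in> borel_measurable lborel" by (rule borel_measurable_integrable)
  with * show ?thesis unfolding set_integrable_def by (simp add: integrable_completion)
qed

text \<open>Definiteness of the L2 product on continuous functions. The interior points with
  \<open>f x \<noteq> 0\<close> form an open null set, hence there are none; density carries the
  conclusion to all of \<open>K\<close>.\<close>

lemma set_integral_norm_eq_0:
  fixes f :: "'a::euclidean_space \<Rightarrow> 'b::euclidean_space"
  assumes K: "compact K" "K \<subseteq> closure (interior K)" and f: "continuous_on K f"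
    and 0: "(LINT x:K|lebesgue. f x \<bullet> f x) = 0" and x: "x \<in> K"
  shows "f x = 0"
proof -
  let ?U = "{x \<in> interior K. f x \<noteq> 0}"
  have int: "set_integrable lebesgue K (\<lambda>x. f x \<bullet> f x)"
    using K(1) by (rule set_integrable_compact_lebesgue) (intro continuous_intros f)
  have "AE x in lebesgue. indicator K x *\<^sub>R (f x \<bullet> f x) = 0"
    using 0 int unfolding set_lebesgue_integral_def set_integrable_def
    by (subst integral_nonneg_eq_0_iff_AE[symmetric]) auto
  then have "AE x in lebesgue. x \<notin> ?U"
    by eventually_elim (use interior_subset[of K] in \<open>auto simp: indicator_def split: if_splits\<close>)
  then have "negligible ?U"
    unfolding completion.AE_iff_null_sets by (simp add: negligible_iff_null_sets)
  moreover have "open ?U"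
  proof -
    have "continuous_on (interior K) f" using f interior_subset continuous_on_subset by blast
    then have "open (interior K \<inter> f -` (- {0}))" by (rule continuous_open_preimage) auto
    moreover have "?U = interior K \<inter> f -` (- {0})" by auto
    ultimately show ?thesis by simp
  qed
  ultimately have "?U = {}" using open_not_negligible by blast
  then have *: "\<And>y. y \<in> interior K \<Longrightarrow> f y = 0" by blast
  have "continuous_on (closure (interior K)) f"
    by (rule continuous_on_subset[OF f]) (simp add: closure_minimal interior_subset compact_imp_closed K)
  then show ?thesis
    by (rule continuous_constant_on_closure) (use * K(2) x in auto)
qed

text \<open>Gram-Schmidt by induction on \<open>F\<close>, with representations required on
  \<open>K\<close> only, where the integrals see the functions. Linear dependence is covered: a
  residual of norm 0 vanishes on \<open>K\<close> by definiteness, and the orthonormal set is then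
  kept.\<close>

lemma L2_orthonormal_basis:
  fixes F :: "('a::euclidean_space \<Rightarrow> 'b::euclidean_space) set"
  assumes K: "compact K" "K \<subseteq> closure (interior K)"
    and "finite F" "\<forall>f\<in>F. continuous_on K f"
  shows "\<exists>E. finite E \<and> (\<forall>e\<in>E. continuous_on K e)
    \<and> (\<forall>e\<in>E. \<forall>e'\<in>E. (LINT x:K|lebesgue. e x \<bullet> e' x) = (if e = e' then 1 else 0))
    \<and> (\<forall>f\<in>F. \<exists>a. \<forall>x\<in>K. f x = (\<Sum>e\<in>E. a e *\<^sub>R e x))"
  using assms(3,4)
proof (induction F rule: finite_induct)
  case empty
  then show ?case by (intro exI[of _ "{}"]) auto
next
  case (insert b F)
  obtain E where E': "finite E" "\<forall>e\<in>E. continuous_on K e"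
     "\<forall>e\<in>E. \<forall>e'\<in>E. (LINT x:K|lebesgue. e x \<bullet> e' x) = (if e = e' then 1 else 0)"
     "\<forall>f\<in>F. \<exists>a. \<forall>x\<in>K. f x = (\<Sum>e\<in>E. a e *\<^sub>R e x)"
    using insert.IH[OF insert.prems[unfolded ball_simps, THEN conjunct2]] by (elim exE conjE) (rule that)
  note E = E'(1) E'(2-4)[rule_format]
  have b: "continuous_on K b" using insert.prems by simp
  define r where "r x = b x - (\<Sum>e\<in>E. (LINT y:K|lebesgue. b y \<bullet> e y) *\<^sub>R e x)" for x
  have r: "continuous_on K r" unfolding r_def by (intro continuous_intros b E)
  define N where "N = (LINT x:K|lebesgue. r x \<bullet> r x)"
  have int: "set_integrable lebesgue K (\<lambda>x. f x \<bullet> g x)" if "continuous_on K f" "continuous_on K g" for f g :: "'a \<Rightarrow> 'b"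
    using K(1) by (rule set_integrable_compact_lebesgue) (intro continuous_intros that)
  have re: "(LINT x:K|lebesgue. r x \<bullet> e x) = 0" if e: "e \<in> E" for e
  proof -
    have "(LINT x:K|lebesgue. r x \<bullet> e x)
       = (LINT x:K|lebesgue. b x \<bullet> e x - (\<Sum>e'\<in>E. (LINT y:K|lebesgue. b y \<bullet> e' y) * (e' x \<bullet> e x)))"
      by (simp add: r_def inner_diff_left inner_sum_left)
    also have "\<dots> = (LINT x:K|lebesgue. b x \<bullet> e x) - (\<Sum>e'\<in>E. (LINT y:K|lebesgue. b y \<bullet> e' y) * (LINT x:K|lebesgue. e' x \<bullet> e x))"
    proof -
      have "set_integrable lebesgue K (\<lambda>x. (LINT y:K|lebesgue. b y \<bullet> e' y) * (e' x \<bullet> e x))" if "e' \<in> E" for e'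
        by (rule set_integrable_mult_right) (rule int[OF E(2)[OF that] E(2)[OF e]])
      from set_integral_sum[of E, OF this] show ?thesis
        by (simp add: set_integral_diff(2)[OF int[OF b E(2)[OF e]]])
    qed
    also have "(\<Sum>e'\<in>E. (LINT y:K|lebesgue. b y \<bullet> e' y) * (LINT x:K|lebesgue. e' x \<bullet> e x)) = (\<Sum>e'\<in>E. if e' = e then (LINT y:K|lebesgue. b y \<bullet> e' y) else 0)"
      using E(3) e by (intro sum.cong) auto
    finally show ?thesis using e E(1) by simp
  qed
  have N0: "N \<ge> 0" unfolding N_def set_lebesgue_integral_def by (intro Bochner_Integration.integral_nonneg) (simp add: indicator_def)
  show ?case
  proof (cases "N = 0")
    case True
    then have "r x = 0" if "x \<in> K" for x using set_integral_norm_eq_0[OF K r _ that] unfolding N_def by blast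
    then have "\<forall>x\<in>K. b x = (\<Sum>e\<in>E. (LINT y:K|lebesgue. b y \<bullet> e y) *\<^sub>R e x)"
      unfolding r_def right_minus_eq by (rule ballI)
    then have "\<exists>a. \<forall>x\<in>K. b x = (\<Sum>e\<in>E. a e *\<^sub>R e x)"
      by (rule exI[of _ "\<lambda>e. LINT y:K|lebesgue. b y \<bullet> e y"])
    with E' show ?thesis by (intro exI[of _ E]) (simp only: ball_simps simp_thms if_True if_False)
  next
    case False
    then have N: "N > 0" using N0 by simp
    define e0 where "e0 x = (1 / sqrt N) *\<^sub>R r x" for x
    have e0: "continuous_on K e0" unfolding e0_def by (intro continuous_intros r)
    have e00: "(LINT x:K|lebesgue. e0 x \<bullet> e0 x) = 1"
      using N by (simp add: e0_def N_def[symmetric])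
    have e0e: "(LINT x:K|lebesgue. e0 x \<bullet> e x) = 0" "(LINT x:K|lebesgue. e x \<bullet> e0 x) = 0" if "e \<in> E" for e
      using re[OF that] by (simp_all add: e0_def inner_commute[of "e _"])
    have e0E: "e0 \<notin> E" using e0e e00 by fastforce
    have b_eq: "b x = (\<Sum>e\<in>insert e0 E. (if e = e0 then sqrt N else (LINT y:K|lebesgue. b y \<bullet> e y)) *\<^sub>R e x)" for x
    proof -
      have "(\<Sum>e\<in>E. (if e = e0 then sqrt N else (LINT y:K|lebesgue. b y \<bullet> e y)) *\<^sub>R e x) = (\<Sum>e\<in>E. (LINT y:K|lebesgue. b y \<bullet> e y) *\<^sub>R e x)"
        using e0E by (intro sum.cong) auto
      then show ?thesis using E(1) e0E N by (simp add: e0_def r_def)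
    qed
    have F_eq: "\<exists>a. \<forall>x\<in>K. f x = (\<Sum>e\<in>insert e0 E. a e *\<^sub>R e x)" if f: "f \<in> F" for f
    proof -
      obtain a where a: "\<forall>x\<in>K. f x = (\<Sum>e\<in>E. a e *\<^sub>R e x)" using E(4)[OF f] by blast
      have "(\<Sum>e\<in>E. (a(e0 := 0)) e *\<^sub>R e x) = (\<Sum>e\<in>E. a e *\<^sub>R e x)" for x
        using e0E by (intro sum.cong) auto
      then show ?thesis using a E(1) e0E by (intro exI[of _ "a(e0 := 0)"]) simp
    qed
    show ?thesis
    proof (intro exI[of _ "insert e0 E"] conjI ballI)
      show "\<exists>a. \<forall>x\<in>K. f x = (\<Sum>e\<in>insert e0 E. a e *\<^sub>R e x)" if "f \<in> insert b F" for f
      proof (cases "f = b")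
        case True
        show ?thesis unfolding True
          by (rule exI[of _ "\<lambda>e. if e = e0 then sqrt N else LINT y:K|lebesgue. b y \<bullet> e y"]) (rule ballI, rule b_eq)
      next
        case False
        with that show ?thesis by (intro F_eq) simp
      qed
    next
      fix e e' assume "e \<in> insert e0 E" "e' \<in> insert e0 E"
      then show "(LINT x:K|lebesgue. e x \<bullet> e' x) = (if e = e' then 1 else 0)"
        using e00 e0e E(3) e0E by auto
    qed (use E e0 in auto)
  qed
qed

text \<open>The constant is the sum of the squared bounds of an orthonormal basis, hence independent
  of \<open>c\<close>: Parseval evaluates the integral and Cauchy-Schwarz bounds the value at
  \<open>x\<close>.\<close>

lemma sup_le_L2_norm:
  fixes F :: "('a::euclidean_space \<Rightarrow> 'b::euclidean_space) set"
  assumes K: "compact K" "K \<subseteq> closure (interior K)"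
    and F: "finite F" "\<And>f. f \<in> F \<Longrightarrow> continuous_on K f"
  shows "\<exists>C\<ge>0. \<forall>c. \<forall>x\<in>K. (norm (lincomb F c x))\<^sup>2 \<le> C * (LINT y:K|lebesgue. (norm (lincomb F c y))\<^sup>2)"
proof -
  obtain E where E': "finite E" "\<forall>e\<in>E. continuous_on K e"
     "\<forall>e\<in>E. \<forall>e'\<in>E. (LINT x:K|lebesgue. e x \<bullet> e' x) = (if e = e' then 1 else 0)"
     "\<forall>f\<in>F. \<exists>a. \<forall>x\<in>K. f x = (\<Sum>e\<in>E. a e *\<^sub>R e x)"
  proof -
    from F(2) have "\<forall>f\<in>F. continuous_on K f" ..
    from L2_orthonormal_basis[OF K F(1) this] show ?thesis by (elim exE conjE) (rule that)
  qed
  note E = E'(1) E'(2-4)[rule_format]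
  from E(4) obtain a where a: "\<And>f x. f \<in> F \<Longrightarrow> x \<in> K \<Longrightarrow> f x = (\<Sum>e\<in>E. a f e *\<^sub>R e x)" by metis
  have "\<exists>M\<ge>0. \<forall>x\<in>K. norm (e x) \<le> M" if "e \<in> E" for e
    using compact_imp_bounded[OF compact_continuous_image[OF E(2)[OF that] K(1)]]
    by (auto simp: bounded_iff) (meson norm_ge_zero order_trans linear)
  then obtain M where M: "\<And>e. e \<in> E \<Longrightarrow> M e \<ge> 0" "\<And>e x. e \<in> E \<Longrightarrow> x \<in> K \<Longrightarrow> norm (e x) \<le> M e" by metis
  have int: "set_integrable lebesgue K (\<lambda>x. f x \<bullet> g x)" if "continuous_on K f" "continuous_on K g" for f g :: "'a \<Rightarrow> 'b"
    using K(1) by (rule set_integrable_compact_lebesgue) (intro continuous_intros that)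
  have "(norm (lincomb F c x))\<^sup>2 \<le> (\<Sum>e\<in>E. (M e)\<^sup>2) * (LINT y:K|lebesgue. (norm (lincomb F c y))\<^sup>2)" if x: "x \<in> K" for c x
  proof -
    define d where "d e = (\<Sum>f\<in>F. c f * a f e)" for e
    have eq: "lincomb F c y = (\<Sum>e\<in>E. d e *\<^sub>R e y)" if "y \<in> K" for y
    proof -
      have "lincomb F c y = (\<Sum>f\<in>F. \<Sum>e\<in>E. (c f * a f e) *\<^sub>R e y)"
        unfolding lincomb_def using a[OF _ that] by (intro sum.cong refl) (metis (no_types, lifting) scaleR_scaleR scaleR_sum_right sum.cong)
      also have "\<dots> = (\<Sum>e\<in>E. d e *\<^sub>R e y)" by (subst sum.swap) (simp add: d_def scaleR_sum_left)
      finally show ?thesis .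
    qed
    have K': "K \<in> sets lebesgue" using K(1) by (simp add: lmeasurable_compact fmeasurableD)
    have "(LINT y:K|lebesgue. (norm (lincomb F c y))\<^sup>2) = (LINT y:K|lebesgue. (\<Sum>e\<in>E. \<Sum>e'\<in>E. d e * d e' * (e y \<bullet> e' y)))"
      by (rule set_lebesgue_integral_cong[OF K'])
        (simp add: eq power2_norm_eq_inner inner_sum_left inner_sum_right sum_distrib_left mult.assoc mult.left_commute inner_commute)
    also have "\<dots> = (\<Sum>e\<in>E. \<Sum>e'\<in>E. d e * d e' * (LINT y:K|lebesgue. e y \<bullet> e' y))"
    proof -
      have "set_integrable lebesgue K (\<lambda>y. d e * d e' * (e y \<bullet> e' y))" if "e \<in> E" "e' \<in> E" for e e'
        by (rule set_integrable_mult_right) (rule int[OF E(2)[OF that(1)] E(2)[OF that(2)]])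
      then show ?thesis by (simp add: set_integral_sum cong: sum.cong)
    qed
    also have "\<dots> = (\<Sum>e\<in>E. \<Sum>e'\<in>E. if e = e' then (d e)\<^sup>2 else 0)"
      using E(3) by (intro sum.cong) (auto simp: power2_eq_square)
    also have "\<dots> = (\<Sum>e\<in>E. (d e)\<^sup>2)" using E(1) by simp
    finally have N: "(LINT y:K|lebesgue. (norm (lincomb F c y))\<^sup>2) = (\<Sum>e\<in>E. (d e)\<^sup>2)" .
    have "norm (lincomb F c x) \<le> (\<Sum>e\<in>E. \<bar>d e\<bar> * norm (e x))"
      unfolding eq[OF x] by (rule order_trans[OF norm_sum]) simp
    also have "\<dots> \<le> (\<Sum>e\<in>E. \<bar>M e\<bar> * \<bar>d e\<bar>)"
      using M x by (intro sum_mono) (simp add: mult.commute[of "M _"] mult_left_mono)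
    also have "\<dots> \<le> L2_set M E * L2_set d E" by (rule L2_set_mult_ineq)
    finally have "(norm (lincomb F c x))\<^sup>2 \<le> (L2_set M E * L2_set d E)\<^sup>2" by (rule power_mono) simp
    then show ?thesis unfolding N by (simp add: L2_set_def power_mult_distrib sum_nonneg)
  qed
  then show ?thesis by (intro exI[of _ "\<Sum>e\<in>E. (M e)\<^sup>2"]) (auto intro: sum_nonneg)
qed

section \<open>Boundary integrals\<close>

text \<open>A class closed under the algebra of the boundary terms, so that integrability follows
  rule by rule. Measurability refers to \<open>S\<close> alone, since traces and weights are
  controlled on one cell only.\<close>

definition bdd_meas :: "'a::topological_space set \<Rightarrow> ('a \<Rightarrow> 'b::euclidean_space) \<Rightarrow> bool" where
  "bdd_meas S g \<longleftrightarrow> g \<in> borel_measurable (restrict_space borel S) \<and> (\<exists>B. \<forall>x\<in>S. norm (g x) \<le> B)"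

named_theorems bdd_meas_intros

lemma bdd_meas_cong: "(\<And>x. x \<in> S \<Longrightarrow> f x = g x) \<Longrightarrow> bdd_meas S f \<longleftrightarrow> bdd_meas S g"
  unfolding bdd_meas_def by (intro conj_cong measurable_cong ex_cong1 ball_cong) (simp_all add: space_restrict_space)

lemma bdd_meas_continuous:
  assumes "continuous_on K g" "compact K" "S \<subseteq> K"
  shows "bdd_meas S g"
proof -
  obtain B where "\<forall>x\<in>K. norm (g x) \<le> B"
    using compact_imp_bounded[OF compact_continuous_image[OF assms(1,2)]] by (auto simp: bounded_iff)
  moreover have "g \<in> borel_measurable (restrict_space borel S)"
    using assms by (intro borel_measurable_continuous_on_restrict) (rule continuous_on_subset)
  ultimately show ?thesis using assms(3) unfolding bdd_meas_def by blast
qed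

lemma bdd_meas_compose:
  assumes g: "bdd_meas S g" and F: "continuous_on UNIV F"
  shows "bdd_meas S (\<lambda>x. F (g x))"
proof -
  obtain B where "\<And>x. x \<in> S \<Longrightarrow> norm (g x) \<le> B" using g by (auto simp: bdd_meas_def)
  then have B: "g x \<in> cball 0 B" if "x \<in> S" for x using that by simp
  have "bounded (F ` cball 0 B)"
    by (intro compact_imp_bounded compact_continuous_image continuous_on_subset[OF F]) auto
  then obtain C where "\<And>y. y \<in> cball 0 B \<Longrightarrow> norm (F y) \<le> C" unfolding bounded_iff by blast
  then have "\<forall>x\<in>S. norm (F (g x)) \<le> C" using B by blast
  moreover have "(\<lambda>x. F (g x)) \<in> borel_measurable (restrict_space borel S)"
    using g borel_measurable_continuous_onI[OF F] unfolding bdd_meas_def by (auto intro: measurable_compose)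
  ultimately show ?thesis unfolding bdd_meas_def by blast
qed

lemma bdd_meas_const [bdd_meas_intros]: "bdd_meas S (\<lambda>_. c)"
  by (auto simp: bdd_meas_def)

lemma bdd_meas_add [bdd_meas_intros]: "bdd_meas S f \<Longrightarrow> bdd_meas S g \<Longrightarrow> bdd_meas S (\<lambda>x. f x + g x)"
  unfolding bdd_meas_def by (auto intro!: exI[of _ "_ + _"] norm_add_rule_thm)

lemma bdd_meas_scaleR [bdd_meas_intros]: "bdd_meas S f \<Longrightarrow> bdd_meas S g \<Longrightarrow> bdd_meas S (\<lambda>x. f x *\<^sub>R g x)"
  unfolding bdd_meas_def
proof (elim conjE exE, intro conjI)
  fix B C assume "\<forall>x\<in>S. norm (f x) \<le> B" "\<forall>x\<in>S. norm (g x) \<le> C"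
  then show "\<exists>B. \<forall>x\<in>S. norm (f x *\<^sub>R g x) \<le> B"
    by (intro exI[of _ "B * C"] ballI) (auto intro!: mult_mono intro: order_trans[OF norm_ge_zero])
qed measurable

lemma bdd_meas_inner [bdd_meas_intros]: "bdd_meas S f \<Longrightarrow> bdd_meas S g \<Longrightarrow> bdd_meas S (\<lambda>x. f x \<bullet> g x)"
  unfolding bdd_meas_def
proof (elim conjE exE, intro conjI)
  fix B C assume "\<forall>x\<in>S. norm (f x) \<le> B" "\<forall>x\<in>S. norm (g x) \<le> C"
  then show "\<exists>B. \<forall>x\<in>S. norm (f x \<bullet> g x) \<le> B"
    by (intro exI[of _ "B * C"] ballI) (auto intro!: order_trans[OF Cauchy_Schwarz_ineq2] mult_mono intro: order_trans[OF norm_ge_zero])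
qed measurable

lemma bdd_meas_mult [bdd_meas_intros]:
  "bdd_meas S f \<Longrightarrow> bdd_meas S g \<Longrightarrow> bdd_meas S (\<lambda>x. f x * g x :: real)"
  using bdd_meas_inner[of S f g] by simp

lemma bdd_meas_minus [bdd_meas_intros]: "bdd_meas S f \<Longrightarrow> bdd_meas S (\<lambda>x. - f x)"
  using bdd_meas_scaleR[OF bdd_meas_const[of S "-1"]] by fastforce

lemma bdd_meas_diff [bdd_meas_intros]: "bdd_meas S f \<Longrightarrow> bdd_meas S g \<Longrightarrow> bdd_meas S (\<lambda>x. f x - g x)"
  using bdd_meas_add[OF _ bdd_meas_minus, of S f g] by simp

lemma bdd_meas_abs [bdd_meas_intros]: "bdd_meas S f \<Longrightarrow> bdd_meas S (\<lambda>x. \<bar>f x :: real\<bar>)"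
  by (erule bdd_meas_compose[where F="\<lambda>x. \<bar>x\<bar>"]) (intro continuous_intros)

lemma bdd_meas_sqrt [bdd_meas_intros]: "bdd_meas S f \<Longrightarrow> bdd_meas S (\<lambda>x. sqrt (f x))"
  by (erule bdd_meas_compose[where F="\<lambda>x. sqrt x"]) (intro continuous_intros)

lemma bdd_meas_power [bdd_meas_intros]: "bdd_meas S f \<Longrightarrow> bdd_meas S (\<lambda>x. (f x :: real) ^ k)"
  by (erule bdd_meas_compose[where F="\<lambda>x. x ^ k"]) (intro continuous_intros)

lemma bdd_meas_neg_part [bdd_meas_intros]: "bdd_meas S f \<Longrightarrow> bdd_meas S (\<lambda>x. neg_part (f x))"
  unfolding neg_part_def
  by (erule bdd_meas_compose[where F="\<lambda>x. x - max x 0"]) (intro continuous_intros)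

lemma bdd_meas_max_zero [bdd_meas_intros]: "bdd_meas S f \<Longrightarrow> bdd_meas S (\<lambda>x. max (f x) (0::real))"
  by (erule bdd_meas_compose[where F="\<lambda>x. max x 0"]) (intro continuous_intros)

lemma bdd_meas_divide:
  assumes f: "bdd_meas S f" and g: "bdd_meas S g" and c: "c > 0" "\<And>x. x \<in> S \<Longrightarrow> c \<le> g x"
  shows "bdd_meas S (\<lambda>x. f x / g x :: real)"
proof -
  \<comment> \<open>Truncating the denominator gives a function continuous on the whole line, to
    which composition applies; on \<open>S\<close> the truncation changes nothing.\<close>
  have "bdd_meas S (\<lambda>x. 1 / max c (g x))"
    by (rule bdd_meas_compose[OF g, where F="\<lambda>y. 1 / max c y"]) (use c(1) in \<open>auto intro!: continuous_intros\<close>)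
  from bdd_meas_mult[OF f this] show ?thesis
    by (rule bdd_meas_cong[THEN iffD1, rotated]) (use c in \<open>simp add: max_def\<close>)
qed

lemma sets_surface [measurable_cong]: "sets surface = sets borel"
  unfolding surface_def hausdorff_def
  using sets.sigma_sets_eq[of borel] by (simp add: sets_measure_of_conv)

lemma space_surface: "space surface = UNIV"
  unfolding surface_def hausdorff_def by (simp add: space_measure_of_conv)

lemma bdd_meas_set_integrable:
  fixes S :: "(real ^ 'd::finite) set"
  assumes g: "bdd_meas S g" and S: "S \<in> sets borel" "emeasure surface S < \<infinity>"
  shows "set_integrable surface S g"
proof -
  let ?M = "restrict_space surface S"
  have S': "S \<inter> space surface \<in> sets surface" using S by (simp add: space_surface sets_surface)
  interpret finite_measure ?M
    using S S' by (intro finite_measureI) (simp add: emeasure_restrict_space space_restrict_space space_surface)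
  obtain B where B: "\<forall>x\<in>S. norm (g x) \<le> B" using g by (auto simp: bdd_meas_def)
  have "g \<in> borel_measurable ?M"
    using g unfolding bdd_meas_def by (simp add: measurable_cong_sets[OF sets_restrict_space_cong[OF sets_surface] refl])
  moreover have "AE x in ?M. norm (g x) \<le> B" using B by (intro AE_I2) (simp add: space_restrict_space)
  ultimately have "integrable ?M g" by (rule_tac integrable_const_bound)
  then show ?thesis unfolding integrable_restrict_space[OF S'] set_integrable_def .
qed

text \<open>Handles the data, which are merely integrable: the bounded partner yields the dominating
  function \<open>B * norm (f x)\<close>.\<close>

lemma set_integrable_inner_bdd_meas:
  fixes S :: "(real ^ 'd::finite) set" and f g :: "real ^ 'd \<Rightarrow> 'b::euclidean_space"
  assumes f: "set_integrable surface S f" and g: "bdd_meas S g" and S: "S \<in> sets borel"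
  shows "set_integrable surface S (\<lambda>x. f x \<bullet> g x)"
proof -
  let ?M = "restrict_space surface S"
  have S': "S \<inter> space surface \<in> sets surface" using S by (simp add: space_surface sets_surface)
  obtain B where B: "\<forall>x\<in>S. norm (g x) \<le> B" using g by (auto simp: bdd_meas_def)
  have g': "g \<in> borel_measurable ?M"
    using g unfolding bdd_meas_def by (simp add: measurable_cong_sets[OF sets_restrict_space_cong[OF sets_surface] refl])
  have f': "integrable ?M f" using f unfolding integrable_restrict_space[OF S'] set_integrable_def .
  have "integrable ?M (\<lambda>x. f x \<bullet> g x)"
  proof (rule Bochner_Integration.integrable_bound)
    show "integrable ?M (\<lambda>x. B * norm (f x))" using f' by simp
    show "(\<lambda>x. f x \<bullet> g x) \<in> borel_measurable ?M" using g' f' by measurable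
    have "norm (f x \<bullet> g x) \<le> norm (B * norm (f x))" if "x \<in> S" for x
    proof -
      have "norm (f x \<bullet> g x) \<le> norm (f x) * norm (g x)" using Cauchy_Schwarz_ineq2 by simp
      also have "\<dots> \<le> norm (f x) * B" using B that by (intro mult_left_mono) auto
      finally show ?thesis by (simp add: mult.commute)
    qed
    then show "AE x in ?M. norm (f x \<bullet> g x) \<le> norm (B * norm (f x))"
      by (intro AE_I2) (simp add: space_restrict_space)
  qed
  then show ?thesis unfolding integrable_restrict_space[OF S'] set_integrable_def .
qed

text \<open>Integrability is required face by face, because \<open>bdint\<close> is a sum over cells
  and is split cell by cell.\<close>

definition bd_integrable :: "('d::finite) geometry \<Rightarrow> (real ^ 'd) set \<Rightarrow> ((real ^ 'd) set \<Rightarrow> real ^ 'd \<Rightarrow> real) \<Rightarrow> bool" where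
  "bd_integrable G \<Gamma> g \<longleftrightarrow> (\<forall>K\<in>mesh G. set_integrable surface (\<Gamma> \<inter> K) (g K))"

lemma bdint_cong:
  assumes "\<And>K x. K \<in> mesh G \<Longrightarrow> x \<in> \<Gamma> \<Longrightarrow> x \<in> K \<Longrightarrow> f K x = g K x"
  shows "bdint G \<Gamma> f = bdint G \<Gamma> g"
  unfolding bdint_def set_lebesgue_integral_def
  by (intro sum.cong refl Bochner_Integration.integral_cong) (use assms in \<open>auto simp: indicator_def\<close>)

lemma bd_integrable_cong:
  assumes "\<And>K x. K \<in> mesh G \<Longrightarrow> x \<in> \<Gamma> \<Longrightarrow> x \<in> K \<Longrightarrow> f K x = g K x"
  shows "bd_integrable G \<Gamma> f \<longleftrightarrow> bd_integrable G \<Gamma> g"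
  unfolding bd_integrable_def set_integrable_def
  by (intro ball_cong refl Bochner_Integration.integrable_cong) (use assms in \<open>auto simp: indicator_def\<close>)

text \<open>Serves to extend inflow integrals over the wall, where the prescribed velocity is
  zero.\<close>

lemma bdint_restrict:
  assumes "\<Gamma> \<subseteq> \<Gamma>'" "\<And>K x. K \<in> mesh G \<Longrightarrow> x \<in> \<Gamma>' - \<Gamma> \<Longrightarrow> x \<in> K \<Longrightarrow> f K x = 0"
  shows "bdint G \<Gamma>' f = bdint G \<Gamma> f" and "bd_integrable G \<Gamma>' f \<longleftrightarrow> bd_integrable G \<Gamma> f"
proof -
  have "(\<lambda>x. indicator (\<Gamma>' \<inter> K) x *\<^sub>R f K x) = (\<lambda>x. indicator (\<Gamma> \<inter> K) x *\<^sub>R f K x)" if "K \<in> mesh G" for K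
    using assms that by (auto simp: indicator_def fun_eq_iff)
  then show "bdint G \<Gamma>' f = bdint G \<Gamma> f" and "bd_integrable G \<Gamma>' f \<longleftrightarrow> bd_integrable G \<Gamma> f"
    unfolding bdint_def set_lebesgue_integral_def bd_integrable_def set_integrable_def by simp_all
qed

lemma bdint_add:
  assumes "bd_integrable G \<Gamma> f" "bd_integrable G \<Gamma> g"
  shows "bd_integrable G \<Gamma> (\<lambda>K x. f K x + g K x)" "bdint G \<Gamma> (\<lambda>K x. f K x + g K x) = bdint G \<Gamma> f + bdint G \<Gamma> g"
  using assms by (simp_all add: bd_integrable_def bdint_def sum.distrib)

lemma bdint_diff:
  assumes "bd_integrable G \<Gamma> f" "bd_integrable G \<Gamma> g"
  shows "bd_integrable G \<Gamma> (\<lambda>K x. f K x - g K x)" "bdint G \<Gamma> (\<lambda>K x. f K x - g K x) = bdint G \<Gamma> f - bdint G \<Gamma> g"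
  using assms by (simp_all add: bd_integrable_def bdint_def sum_subtractf)

lemma bd_integrable_cmult: "bd_integrable G \<Gamma> f \<Longrightarrow> bd_integrable G \<Gamma> (\<lambda>K x. c * f K x)"
  by (simp add: bd_integrable_def)

lemma bdint_cmult: "bdint G \<Gamma> (\<lambda>K x. c * f K x) = c * bdint G \<Gamma> f"
  by (simp add: bdint_def sum_distrib_left)

lemma bdint_minus: "bdint G \<Gamma> (\<lambda>K x. - f K x) = - bdint G \<Gamma> f"
  using bdint_cmult[of G \<Gamma> "-1" f] by simp

lemma bdint_mono:
  assumes "bd_integrable G \<Gamma> f" "bd_integrable G \<Gamma> g"
    and "\<And>K x. K \<in> mesh G \<Longrightarrow> x \<in> \<Gamma> \<Longrightarrow> x \<in> K \<Longrightarrow> f K x \<le> g K x"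
  shows "bdint G \<Gamma> f \<le> bdint G \<Gamma> g"
  unfolding bdint_def using assms by (intro sum_mono set_integral_mono) (auto simp: bd_integrable_def)

lemma bdint_nonneg:
  assumes "\<And>K x. K \<in> mesh G \<Longrightarrow> x \<in> \<Gamma> \<Longrightarrow> x \<in> K \<Longrightarrow> 0 \<le> f K x"
  shows "0 \<le> bdint G \<Gamma> f"
  unfolding bdint_def set_lebesgue_integral_def using assms
  by (intro sum_nonneg Bochner_Integration.integral_nonneg) (auto simp: indicator_def)

section \<open>The energy identity\<close>

definition fe_function :: "('d::finite) geometry \<Rightarrow> (real ^ 'd \<Rightarrow> 'b::real_normed_vector) \<Rightarrow> bool" where
  "fe_function G f \<longleftrightarrow> continuous_on (closure (Omega G)) f \<and> (\<forall>K\<in>mesh G. C1_up_to K f)"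

lemma fe_function_lincomb:
  assumes "\<And>b. b \<in> B \<Longrightarrow> fe_function G b"
  shows "fe_function G (lincomb B c)"
  using assms unfolding fe_function_def
  by (auto intro!: C1_up_to_lincomb) (auto simp: lincomb_def intro!: continuous_on_sum continuous_on_scaleR continuous_on_const)

lemma fe_space_fe_function:
  assumes "fe_space G V" "f \<in> V"
  shows "fe_function G f"
proof -
  obtain B where B: "V = range (lincomb B)" "\<forall>b\<in>B. continuous_on (closure (Omega G)) b \<and> (\<forall>K\<in>mesh G. smooth_up_to K b)"
    using assms(1) unfolding fe_space_def by blast
  then have "\<And>b. b \<in> B \<Longrightarrow> fe_function G b" by (auto simp: fe_function_def smooth_up_to_imp_C1_up_to)
  then show ?thesis using assms(2) B(1) by (auto intro: fe_function_lincomb)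
qed

lemma bdd_meas_divide_const [bdd_meas_intros]: "bdd_meas S f \<Longrightarrow> bdd_meas S (\<lambda>x. f x / c :: real)"
  by (erule bdd_meas_compose[where F="\<lambda>x. x / c"]) (simp add: divide_inverse continuous_on_mult_right)

lemma bdd_meas_sum [bdd_meas_intros]:
  "(\<And>i. i \<in> I \<Longrightarrow> bdd_meas S (f i)) \<Longrightarrow> bdd_meas S (\<lambda>x. \<Sum>i\<in>I. f i x)"
  by (induction I rule: infinite_finite_induct) (auto intro: bdd_meas_intros)

lemma bdd_meas_nth [bdd_meas_intros]: "bdd_meas S f \<Longrightarrow> bdd_meas S (\<lambda>x. f x $ i)"
  by (erule bdd_meas_compose[where F="\<lambda>x. x $ i"]) (intro continuous_intros)

context
  fixes G :: "('d::finite) geometry"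
  assumes G: "meshed_domain G"
begin

lemma mesh_facts:
  assumes "K \<in> mesh G"
  shows "compact K" "K \<subseteq> closure (interior K)" "negligible (K - interior K)" "interior K \<noteq> {}"
    "K \<subseteq> closure (Omega G)" "interior K \<subseteq> Omega G" "diameter K > 0"
proof -
  have c: "simplicial_cell K \<or> cubic_cell K" using G assms by (auto simp: meshed_domain_def is_mesh_def)
  note cell_properties[OF c]
  then show "compact K" "K \<subseteq> closure (interior K)" "negligible (K - interior K)" "interior K \<noteq> {}" by auto
  then show "diameter K > 0" by (intro diameter_pos compact_imp_bounded)
  show "K \<subseteq> closure (Omega G)" "interior K \<subseteq> Omega G" using G assms by (auto simp: meshed_domain_def is_mesh_def)
qed

lemma finite_mesh: "finite (mesh G)" and Union_mesh: "\<Union>(mesh G) = closure (Omega G)"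
  using G by (auto simp: meshed_domain_def is_mesh_def)

lemma boundary_parts:
  "G_wall G \<subseteq> frontier (Omega G)" "G_in G \<subseteq> frontier (Omega G)" "G_out G \<subseteq> frontier (Omega G)"
  "G_sym G \<subseteq> frontier (Omega G)" "G_char G \<subseteq> frontier (Omega G)"
  "G_wall G \<in> sets borel" "G_in G \<in> sets borel" "G_out G \<in> sets borel" "G_sym G \<in> sets borel" "G_char G \<in> sets borel"
  using G unfolding meshed_domain_def by auto

lemma norm_nrm: "x \<in> frontier (Omega G) \<Longrightarrow> norm (nrm G x) = 1"
  using G by (auto simp: meshed_domain_def)

lemma emeasure_surface_boundary_part:
  assumes "\<Gamma> \<subseteq> frontier (Omega G)"
  shows "emeasure surface \<Gamma> < \<infinity>"
proof -
  have "emeasure surface \<Gamma> \<le> emeasure surface (frontier (Omega G))"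
    by (rule emeasure_mono[OF assms]) (simp add: sets_surface)
  also have "\<dots> < \<infinity>" using G by (simp add: meshed_domain_def)
  finally show ?thesis .
qed

lemma bd_integrableI:
  assumes "\<And>K. K \<in> mesh G \<Longrightarrow> bdd_meas (\<Gamma> \<inter> K) (g K)" "\<Gamma> \<subseteq> frontier (Omega G)" "\<Gamma> \<in> sets borel"
  shows "bd_integrable G \<Gamma> g"
  unfolding bd_integrable_def
proof
  fix K assume K: "K \<in> mesh G"
  have "\<Gamma> \<inter> K \<in> sets borel" using assms(3) mesh_facts(1)[OF K] by (auto intro: borel_compact)
  then show "set_integrable surface (\<Gamma> \<inter> K) (g K)"
    using assms K by (intro bdd_meas_set_integrable emeasure_surface_boundary_part) auto
qed

lemma bd_integrable_inner:
  fixes f :: "real ^ 'd \<Rightarrow> 'b::euclidean_space"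
  assumes f: "set_integrable surface \<Gamma>' f" "\<Gamma> \<subseteq> \<Gamma>'" "\<Gamma> \<in> sets borel"
    and g: "\<And>K. K \<in> mesh G \<Longrightarrow> bdd_meas (\<Gamma> \<inter> K) (g K)"
  shows "bd_integrable G \<Gamma> (\<lambda>K x. f x \<bullet> g K x)"
  unfolding bd_integrable_def
proof
  fix K assume K: "K \<in> mesh G"
  have S: "\<Gamma> \<inter> K \<in> sets borel" using assms(3) mesh_facts(1)[OF K] by (auto intro: borel_compact)
  moreover have "set_integrable surface (\<Gamma> \<inter> K) f"
    by (rule set_integrable_subset[OF f(1)]) (use S f(2) in \<open>auto simp: sets_surface\<close>)
  ultimately show "set_integrable surface (\<Gamma> \<inter> K) (\<lambda>x. f x \<bullet> g K x)"
    using g[OF K] by (intro set_integrable_inner_bdd_meas)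
qed

lemma bdd_meas_nrm [bdd_meas_intros]: "S \<subseteq> frontier (Omega G) \<Longrightarrow> bdd_meas S (nrm G)"
  unfolding bdd_meas_def using norm_nrm G
  by (auto intro!: exI[of _ 1] measurable_restrict_space1 simp: meshed_domain_def)

lemma bdd_meas_on_cell:
  assumes "continuous_on (closure (Omega G)) f" "K \<in> mesh G" "S \<subseteq> K"
  shows "bdd_meas S f"
  using assms mesh_facts[OF assms(2)] by (intro bdd_meas_continuous[of K]) (auto intro: continuous_on_subset)

lemma bdd_meas_dn [bdd_meas_intros]:
  assumes "fe_function G v" "K \<in> mesh G" "S \<subseteq> frontier (Omega G)" "S \<subseteq> K"
  shows "bdd_meas S (dn G K v)" "bdd_meas S (dnn G K v)"
proof -
  have "continuous_on K (cell_trace K (pd i v))" for i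
    using assms mesh_facts[OF assms(2)] by (intro cell_trace_continuous_on) (auto simp: fe_function_def C1_up_to_def)
  then have "bdd_meas S (cell_trace K (pd i v))" for i
    using assms mesh_facts[OF assms(2)] by (intro bdd_meas_continuous[of K])
  then show 1: "bdd_meas S (dn G K v)"
    unfolding dn_def[abs_def] using assms(3) by (intro bdd_meas_intros)
  show "bdd_meas S (dnn G K v)"
    unfolding dnn_def[abs_def] using assms(3) 1 by (intro bdd_meas_intros)
qed

section \<open>Boundary integrands of a fixed discrete state\<close>

context
  fixes v :: "real ^ 'd \<Rightarrow> real ^ 'd" and p :: "real ^ 'd \<Rightarrow> real" and th :: "(real ^ 'd) set \<Rightarrow> real ^ 'd \<Rightarrow> real"
  assumes v: "fe_function G v" and p: "continuous_on (closure (Omega G)) p"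
    and th: "\<And>K. K \<in> mesh G \<Longrightarrow> continuous_on K (th K)" "\<And>K x. K \<in> mesh G \<Longrightarrow> x \<in> K \<Longrightarrow> th K x > 0"
begin

lemma bdd_meas_state:
  assumes "K \<in> mesh G" "S \<subseteq> K"
  shows "bdd_meas S v" "bdd_meas S p" "bdd_meas S (th K)"
proof -
  show "bdd_meas S v" "bdd_meas S p" using assms v p by (auto intro!: bdd_meas_on_cell simp: fe_function_def)
  show "bdd_meas S (th K)"
    by (rule bdd_meas_continuous[OF th(1)[OF assms(1)] mesh_facts(1)[OF assms(1)] assms(2)])
qed

lemma weight_lower_bound:
  assumes "K \<in> mesh G"
  obtains c where "c > 0" "\<And>x. x \<in> K \<Longrightarrow> c \<le> th K x"
proof -
  have "K \<noteq> {}" using mesh_facts(4)[OF assms] interior_subset by blast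
  then obtain y where "y \<in> K" "\<forall>x\<in>K. th K y \<le> th K x"
    using continuous_attains_inf[OF mesh_facts(1)[OF assms] _ th(1)[OF assms]] by blast
  then show ?thesis using that th(2)[OF assms] by blast
qed

lemma bdd_meas_divide_weight [bdd_meas_intros]:
  assumes "bdd_meas S f" "K \<in> mesh G" "S \<subseteq> K"
  shows "bdd_meas S (\<lambda>x. f x / th K x)"
proof -
  obtain c where "c > 0" "\<And>x. x \<in> K \<Longrightarrow> c \<le> th K x" using weight_lower_bound[OF assms(2)] by blast
  then show ?thesis
    using assms(3) by (intro bdd_meas_divide[OF assms(1) bdd_meas_state(3)[OF assms(2,3)]]) auto
qed

lemma bdd_meas_divide_sqrt:
  assumes "bdd_meas S f" "K \<in> mesh G" "S \<subseteq> K" "S \<subseteq> frontier (Omega G)"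
  shows "bdd_meas S (\<lambda>x. f x / sqrt (4 * (th K x)\<^sup>2 + \<rho>\<^sup>2 * (v x \<bullet> nrm G x)\<^sup>2))"
proof -
  obtain c where c: "c > 0" "\<And>x. x \<in> K \<Longrightarrow> c \<le> th K x" using weight_lower_bound[OF assms(2)] by blast
  have s: "bdd_meas S (\<lambda>x. sqrt (4 * (th K x)\<^sup>2 + \<rho>\<^sup>2 * (v x \<bullet> nrm G x)\<^sup>2))"
    using assms by (intro bdd_meas_intros bdd_meas_state)
  have "c \<le> sqrt (4 * (th K x)\<^sup>2 + \<rho>\<^sup>2 * (v x \<bullet> nrm G x)\<^sup>2)" if "x \<in> S" for x
  proof (rule real_le_rsqrt)
    have "c\<^sup>2 \<le> (th K x)\<^sup>2" using c that assms(3) by (intro power_mono) auto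
    then show "c\<^sup>2 \<le> 4 * (th K x)\<^sup>2 + \<rho>\<^sup>2 * (v x \<bullet> nrm G x)\<^sup>2"
      by (intro order_trans[OF _ add_increasing2[of "\<rho>\<^sup>2 * (v x \<bullet> nrm G x)\<^sup>2" "(th K x)\<^sup>2" "4 * (th K x)\<^sup>2"]]) auto
  qed
  from bdd_meas_divide[OF assms(1) s c(1) this] show ?thesis .
qed

text \<open>\<open>A_abs\<close> is built from a definite description, so its measurability in
  \<open>x\<close> is read off from the explicit formula \<open>A_abs_form\<close>, valid for unit
  normals and positive weights.\<close>

lemma bd_integrable_A_abs:
  "bd_integrable G (G_char G) (\<lambda>K x. (A_abs \<rho> (th K x) (nrm G x) (v x) *v vp (v x) (p x)) \<bullet> vp (v x) (p x))"
proof -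
  let ?n = "nrm G"
  let ?f = "\<lambda>K x. \<bar>\<rho> * (v x \<bullet> ?n x)\<bar> * (v x \<bullet> v x - (v x \<bullet> ?n x) * (v x \<bullet> ?n x))
     + (((\<rho> * (v x \<bullet> ?n x))\<^sup>2 + 2 * (th K x)\<^sup>2) * (v x \<bullet> ?n x) * (v x \<bullet> ?n x)
        + \<rho> * (v x \<bullet> ?n x) * ((v x \<bullet> ?n x) * p x + p x * (v x \<bullet> ?n x)) + 2 * p x * p x)
       / sqrt (4 * (th K x)\<^sup>2 + \<rho>\<^sup>2 * (v x \<bullet> ?n x)\<^sup>2)"
  have "bd_integrable G (G_char G) ?f"
    by (rule bd_integrableI) (use boundary_parts in \<open>auto intro!: bdd_meas_intros bdd_meas_divide_sqrt bdd_meas_state\<close>)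
  then show ?thesis
    by (rule bd_integrable_cong[THEN iffD1, rotated])
      (use boundary_parts norm_nrm th(2) in \<open>auto simp: A_abs_form subset_eq\<close>)
qed

text \<open>The form is rearranged so that \<open>w\<close> and \<open>q\<close> each face one
  bounded cofactor. Here \<open>?l\<close> is the negative eigenvalue and \<open>?r\<close> the
  factor that both data share in the corresponding eigendirection.\<close>

lemma bd_integrable_A_neg:
  assumes w: "set_integrable surface (G_in G \<union> G_char G) w" and q: "set_integrable surface (G_out G \<union> G_char G) q"
  shows "bd_integrable G (G_char G) (\<lambda>K x. (A_neg \<rho> (th K x) (nrm G x) (v x) *v vp (w x) (q x)) \<bullet> vp (v x) (p x))"
proof -
  let ?n = "nrm G"
  let ?s = "\<lambda>K x. sqrt (4 * (th K x)\<^sup>2 + \<rho>\<^sup>2 * (v x \<bullet> ?n x)\<^sup>2)"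
  let ?l = "\<lambda>K x. (\<rho> * (v x \<bullet> ?n x) - ?s K x) / 2"
  let ?r = "\<lambda>K x. (?l K x * (v x \<bullet> ?n x) + p x) / ?s K x"
  have l: "bdd_meas S (?l K)" if "K \<in> mesh G" "S \<subseteq> K" "S \<subseteq> frontier (Omega G)" for K S
    using that by (auto intro!: bdd_meas_intros bdd_meas_state)
  have r: "bdd_meas S (?r K)" if "K \<in> mesh G" "S \<subseteq> K" "S \<subseteq> frontier (Omega G)" for K S
    using that l by (auto intro!: bdd_meas_intros bdd_meas_divide_sqrt bdd_meas_state)
  have 1: "bd_integrable G (G_char G) (\<lambda>K x. w x \<bullet>
     (neg_part (\<rho> * (v x \<bullet> ?n x)) *\<^sub>R (v x - (v x \<bullet> ?n x) *\<^sub>R ?n x) - (?l K x * ?r K x) *\<^sub>R ?n x))"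
    using boundary_parts
    by (intro bd_integrable_inner[OF w] r l bdd_meas_intros bdd_meas_state) auto
  have 2: "bd_integrable G (G_char G) (\<lambda>K x. q x \<bullet> ?r K x)"
    using boundary_parts by (intro bd_integrable_inner[OF q] r) auto
  show ?thesis
  proof (rule bd_integrable_cong[THEN iffD1, OF _ bdint_diff(1)[OF 1 2]])
    fix K x assume "K \<in> mesh G" "x \<in> G_char G" "x \<in> K"
    then have n: "norm (?n x) = 1" and t: "th K x > 0" using norm_nrm boundary_parts th(2) by auto
    show "w x \<bullet> (neg_part (\<rho> * (v x \<bullet> ?n x)) *\<^sub>R (v x - (v x \<bullet> ?n x) *\<^sub>R ?n x) - (?l K x * ?r K x) *\<^sub>R ?n x) - q x \<bullet> ?r K x
      = (A_neg \<rho> (th K x) (?n x) (v x) *v vp (w x) (q x)) \<bullet> vp (v x) (p x)"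
    proof -
      have aux: "w' \<bullet> (c *\<^sub>R (z - X *\<^sub>R m) - (L * r) *\<^sub>R m) - q' \<bullet> r = c * (w' \<bullet> z - (w' \<bullet> m) * X) - (L * (w' \<bullet> m) + q') * r"
        for w' z m :: "real ^ 'd" and c X L r q' :: real
        by (simp add: inner_diff_right algebra_simps)
      show ?thesis unfolding A_neg_form[OF n t] aux by (simp only: times_divide_eq_right)
    qed
  qed
qed


text \<open>The last summand is the origin of \<open>backflow\<close>. At \<delta> = 1 the cubic
  coefficient of \<open>Q_out\<close> is half of \<open>\<bar>w \<bullet> n\<bar>\<close>, so that
  together with the tangential part it restores the full \<open>w \<bullet> w\<close>.\<close>

lemma outflow_integrand:
  assumes "norm n = 1"
  shows "\<rho> / 2 * \<bar>w \<bullet> n\<bar> * ((w - (w \<bullet> n) *\<^sub>R n) \<bullet> (w - (w \<bullet> n) *\<^sub>R n)) + Q_out \<rho> \<theta> n w (q - \<mu> * d) 1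
    = (\<rho> / 2 * \<bar>w \<bullet> n\<bar> * (w \<bullet> w) + 1 / \<theta> * (\<rho> * neg_part (w \<bullet> n) * (w \<bullet> n) + q) * q)
      - \<mu> * (1 / \<theta> * (d * q + d * q - \<mu> * d * d))
      - \<mu> * (1 / \<theta> * d * (\<rho> * neg_part (w \<bullet> n) * (w \<bullet> n)))"
proof -
  define X where "X = w \<bullet> n"
  have nn: "n \<bullet> n = 1" using assms by (simp add: dot_square_norm)
  have 1: "(w - X *\<^sub>R n) \<bullet> (w - X *\<^sub>R n) = w \<bullet> w - X * X"
    by (simp add: inner_diff_left inner_diff_right nn X_def inner_commute algebra_simps)
  have 2: "1/2 * max X 0 + (1/2 - 1) * neg_part X = \<bar>X\<bar> / 2" by (simp add: neg_part_def max_def)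
  show ?thesis unfolding Q_out_def X_def[symmetric] 1 2
    by (simp add: algebra_simps power2_eq_square add_divide_distrib diff_divide_distrib)
qed

text \<open>The balance at one instant, free of time derivatives, for general data and \<kappa>; the
  stability estimate reuses it with zero data. The boundary parts are compared one by one, and the
  two volume integrals on the right are carried over untouched.\<close>

lemma a_l_NaSt_identity:
  fixes P :: flow_par and \<theta> :: "'d weight" and D :: "'d flow_data" and t :: real
  defines "\<rho> \<equiv> rho P" and "\<mu> \<equiv> mu P" and "\<gamma> \<equiv> gam P" and "n \<equiv> nrm G" and "w \<equiv> vD D t" and "q \<equiv> pD D t"
  assumes \<rho>: "rho P \<ge> 0" and w: "set_integrable surface (G_in G \<union> G_char G) (vD D t)"
    and q: "set_integrable surface (G_out G \<union> G_char G) (pD D t)"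
    and wall: "\<And>x. x \<in> G_wall G \<Longrightarrow> vD D t x = 0"
    and th_eq: "th = \<theta> (v, p)"
  shows "l_NaSt G P \<theta> D t (v, p) (v, p) - a_NaSt \<kappa> G P \<theta> (v, p) (v, p) =
      - \<mu> * (LINT x:Omega G|lebesgue. grad_prod v v x)
             + (LINT x:Omega G|lebesgue. src D t x \<bullet> v x)
             - bdint G (G_char G) (\<lambda>K x.
                 ((1/2) *\<^sub>R (A_abs \<rho> (th K x) (n x) (v x) *v vp (v x) (p x))
                   + A_neg \<rho> (th K x) (n x) (v x) *v vp (w x) (q x)) \<bullet> vp (v x) (p x))
             - \<mu> * bdint G (G_wall G \<union> G_in G) (\<lambda>K x.
                 (v x - w x) \<bullet> ((\<gamma> / diameter K) *\<^sub>R v x - dn G K v x) - v x \<bullet> dn G K v x)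
             - \<mu> * bdint G (G_sym G) (\<lambda>K x.
                 (v x \<bullet> n x) * (\<gamma> / diameter K * (v x \<bullet> n x) - 2 * dnn G K v x))
             - 1/2 * bdint G (G_wall G \<union> G_sym G \<union> G_in G) (\<lambda>K x.
                 (A_abs \<rho> (th K x) (n x) (v x) *v vp (v x) 0) \<bullet> vp (v x) 0)
             - bdint G (G_in G) (\<lambda>K x.
                 \<rho> * neg_part (v x \<bullet> n x) * (w x \<bullet> v x)
                 + (w x \<bullet> n x) * (p x - alpha \<rho> (th K x) (n x) (v x) * (v x \<bullet> n x)))
             - bdint G (G_out G) (\<lambda>K x.
                 \<rho> / 2 * \<bar>v x \<bullet> n x\<bar> * ((v x - (v x \<bullet> n x) *\<^sub>R n x) \<bullet> (v x - (v x \<bullet> n x) *\<^sub>R n x))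
                 + Q_out \<rho> (th K x) (n x) (v x) (p x - \<mu> * dnn G K v x) 1)
             + bdint G (G_out G) (\<lambda>K x.
                 (1 / th K x * (p x - \<mu> * dnn G K v x) - v x \<bullet> n x) * q x)
             - (1 - \<kappa>) * \<mu> * backflow G P \<theta> (v, p) (v, p)"
proof -
  note bp = boundary_parts and bi = bdd_meas_intros bdd_meas_state v
  have bpu: "G_wall G \<union> G_in G \<subseteq> frontier (Omega G)" "G_wall G \<union> G_in G \<in> sets borel" using bp by auto
  let ?AA = "\<lambda>K x. (A_abs \<rho> (th K x) (n x) (v x) *v vp (v x) (p x)) \<bullet> vp (v x) (p x)"
  let ?AN = "\<lambda>K x. (A_neg \<rho> (th K x) (n x) (v x) *v vp (w x) (q x)) \<bullet> vp (v x) (p x)"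
  let ?A0 = "\<lambda>K x. (A_abs \<rho> (th K x) (n x) (v x) *v vp (v x) 0) \<bullet> vp (v x) 0"
  let ?C3 = "\<lambda>K x. \<rho> / 2 * \<bar>v x \<bullet> n x\<bar> * (v x \<bullet> v x)
        + 1 / th K x * (\<rho> * neg_part (v x \<bullet> n x) * (v x \<bullet> n x) + p x) * p x"
  let ?V1 = "\<lambda>K x. dn G K v x \<bullet> v x + v x \<bullet> (dn G K v x - (\<gamma> / diameter K) *\<^sub>R v x)"
  let ?V2 = "\<lambda>K x. dnn G K v x * (v x \<bullet> n x) + (v x \<bullet> n x) * (dnn G K v x - \<gamma> / diameter K * (v x \<bullet> n x))"
  let ?V3 = "\<lambda>K x. 1 / th K x * (dnn G K v x * p x + dnn G K v x * p x - \<mu> * dnn G K v x * dnn G K v x)"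
  let ?L1 = "\<lambda>K x. 1 / th K x * q x * p x - q x * (v x \<bullet> n x)"
  let ?L2 = "\<lambda>K x. w x \<bullet> (dn G K v x - (\<gamma> / diameter K) *\<^sub>R v x)"
  let ?L3 = "\<lambda>K x. 1 / th K x * dnn G K v x * q x"
  let ?LI = "\<lambda>K x. - \<rho> * neg_part (v x \<bullet> n x) * (w x \<bullet> v x)
        + alpha \<rho> (th K x) (n x) (v x) * (w x \<bullet> n x) * (v x \<bullet> n x) - p x * (w x \<bullet> n x)"
  let ?B = "\<lambda>K x. 1 / th K x * dnn G K v x * (\<rho> * neg_part (v x \<bullet> n x) * (v x \<bullet> n x))"
  let ?T1 = "\<lambda>K x. (v x - w x) \<bullet> ((\<gamma> / diameter K) *\<^sub>R v x - dn G K v x) - v x \<bullet> dn G K v x"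
  have a_Eu: "a_Eu G P \<theta> (v, p) (v, p) = 1/2 * bdint G (G_char G) ?AA
      + 1/2 * bdint G (G_wall G \<union> G_sym G \<union> G_in G) ?A0 + bdint G (G_out G) ?C3"
  proof -
    \<comment> \<open>With the solution as test function the volume integrands of
      \<open>a_Eu\<close> vanish pointwise: the convective one by symmetry of the inner product, the
      other because its two divergence terms coincide.\<close>
    have 1: "adv (v x) v x \<bullet> v x - v x \<bullet> adv (v x) v x = 0" for x by (simp add: inner_commute)
    have 2: "bdint G (G_char G) (\<lambda>K x. \<rho> / 2 * (v x \<bullet> n x) * (v x \<bullet> v x) + p x * (v x \<bullet> n x)
        - (A_neg \<rho> (th K x) (n x) (v x) *v vp (v x) (p x)) \<bullet> vp (v x) (p x)) = 1/2 * bdint G (G_char G) ?AA"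
      unfolding bdint_cmult[symmetric]
    proof (rule bdint_cong)
      fix K x assume "K \<in> mesh G" "x \<in> G_char G" "x \<in> K"
      then have n: "norm (n x) = 1" and t: "th K x > 0" using norm_nrm bp th(2) by (auto simp: n_def)
      show "\<rho> / 2 * (v x \<bullet> n x) * (v x \<bullet> v x) + p x * (v x \<bullet> n x)
        - (A_neg \<rho> (th K x) (n x) (v x) *v vp (v x) (p x)) \<bullet> vp (v x) (p x) = 1/2 * ?AA K x"
        by (rule A_abs_A_neg[OF n t, symmetric])
    qed
    have 3: "bdint G (G_wall G \<union> G_sym G \<union> G_in G) (\<lambda>K x. \<rho> / 2 * \<bar>v x \<bullet> n x\<bar> * (v x \<bullet> v x)
        + alpha \<rho> (th K x) (n x) (v x) * (v x \<bullet> n x) * (v x \<bullet> n x)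
        - p x * (v x \<bullet> n x) + p x * (v x \<bullet> n x)) = 1/2 * bdint G (G_wall G \<union> G_sym G \<union> G_in G) ?A0"
      unfolding bdint_cmult[symmetric]
    proof (rule bdint_cong)
      fix K x assume "K \<in> mesh G" "x \<in> G_wall G \<union> G_sym G \<union> G_in G" "x \<in> K"
      then have n: "norm (n x) = 1" and t: "th K x > 0" using norm_nrm bp th(2) by (auto simp: n_def)
      show "\<rho> / 2 * \<bar>v x \<bullet> n x\<bar> * (v x \<bullet> v x) + alpha \<rho> (th K x) (n x) (v x) * (v x \<bullet> n x) * (v x \<bullet> n x)
        - p x * (v x \<bullet> n x) + p x * (v x \<bullet> n x) = 1/2 * ?A0 K x"
        using \<rho> by (subst A_abs_velocity[OF n t]) (simp_all add: \<rho>_def)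
    qed
    show ?thesis
      unfolding a_Eu_def Let_def fst_conv snd_conv th_eq[symmetric] \<rho>_def[symmetric] n_def[symmetric] 1 2 3
      by (simp add: set_lebesgue_integral_def)
  qed
  have AA: "bd_integrable G (G_char G) ?AA" unfolding n_def by (rule bd_integrable_A_abs)
  have AN: "bd_integrable G (G_char G) ?AN" unfolding n_def w_def q_def by (rule bd_integrable_A_neg[OF w q])
  have char: "bdint G (G_char G) (\<lambda>K x. ((1/2) *\<^sub>R (A_abs \<rho> (th K x) (n x) (v x) *v vp (v x) (p x))
       + A_neg \<rho> (th K x) (n x) (v x) *v vp (w x) (q x)) \<bullet> vp (v x) (p x))
     = 1/2 * bdint G (G_char G) ?AA + bdint G (G_char G) ?AN"
    using bdint_add(2)[OF bd_integrable_cmult[OF AA, of "1/2"] AN] unfolding bdint_cmult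
    by (simp only: inner_add_left inner_scaleR_left)
  have V1: "bd_integrable G (G_wall G \<union> G_in G) ?V1"
    unfolding n_def using bpu by (intro bd_integrableI bi) auto
  have L2in: "bd_integrable G (G_in G) ?L2"
    unfolding w_def using bp by (intro bd_integrable_inner[OF w] bi) auto
  \<comment> \<open>The viscous term of the solution lives on wall and inflow, that of the data on
    inflow only; \<open>wall\<close> brings both to the same set.\<close>
  have L2: "bdint G (G_wall G \<union> G_in G) ?L2 = bdint G (G_in G) ?L2"
    by (rule bdint_restrict(1)) (auto simp: w_def wall)
  have L2': "bd_integrable G (G_wall G \<union> G_in G) ?L2"
    by (rule bdint_restrict(2)[THEN iffD2, OF _ _ L2in]) (auto simp: w_def wall)
  have wi: "bdint G (G_wall G \<union> G_in G) ?T1 = - bdint G (G_wall G \<union> G_in G) ?V1 + bdint G (G_in G) ?L2"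
  proof -
    have "?T1 = (\<lambda>K x. ?L2 K x - ?V1 K x)"
      by (simp add: fun_eq_iff inner_diff_left inner_diff_right inner_commute algebra_simps)
    then show ?thesis using bdint_diff(2)[OF L2' V1] L2 by (simp only:)
  qed
  have sym: "bdint G (G_sym G) (\<lambda>K x. (v x \<bullet> n x) * (\<gamma> / diameter K * (v x \<bullet> n x) - 2 * dnn G K v x)) = - bdint G (G_sym G) ?V2"
    unfolding bdint_minus[symmetric] by (rule bdint_cong) (simp add: algebra_simps)
  have inn: "bdint G (G_in G) (\<lambda>K x. \<rho> * neg_part (v x \<bullet> n x) * (w x \<bullet> v x)
       + (w x \<bullet> n x) * (p x - alpha \<rho> (th K x) (n x) (v x) * (v x \<bullet> n x))) = - bdint G (G_in G) ?LI"
    unfolding bdint_minus[symmetric] by (rule bdint_cong) (simp add: algebra_simps)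
  have C3: "bd_integrable G (G_out G) ?C3" and V3: "bd_integrable G (G_out G) ?V3" and B: "bd_integrable G (G_out G) ?B"
    unfolding n_def by (assumption | rule bp Int_lower2 le_infI1 | rule bd_integrableI bi)+
  have out: "bdint G (G_out G) (\<lambda>K x. \<rho> / 2 * \<bar>v x \<bullet> n x\<bar> * ((v x - (v x \<bullet> n x) *\<^sub>R n x) \<bullet> (v x - (v x \<bullet> n x) *\<^sub>R n x))
         + Q_out \<rho> (th K x) (n x) (v x) (p x - \<mu> * dnn G K v x) 1)
      = bdint G (G_out G) ?C3 - \<mu> * bdint G (G_out G) ?V3 - \<mu> * bdint G (G_out G) ?B"
  proof -
    have "bdint G (G_out G) (\<lambda>K x. \<rho> / 2 * \<bar>v x \<bullet> n x\<bar> * ((v x - (v x \<bullet> n x) *\<^sub>R n x) \<bullet> (v x - (v x \<bullet> n x) *\<^sub>R n x))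
         + Q_out \<rho> (th K x) (n x) (v x) (p x - \<mu> * dnn G K v x) 1)
       = bdint G (G_out G) (\<lambda>K x. ?C3 K x - \<mu> * ?V3 K x - \<mu> * ?B K x)"
    proof (rule bdint_cong)
      fix K x assume "x \<in> G_out G"
      then have n: "norm (n x) = 1" using norm_nrm bp by (auto simp: n_def)
      show "\<rho> / 2 * \<bar>v x \<bullet> n x\<bar> * ((v x - (v x \<bullet> n x) *\<^sub>R n x) \<bullet> (v x - (v x \<bullet> n x) *\<^sub>R n x))
         + Q_out \<rho> (th K x) (n x) (v x) (p x - \<mu> * dnn G K v x) 1 = ?C3 K x - \<mu> * ?V3 K x - \<mu> * ?B K x"
        by (rule outflow_integrand[OF n])
    qed
    then show ?thesis
      using bdint_diff(2)[OF bdint_diff(1)[OF C3 bd_integrable_cmult[OF V3, of \<mu>]] bd_integrable_cmult[OF B, of \<mu>]]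
        bdint_diff(2)[OF C3 bd_integrable_cmult[OF V3, of \<mu>]] by (simp only: bdint_cmult)
  qed
  have L1: "bd_integrable G (G_out G) ?L1"
  proof (rule bd_integrable_cong[THEN iffD1])
    show "bd_integrable G (G_out G) (\<lambda>K x. q x \<bullet> (1 / th K x * p x - v x \<bullet> n x))"
      unfolding q_def n_def using bp by (intro bd_integrable_inner[OF q] bi) auto
  qed (simp add: algebra_simps)
  have L3: "bd_integrable G (G_out G) ?L3"
  proof (rule bd_integrable_cong[THEN iffD1])
    show "bd_integrable G (G_out G) (\<lambda>K x. q x \<bullet> (1 / th K x * dnn G K v x))"
      unfolding q_def n_def using bp by (intro bd_integrable_inner[OF q] bi) auto
  qed (simp add: algebra_simps)
  have outp: "bdint G (G_out G) (\<lambda>K x. (1 / th K x * (p x - \<mu> * dnn G K v x) - v x \<bullet> n x) * q x)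
     = bdint G (G_out G) ?L1 - \<mu> * bdint G (G_out G) ?L3"
  proof -
    have "(1 / th K x * (p x - \<mu> * dnn G K v x) - v x \<bullet> n x) * q x = ?L1 K x - \<mu> * ?L3 K x" for K x
      by (simp add: algebra_simps diff_divide_distrib)
    then show ?thesis using bdint_diff(2)[OF L1 bd_integrable_cmult[OF L3, of \<mu>]] by (simp only: bdint_cmult)
  qed
  have l_Eu: "l_Eu G P \<theta> D t (v, p) (v, p) = (LINT x:Omega G|lebesgue. src D t x \<bullet> v x)
      - bdint G (G_char G) ?AN + bdint G (G_in G) ?LI + bdint G (G_out G) ?L1"
    by (simp add: l_Eu_def Let_def th_eq[symmetric] \<rho>_def n_def w_def q_def)
  have a_visc: "a_visc G P \<theta> (v, p) (v, p) = (LINT x:Omega G|lebesgue. grad_prod v v x)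
      - bdint G (G_wall G \<union> G_in G) ?V1 - bdint G (G_sym G) ?V2 - bdint G (G_out G) ?V3"
    by (simp add: a_visc_def Let_def th_eq[symmetric] \<mu>_def n_def \<gamma>_def)
  have l_visc: "l_visc G P \<theta> D t (v, p) v = - bdint G (G_in G) ?L2 - bdint G (G_out G) ?L3"
    by (simp add: l_visc_def th_eq[symmetric] \<gamma>_def w_def q_def)
  have bf: "backflow G P \<theta> (v, p) (v, p) = bdint G (G_out G) ?B"
    by (simp add: backflow_def Let_def th_eq[symmetric] \<rho>_def n_def)
  show ?thesis
    unfolding a_NaSt_def l_NaSt_def fst_conv a_Eu l_Eu a_visc l_visc bf char wi sym inn out outp \<mu>_def[symmetric]
    by (simp add: algebra_simps)
qed

end
end

section \<open>Time derivative of the kinetic energy\<close>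

lemma set_integral_lincomb_inner:
  fixes B :: "('a::euclidean_space \<Rightarrow> 'b::euclidean_space) set"
  assumes "\<And>b. b \<in> B \<Longrightarrow> continuous_on K b" "compact K" "S \<subseteq> K" "S \<in> sets lebesgue"
  shows "(LINT x:S|lebesgue. lincomb B a x \<bullet> lincomb B c x)
    = (\<Sum>b\<in>B. \<Sum>b'\<in>B. a b * c b' * (LINT x:S|lebesgue. b x \<bullet> b' x))"
proof -
  have "set_integrable lebesgue S (\<lambda>x. b x \<bullet> b' x)" if "b \<in> B" "b' \<in> B" for b b'
    by (rule set_integrable_subset[OF set_integrable_compact_lebesgue[of K]])
      (use assms that in \<open>auto intro!: continuous_on_inner\<close>)
  then have int: "set_integrable lebesgue S (\<lambda>x. a b * c b' * (b x \<bullet> b' x))" if "b \<in> B" "b' \<in> B" for b b'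
    using that by (intro set_integrable_mult_right)
  have "(LINT x:S|lebesgue. lincomb B a x \<bullet> lincomb B c x)
     = (LINT x:S|lebesgue. (\<Sum>b\<in>B. \<Sum>b'\<in>B. a b * c b' * (b x \<bullet> b' x)))"
    by (simp add: lincomb_def inner_sum_left inner_sum_right sum_distrib_left mult.assoc mult.left_commute)
       (subst sum.swap, simp)
  also have "\<dots> = (\<Sum>b\<in>B. \<Sum>b'\<in>B. a b * c b' * (LINT x:S|lebesgue. b x \<bullet> b' x))"
    using int by (simp add: set_integral_sum cong: sum.cong)
  finally show ?thesis .
qed

lemma has_vector_derivative_lincomb:
  assumes "\<And>b. b \<in> B \<Longrightarrow> ((\<lambda>s. c s b) has_real_derivative c' b) (at t)"
  shows "((\<lambda>s. lincomb B (c s) x) has_vector_derivative lincomb B c' x) (at t)"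
proof -
  have "((\<lambda>s. c s b *\<^sub>R b x) has_vector_derivative c' b *\<^sub>R b x) (at t)" if "b \<in> B" for b
    using has_vector_derivative_scaleR[OF assms[OF that] has_vector_derivative_const[of "b x"]] by simp
  then show ?thesis unfolding lincomb_def by (rule has_vector_derivative_sum)
qed

text \<open>In the coefficients the energy is a quadratic polynomial with constant Gram matrix
  \<open>M\<close>, so nothing is differentiated under the integral sign. Symmetry of
  \<open>M\<close> merges the two product-rule terms and absorbs the factor 1/2.\<close>

lemma kinetic_energy_derivative:
  fixes G :: "('d::finite) geometry"
  assumes G: "meshed_domain G" and I: "open I" "t \<in> I" and u: "fe_curve I V (\<lambda>s. fst (u s))"
    and V: "\<And>f. f \<in> V \<Longrightarrow> continuous_on (closure (Omega G)) f"
  shows "(kinetic_energy G P u has_real_derivative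
     rho P * (LINT x:Omega G|lebesgue. dt (\<lambda>s. fst (u s)) t x \<bullet> fst (u t) x)) (at t)"
proof -
  obtain B c where B: "finite B" "B \<subseteq> V" and c: "\<And>s. s \<in> I \<Longrightarrow> fst (u s) = lincomb B (c s)"
    "\<And>b s. b \<in> B \<Longrightarrow> s \<in> I \<Longrightarrow> (\<lambda>s. c s b) differentiable (at s)"
    using u unfolding fe_curve_def by blast
  define c' where "c' b = deriv (\<lambda>s. c s b) t" for b
  have c': "((\<lambda>s. c s b) has_real_derivative c' b) (at t)" if "b \<in> B" for b
    unfolding c'_def using c(2)[OF that I(2)] by (simp add: DERIV_deriv_iff_real_differentiable)
  have Om: "bounded (Omega G)" "open (Omega G)" using G by (auto simp: meshed_domain_def)
  define M where "M b b' = (LINT x:Omega G|lebesgue. b x \<bullet> b' x)" for b b' :: "real ^ 'd \<Rightarrow> real ^ 'd"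
  have M: "(LINT x:Omega G|lebesgue. lincomb B a x \<bullet> lincomb B e x) = (\<Sum>b\<in>B. \<Sum>b'\<in>B. a b * e b' * M b b')" for a e
    unfolding M_def using B V Om
    by (intro set_integral_lincomb_inner[of B "closure (Omega G)"]) (auto intro: subsetD[OF closure_subset])
  have M_sym: "M b b' = M b' b" for b b' by (simp add: M_def inner_commute)
  have dt: "dt (\<lambda>s. fst (u s)) t = lincomb B c'"
  proof
    fix x
    have "((\<lambda>s. fst (u s) x) has_vector_derivative lincomb B c' x) (at t)"
      by (rule has_vector_derivative_transform_within_open[OF has_vector_derivative_lincomb[OF c'] I])
        (use c in auto)
    then show "dt (\<lambda>s. fst (u s)) t x = lincomb B c' x" unfolding dt_def by (rule vector_derivative_at)
  qed
  have E: "kinetic_energy G P u s = rho P / 2 * (\<Sum>b\<in>B. \<Sum>b'\<in>B. c s b * c s b' * M b b')" if "s \<in> I" for s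
    by (simp add: kinetic_energy_def c(1)[OF that] M)
  have "((\<lambda>s. rho P / 2 * (\<Sum>b\<in>B. \<Sum>b'\<in>B. c s b * c s b' * M b b')) has_real_derivative
      rho P / 2 * (\<Sum>b\<in>B. \<Sum>b'\<in>B. (c t b * c' b' + c' b * c t b') * M b b')) (at t)"
    by (intro DERIV_cmult DERIV_sum DERIV_cmult_right DERIV_mult' c')
  also have "(\<Sum>b\<in>B. \<Sum>b'\<in>B. (c t b * c' b' + c' b * c t b') * M b b')
     = (\<Sum>b\<in>B. \<Sum>b'\<in>B. c t b * c' b' * M b b') + (\<Sum>b\<in>B. \<Sum>b'\<in>B. c' b * c t b' * M b b')"
    by (simp add: distrib_right sum.distrib)
  also have "(\<Sum>b\<in>B. \<Sum>b'\<in>B. c t b * c' b' * M b b') = (\<Sum>b\<in>B. \<Sum>b'\<in>B. c' b * c t b' * M b b')"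
    by (subst sum.swap) (simp add: M_sym mult.commute)
  finally have "((\<lambda>s. rho P / 2 * (\<Sum>b\<in>B. \<Sum>b'\<in>B. c s b * c s b' * M b b')) has_real_derivative
      rho P * (\<Sum>b\<in>B. \<Sum>b'\<in>B. c' b * c t b' * M b b')) (at t)" by simp
  then have "(kinetic_energy G P u has_real_derivative rho P * (\<Sum>b\<in>B. \<Sum>b'\<in>B. c' b * c t b' * M b b')) (at t)"
    by (rule has_field_derivative_transform_within_open[OF _ I]) (simp add: E)
  then show ?thesis by (simp add: dt c(1)[OF I(2)] M)
qed

text \<open>The pressure of the test function enters \<open>E_op\<close> only through its gradient
  at the current time; the time derivative acts on the velocity alone. Freezing the pressure thus
  leaves the stabilisation at time \<open>t\<close> unchanged.\<close>

lemma E_op_frozen_pressure: "E_op P u (\<lambda>s. (fst (u s), snd (u t))) t = E_op P u u t"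
  by (simp add: E_op_def[abs_def])

lemma discrete_solution_energy:
  fixes G :: "('d::finite) geometry"
  assumes G: "meshed_domain G" and V: "fe_space G V" and sol: "discrete_solution \<kappa> G V W P \<theta> D I u" and t: "t \<in> I"
  shows "(kinetic_energy G P u has_real_derivative
     (l_NaSt G P \<theta> D t (u t) (u t) - a_NaSt \<kappa> G P \<theta> (u t) (u t)) - (a_stab G P \<theta> t u u - l_stab G P \<theta> D t u u)) (at t)"
proof -
  let ?\<psi> = "\<lambda>s. (fst (u s), snd (u t))"
  have u: "fe_curve I V (\<lambda>s. fst (u s))" and I: "open I" and W: "snd (u t) \<in> W"
    using sol t by (auto simp: discrete_solution_def)
  have "fe_curve I W (\<lambda>s. snd (?\<psi> s))"
    unfolding fe_curve_def by (intro exI[of _ "{snd (u t)}"] exI[of _ "\<lambda>_ _. 1"]) (use W in \<open>auto simp: lincomb_def\<close>)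
  moreover have "fe_curve I V (\<lambda>s. fst (?\<psi> s))" using u by simp
  ultimately have "rho P * (LINT x:Omega G|lebesgue. dt (\<lambda>s. fst (u s)) t x \<bullet> fst (?\<psi> t) x)
          + a_NaSt \<kappa> G P \<theta> (u t) (?\<psi> t) + a_stab G P \<theta> t u ?\<psi>
        = l_NaSt G P \<theta> D t (u t) (?\<psi> t) + l_stab G P \<theta> D t u ?\<psi>"
    using sol[unfolded discrete_solution_def, THEN conjunct2, THEN conjunct2, THEN conjunct2, THEN conjunct2,
        THEN conjunct2, THEN conjunct2, THEN conjunct2, THEN spec, of ?\<psi>] t by blast
  moreover have "a_stab G P \<theta> t u ?\<psi> = a_stab G P \<theta> t u u" "l_stab G P \<theta> D t u ?\<psi> = l_stab G P \<theta> D t u u"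
    by (simp_all add: a_stab_def l_stab_def E_op_frozen_pressure)
  ultimately have eq: "rho P * (LINT x:Omega G|lebesgue. dt (\<lambda>s. fst (u s)) t x \<bullet> fst (u t) x)
     = (l_NaSt G P \<theta> D t (u t) (u t) - a_NaSt \<kappa> G P \<theta> (u t) (u t)) - (a_stab G P \<theta> t u u - l_stab G P \<theta> D t u u)"
    by simp
  show ?thesis unfolding eq[symmetric]
    by (rule kinetic_energy_derivative[OF G I t u]) (use fe_space_fe_function[OF V] in \<open>simp add: fe_function_def\<close>)
qed

lemma bdint_eq_0:
  assumes "\<And>K x. K \<in> mesh G \<Longrightarrow> x \<in> \<Gamma> \<Longrightarrow> x \<in> K \<Longrightarrow> f K x = 0"
  shows "bdint G \<Gamma> f = 0"
  using bdint_cong[of G \<Gamma> f "\<lambda>_ _. 0"] assms by (simp add: bdint_def set_lebesgue_integral_def)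

lemma vp_0_0: "vp 0 0 = 0"
  by (rule vp_eqI[symmetric]) simp_all

lemma vanishing_data_l_NaSt:
  assumes "vanishing_data G I D" "t \<in> I"
  shows "l_NaSt G P \<theta> D t u \<psi> = 0"
proof -
  have "(LINT x:Omega G|lebesgue. src D t x \<bullet> fst \<psi> x) = 0"
    unfolding set_lebesgue_integral_def
    by (rule integral_eq_zero_AE) (use assms in \<open>auto simp: vanishing_data_def indicator_def\<close>)
  then show ?thesis
    using assms unfolding l_NaSt_def l_Eu_def l_visc_def Let_def vanishing_data_def
    by (auto simp: vp_0_0 bdint_eq_0)
qed

text \<open>The source vanishes on the open domain, while the stabilisation integrates over closed
  cells; the difference lies in the cell boundaries, which are null sets.\<close>

lemma vanishing_data_l_stab:
  assumes G: "meshed_domain G" and D: "vanishing_data G I D" "t \<in> I"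
  shows "l_stab G P \<theta> D t u \<psi> = 0"
proof -
  have "(LINT x:K|lebesgue. gam1 P * diameter K / \<theta> (u t) K x * (src D t x \<bullet> E_op P u \<psi> t x)) = 0" if K: "K \<in> mesh G" for K
    unfolding set_lebesgue_integral_def
  proof (rule integral_eq_zero_AE)
    have "AE x in lebesgue. x \<notin> K - interior K"
      using mesh_facts(3)[OF G K] by (intro AE_not_in) (simp add: negligible_iff_null_sets)
    then show "AE x in lebesgue. indicator K x *\<^sub>R (gam1 P * diameter K / \<theta> (u t) K x * (src D t x \<bullet> E_op P u \<psi> t x)) = 0"
    proof eventually_elim
      case (elim x)
      then show ?case using mesh_facts(6)[OF G K] D by (auto simp: vanishing_data_def indicator_def)
    qed
  qed
  then show ?thesis by (simp add: l_stab_def)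
qed

section \<open>Stability\<close>

text \<open>Norm equivalence applied to the span of the traced basis gradients. The bound is
  pointwise up to the cell boundary, so it controls surface integrals over any boundary
  part.\<close>

lemma inverse_trace_inequality:
  fixes G :: "('d::finite) geometry"
  assumes G: "meshed_domain G" and V: "fe_space G V" and K: "K \<in> mesh G"
  shows "\<exists>C\<ge>0. \<forall>v\<in>V. \<forall>x\<in>K. (norm (grad_trace K v x))\<^sup>2 \<le> C * (LINT y:K|lebesgue. (norm (grad_trace K v y))\<^sup>2)"
proof -
  note mf = mesh_facts[OF G K]
  obtain B where B: "finite B" "V = range (lincomb B)" "\<forall>b\<in>B. \<forall>K\<in>mesh G. smooth_up_to K b"
    using V unfolding fe_space_def by blast
  have C1: "C1_up_to K b" if "b \<in> B" for b using B(3) K that smooth_up_to_imp_C1_up_to by blast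
  define F where "F = grad_trace K ` B"
  have F: "finite F" "\<And>f. f \<in> F \<Longrightarrow> continuous_on K f"
    using B(1) C1 mf(2) by (auto simp: F_def intro: grad_trace_continuous_on)
  obtain C where C: "C \<ge> 0" "\<And>c x. x \<in> K \<Longrightarrow> (norm (lincomb F c x))\<^sup>2 \<le> C * (LINT y:K|lebesgue. (norm (lincomb F c y))\<^sup>2)"
    using sup_le_L2_norm[OF mf(1,2) F] by blast
  have K': "K \<in> sets lebesgue" using mf(1) by (simp add: lmeasurable_compact fmeasurableD)
  have "(norm (grad_trace K v x))\<^sup>2 \<le> C * (LINT y:K|lebesgue. (norm (grad_trace K v y))\<^sup>2)"
    if v: "v \<in> V" and x: "x \<in> K" for v x
  proof -
    obtain a where a: "v = lincomb B a" using v B(2) by blast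
    \<comment> \<open>Different basis functions may share a gradient, for instance when they differ
      by a constant, so coefficients are summed over the fibres of
      \<open>grad_trace K\<close>.\<close>
    define c where "c f = (\<Sum>b\<in>{b\<in>B. grad_trace K b = f}. a b)" for f
    have eq: "grad_trace K v y = lincomb F c y" if "y \<in> K" for y
    proof -
      have "grad_trace K v y = (\<Sum>b\<in>B. a b *\<^sub>R grad_trace K b y)"
        unfolding a by (rule grad_trace_lincomb[OF mf(2) C1 that])
      also have "\<dots> = (\<Sum>f\<in>F. \<Sum>b\<in>{b\<in>B. grad_trace K b = f}. a b *\<^sub>R grad_trace K b y)"
        unfolding F_def by (rule sum.image_gen[OF B(1)])
      also have "\<dots> = lincomb F c y"
        unfolding lincomb_def c_def scaleR_sum_left by (intro sum.cong refl) auto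
      finally show ?thesis .
    qed
    have "(LINT y:K|lebesgue. (norm (grad_trace K v y))\<^sup>2) = (LINT y:K|lebesgue. (norm (lincomb F c y))\<^sup>2)"
      by (rule set_lebesgue_integral_cong[OF K']) (simp add: eq)
    then show ?thesis using C(2)[OF x, of c] eq[OF x] by simp
  qed
  then show ?thesis using C(1) by blast
qed

text \<open>Gradients may jump across faces, where \<open>grad_prod\<close> is built from
  unspecified derivatives. The faces form a null set, so the integral passes to the disjoint cell
  interiors and from there to the closed cells, with the trace in place of the gradient.\<close>

lemma integral_grad_prod:
  fixes G :: "('d::finite) geometry"
  assumes G: "meshed_domain G" and v: "fe_function G v"
  shows "(LINT x:Omega G|lebesgue. grad_prod v v x) = (\<Sum>K\<in>mesh G. LINT x:K|lebesgue. (norm (grad_trace K v x))\<^sup>2)"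
proof -
  let ?U = "\<Union>K\<in>mesh G. interior K"
  have C1: "C1_up_to K v" if "K \<in> mesh G" for K using v that by (simp add: fe_function_def)
  have intK: "set_integrable lebesgue K (\<lambda>x. (norm (grad_trace K v x))\<^sup>2)" if K: "K \<in> mesh G" for K
    using grad_trace_continuous_on[OF mesh_facts(2)[OF G K] C1[OF K]]
    by (intro set_integrable_compact_lebesgue mesh_facts(1)[OF G K] continuous_intros)
  have sub: "set_integrable lebesgue (interior K) (\<lambda>x. (norm (grad_trace K v x))\<^sup>2)" if K: "K \<in> mesh G" for K
    by (rule set_integrable_subset[OF intK[OF K]]) (auto simp: interior_subset)
  have cell: "set_integrable lebesgue (interior K) (grad_prod v v)"
    "(LINT x:interior K|lebesgue. grad_prod v v x) = (LINT x:K|lebesgue. (norm (grad_trace K v x))\<^sup>2)"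
    if K: "K \<in> mesh G" for K
  proof -
    note eq = grad_trace_norm[OF mesh_facts(2)[OF G K] C1[OF K]]
    show i: "set_integrable lebesgue (interior K) (grad_prod v v)"
      using sub[OF K] unfolding set_integrable_def
      by (rule Bochner_Integration.integrable_cong[THEN iffD1, rotated 2]) (auto simp: eq indicator_def)
    have "(LINT x:interior K|lebesgue. grad_prod v v x) = (LINT x:interior K|lebesgue. (norm (grad_trace K v x))\<^sup>2)"
      by (rule set_lebesgue_integral_cong) (auto simp: eq)
    also have "\<dots> = integral (interior K) (\<lambda>x. (norm (grad_trace K v x))\<^sup>2)"
      by (rule set_lebesgue_integral_eq_integral(2)[OF sub[OF K]])
    also have "\<dots> = integral K (\<lambda>x. (norm (grad_trace K v x))\<^sup>2)"
      by (rule integral_spike_set; rule negligible_subset[OF mesh_facts(3)[OF G K]]) (use interior_subset[of K] in auto)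
    also have "\<dots> = (LINT x:K|lebesgue. (norm (grad_trace K v x))\<^sup>2)"
      by (rule set_lebesgue_integral_eq_integral(2)[OF intK[OF K], symmetric])
    finally show "(LINT x:interior K|lebesgue. grad_prod v v x) = (LINT x:K|lebesgue. (norm (grad_trace K v x))\<^sup>2)" .
  qed
  have disj: "disjoint_family_on interior (mesh G)"
    using G by (auto simp: disjoint_family_on_def meshed_domain_def is_mesh_def)
  have U: "(LINT x:?U|lebesgue. grad_prod v v x) = (\<Sum>K\<in>mesh G. LINT x:interior K|lebesgue. grad_prod v v x)"
    using cell(1) by (intro set_integral_finite_Union finite_mesh[OF G] disj) auto
  have Uint: "set_integrable lebesgue ?U (grad_prod v v)"
    using cell(1) by (intro set_integrable_UN finite_mesh[OF G]) auto
  have "negligible (\<Union>K\<in>mesh G. K - interior K)"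
    using mesh_facts(3)[OF G] finite_mesh[OF G] by (intro negligible_Union) auto
  moreover have "?U \<subseteq> Omega G" using mesh_facts(6)[OF G] by (rule UN_least)
  moreover have "Omega G \<subseteq> \<Union>(mesh G)" unfolding Union_mesh[OF G] by (rule closure_subset)
  then have "Omega G - ?U \<subseteq> (\<Union>K\<in>mesh G. K - interior K)" by auto
  ultimately have neg: "negligible (Omega G - ?U)" "?U - Omega G = {}"
    by (auto elim: negligible_subset)
  have neg': "negligible {x \<in> Omega G - ?U. grad_prod v v x \<noteq> 0}" "negligible {x \<in> ?U - Omega G. grad_prod v v x \<noteq> 0}"
    using neg by (auto intro: negligible_subset)
  have Oint: "set_integrable lebesgue (Omega G) (grad_prod v v)"
    using absolutely_integrable_spike_set_eq[OF neg'] Uint by simp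
  have "(LINT x:Omega G|lebesgue. grad_prod v v x) = integral (Omega G) (grad_prod v v)"
    by (rule set_lebesgue_integral_eq_integral(2)[OF Oint])
  also have "\<dots> = integral ?U (grad_prod v v)"
    by (rule integral_spike_set[OF neg'])
  also have "\<dots> = (LINT x:?U|lebesgue. grad_prod v v x)"
    by (rule set_lebesgue_integral_eq_integral(2)[OF Uint, symmetric])
  finally show ?thesis using U cell(2) by simp
qed

lemma bdd_meas_norm_power2 [bdd_meas_intros]: "bdd_meas S f \<Longrightarrow> bdd_meas S (\<lambda>x. (norm (f x))\<^sup>2)"
  unfolding power2_norm_eq_inner by (intro bdd_meas_intros)

text \<open>The factor 3 prepares three simultaneous uses, on wall and inflow, on the symmetry part
  and on outflow, all paid from one dissipation integral.\<close>

lemma boundary_dissipation: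
  fixes G :: "('d::finite) geometry"
  assumes G: "meshed_domain G" and V: "fe_space G V"
  shows "\<exists>\<epsilon>. (\<forall>K\<in>mesh G. \<epsilon> K > 0) \<and> (\<forall>v\<in>V. \<forall>\<Gamma>. \<Gamma> \<subseteq> frontier (Omega G) \<and> \<Gamma> \<in> sets borel \<longrightarrow>
     3 * bdint G \<Gamma> (\<lambda>K x. \<epsilon> K * (norm (dn G K v x))\<^sup>2) \<le> (LINT x:Omega G|lebesgue. grad_prod v v x))"
proof -
  define N where "N K v = (LINT y:K|lebesgue. (norm (grad_trace K v y))\<^sup>2)" for K and v :: "real ^ 'd \<Rightarrow> real ^ 'd"
  have "\<forall>K\<in>mesh G. \<exists>C\<ge>0. \<forall>v\<in>V. \<forall>x\<in>K. (norm (grad_trace K v x))\<^sup>2 \<le> C * N K v"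
    using inverse_trace_inequality[OF G V] by (simp add: N_def)
  then obtain C where C: "\<And>K. K \<in> mesh G \<Longrightarrow> C K \<ge> 0"
    "\<And>K v x. K \<in> mesh G \<Longrightarrow> v \<in> V \<Longrightarrow> x \<in> K \<Longrightarrow> (norm (grad_trace K v x))\<^sup>2 \<le> C K * N K v" by metis
  \<comment> \<open>The area of the whole boundary bounds that of every
    \<open>\<Gamma> \<inter> K\<close>, so one \<epsilon> serves all \<Gamma>.\<close>
  define S where "S = measure surface (frontier (Omega G))"
  have S0: "S \<ge> 0" by (simp add: S_def)
  \<comment> \<open>Chosen to make \<open>3 * \<epsilon> K * C K * S \<le> 1\<close>; the summand 1
    keeps the denominator positive even if \<open>C K * S\<close> is 0.\<close>
  define \<epsilon> where "\<epsilon> K = 1 / (3 * (C K * S + 1))" for K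
  have pos: "C K * S + 1 > 0" if "K \<in> mesh G" for K using C(1)[OF that] S0 by (simp add: add_nonneg_pos)
  have \<epsilon>: "\<epsilon> K > 0" "3 * \<epsilon> K * C K * S \<le> 1" if "K \<in> mesh G" for K
    using pos[OF that] by (simp_all add: \<epsilon>_def divide_simps)
  have N0: "N K v \<ge> 0" for K v
    unfolding N_def set_lebesgue_integral_def by (intro Bochner_Integration.integral_nonneg) (simp add: indicator_def)
  have "3 * bdint G \<Gamma> (\<lambda>K x. \<epsilon> K * (norm (dn G K v x))\<^sup>2) \<le> (LINT x:Omega G|lebesgue. grad_prod v v x)"
    if v: "v \<in> V" and \<Gamma>: "\<Gamma> \<subseteq> frontier (Omega G)" "\<Gamma> \<in> sets borel" for v \<Gamma>
  proof -
    have fe: "fe_function G v" by (rule fe_space_fe_function[OF V v])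
    have "bdint G \<Gamma> (\<lambda>K x. \<epsilon> K * (norm (dn G K v x))\<^sup>2) \<le> bdint G \<Gamma> (\<lambda>K x. \<epsilon> K * (C K * N K v))"
    proof (rule bdint_mono)
      show "bd_integrable G \<Gamma> (\<lambda>K x. \<epsilon> K * (norm (dn G K v x))\<^sup>2)"
        by (rule bd_integrableI[OF G]) (use fe \<Gamma> in \<open>auto intro!: bdd_meas_intros bdd_meas_dn[OF G]\<close>)
      show "bd_integrable G \<Gamma> (\<lambda>K x. \<epsilon> K * (C K * N K v))"
        by (rule bd_integrableI[OF G]) (use \<Gamma> in \<open>auto intro!: bdd_meas_const\<close>)
      fix K x assume K: "K \<in> mesh G" and x: "x \<in> \<Gamma>" "x \<in> K"
      have "norm (nrm G x) = 1" using x \<Gamma> norm_nrm[OF G] by blast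
      then have "(norm (dn G K v x))\<^sup>2 \<le> (norm (grad_trace K v x))\<^sup>2"
        by (intro power_mono norm_dn_le) auto
      also have "\<dots> \<le> C K * N K v" by (rule C(2)[OF K v x(2)])
      finally show "\<epsilon> K * (norm (dn G K v x))\<^sup>2 \<le> \<epsilon> K * (C K * N K v)"
        using \<epsilon>(1)[OF K] by (intro mult_left_mono) auto
    qed
    also have "3 * bdint G \<Gamma> (\<lambda>K x. \<epsilon> K * (C K * N K v)) \<le> (\<Sum>K\<in>mesh G. N K v)"
      unfolding bdint_def sum_distrib_left
    proof (rule sum_mono)
      fix K assume K: "K \<in> mesh G"
      have meas: "\<Gamma> \<inter> K \<in> sets surface" "emeasure surface (\<Gamma> \<inter> K) \<noteq> \<infinity>"
      proof -
        show "\<Gamma> \<inter> K \<in> sets surface"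
          using \<Gamma>(2) borel_compact[OF mesh_facts(1)[OF G K]] by (simp add: sets_surface)
        show "emeasure surface (\<Gamma> \<inter> K) \<noteq> \<infinity>"
          using emeasure_surface_boundary_part[OF G, of "\<Gamma> \<inter> K"] \<Gamma>(1) by (simp add: le_infI1)
      qed
      have "measure surface (\<Gamma> \<inter> K) \<le> S"
        unfolding S_def using \<Gamma> meas emeasure_surface_boundary_part[OF G order_refl]
        by (intro measure_mono_fmeasurable) (auto simp: fmeasurable_def sets_surface)
      then have "3 * \<epsilon> K * C K * measure surface (\<Gamma> \<inter> K) \<le> 3 * \<epsilon> K * C K * S"
        using \<epsilon>(1)[OF K] C(1)[OF K] by (intro mult_left_mono) auto
      also have "\<dots> \<le> 1" by (rule \<epsilon>(2)[OF K])
      finally have "3 * \<epsilon> K * C K * measure surface (\<Gamma> \<inter> K) * N K v \<le> 1 * N K v"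
        by (rule mult_right_mono) (rule N0)
      then show "3 * (LINT x:\<Gamma> \<inter> K|surface. \<epsilon> K * (C K * N K v)) \<le> N K v"
        unfolding set_integral_const[OF meas] by (simp add: mult_ac)
    qed
    also have "(\<Sum>K\<in>mesh G. N K v) = (LINT x:Omega G|lebesgue. grad_prod v v x)"
      unfolding N_def by (rule integral_grad_prod[OF G fe, symmetric])
    finally show ?thesis by simp
  qed
  then show ?thesis using \<epsilon>(1) by blast
qed

section \<open>Pointwise inequalities for penalty and outflow terms\<close>

lemma young_scaled:
  fixes x y :: "'a::real_inner"
  assumes "\<epsilon> > 0" "1 / \<epsilon> \<le> c"
  shows "- \<epsilon> * (y \<bullet> y) \<le> c * (x \<bullet> x) - 2 * (x \<bullet> y)"
proof -
  \<comment> \<open>The weight 1/\<epsilon> makes the coefficient of \<open>x \<bullet> x\<close>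
    comparable with \<open>c\<close>, which is the penalty \<open>gam P / diameter K\<close> in the
    application.\<close>
  have "0 \<le> (1 / \<epsilon>) * ((x - \<epsilon> *\<^sub>R y) \<bullet> (x - \<epsilon> *\<^sub>R y))" using assms(1) by simp
  also have "\<dots> = (1 / \<epsilon>) * (x \<bullet> x) - 2 * (x \<bullet> y) + \<epsilon> * (y \<bullet> y)"
    using assms(1) by (simp add: inner_diff_left inner_diff_right inner_commute field_simps)
  also have "(1 / \<epsilon>) * (x \<bullet> x) \<le> c * (x \<bullet> x)" using assms(2) by (rule mult_right_mono) simp
  finally show ?thesis by simp
qed

text \<open>The term \<open>(\<rho> * Y + q) * q / \<theta>\<close> is at least
  \<open>- (\<rho> * Y)^2 / (4 * \<theta>)\<close>, its minimum over \<open>q\<close>. As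
  \<open>Y \<le> X^2\<close> and \<theta> dominates \<open>\<rho> * \<bar>X\<bar>\<close>, this
  costs at most half of the cubic term \<open>\<rho> * \<bar>X\<bar> * X^2 / 2\<close>; the other
  half, on the left, stays available against backflow.\<close>

lemma Q_out_lower_bound:
  assumes \<rho>: "\<rho> \<ge> 0" and \<theta>: "\<theta> > 0" "\<rho> * \<bar>v \<bullet> n\<bar> \<le> \<theta>"
  shows "\<rho> * \<bar>v \<bullet> n\<bar> * (v \<bullet> n)\<^sup>2 / 4 \<le> Q_out \<rho> \<theta> n v q 1"
proof -
  define X where "X = v \<bullet> n"
  define Y where "Y = neg_part X * X"
  have Y: "0 \<le> Y" "Y \<le> X\<^sup>2" by (auto simp: Y_def neg_part_def max_def power2_eq_square)
  have Q: "Q_out \<rho> \<theta> n v q 1 = \<rho> * \<bar>X\<bar> * X\<^sup>2 / 2 + (\<rho> * Y + q) * q / \<theta>"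
    unfolding Q_out_def X_def[symmetric] Y_def by (simp add: neg_part_def max_def)
  have "(\<rho> * Y + q) * q \<ge> - (\<rho> * Y)\<^sup>2 / 4"
    using zero_le_power2[of "\<rho> * Y / 2 + q"] by (simp add: power2_eq_square algebra_simps)
  moreover have "(\<rho> * Y)\<^sup>2 \<le> (\<rho> * X\<^sup>2)\<^sup>2" using Y \<rho> by (intro power_mono mult_left_mono) auto
  moreover have "(\<rho> * X\<^sup>2)\<^sup>2 = (\<rho> * \<bar>X\<bar>) * (\<rho> * \<bar>X\<bar> * X\<^sup>2)" by (simp add: power2_eq_square abs_mult_self_eq)
  moreover have "(\<rho> * \<bar>X\<bar>) * (\<rho> * \<bar>X\<bar> * X\<^sup>2) \<le> \<theta> * (\<rho> * \<bar>X\<bar> * X\<^sup>2)"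
    using \<theta>(2) \<rho> by (intro mult_right_mono) (auto simp: X_def)
  ultimately have "- (\<theta> * (\<rho> * \<bar>X\<bar> * X\<^sup>2)) / 4 \<le> (\<rho> * Y + q) * q" by simp
  then have "- (\<rho> * \<bar>X\<bar> * X\<^sup>2) / 4 \<le> (\<rho> * Y + q) * q / \<theta>" using \<theta>(1) by (simp add: field_simps)
  then show ?thesis unfolding Q X_def[symmetric] by linarith
qed

text \<open>The weight dominates both \<open>\<rho> \<bar>v\<^sub>n\<bar>\<close> and \<open>c\<^sub>S\<^sub>t \<mu> / d\<close>, so the backflow term is controlled by
  half of the cubic term in \<open>Q_out\<close> and a part of the viscous dissipation.\<close>

lemma backflow_bound:
  assumes \<rho>: "\<rho> \<ge> 0" and \<mu>: "\<mu> \<ge> 0" and \<theta>: "\<theta> > 0" and \<epsilon>: "\<epsilon> > 0"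
    and c: "\<mu> * k\<^sup>2 * (\<rho> * \<bar>X\<bar>) \<le> \<epsilon> * \<theta>\<^sup>2"
  shows "- \<mu> * \<epsilon> * d\<^sup>2 \<le> k * \<mu> * (1 / \<theta> * d * (\<rho> * neg_part X * X)) + \<rho> * \<bar>X\<bar> * X\<^sup>2 / 4"
proof -
  define Y where "Y = neg_part X * X"
  have Y: "0 \<le> Y" "Y \<le> X\<^sup>2" by (auto simp: Y_def neg_part_def max_def power2_eq_square)
  define z where "z = k * \<rho> * Y / \<theta>"
  \<comment> \<open>Young's inequality with weight \<epsilon> charges
    \<open>\<mu> * \<epsilon> * d^2\<close> to the dissipation. The remaining \<open>z^2\<close>
    term is of fourth order in \<open>X\<close>, and \<open>c\<close> trades one order for the
    factor \<open>\<theta>^2\<close>. In the application \<open>k\<close> is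
    \<open>1 - \<kappa>\<close>.\<close>
  have "0 \<le> \<mu> * (\<epsilon> * d + z / 2)\<^sup>2 / \<epsilon>" using \<mu> \<epsilon> by simp
  also have "\<dots> = \<mu> * \<epsilon> * d\<^sup>2 + \<mu> * d * z + \<mu> * z\<^sup>2 / (4 * \<epsilon>)" using \<epsilon> by (simp add: power2_eq_square field_simps)
  finally have 1: "- \<mu> * \<epsilon> * d\<^sup>2 \<le> \<mu> * d * z + \<mu> * z\<^sup>2 / (4 * \<epsilon>)" by simp
  have "\<mu> * z\<^sup>2 / (4 * \<epsilon>) = \<mu> * k\<^sup>2 * (\<rho> * Y)\<^sup>2 / (4 * (\<epsilon> * \<theta>\<^sup>2))"
    by (simp add: z_def power_mult_distrib power_divide mult_ac)
  also have "\<dots> \<le> \<rho> * \<bar>X\<bar> * X\<^sup>2 / 4"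
  proof -
    have "(\<rho> * Y)\<^sup>2 \<le> (\<rho> * X\<^sup>2)\<^sup>2" using Y \<rho> by (intro power_mono mult_left_mono) auto
    also have "\<dots> = (\<rho> * \<bar>X\<bar>) * (\<rho> * \<bar>X\<bar> * X\<^sup>2)" by (simp add: power2_eq_square abs_mult_self_eq)
    finally have "\<mu> * k\<^sup>2 * (\<rho> * Y)\<^sup>2 \<le> \<mu> * k\<^sup>2 * ((\<rho> * \<bar>X\<bar>) * (\<rho> * \<bar>X\<bar> * X\<^sup>2))"
      using \<mu> by (intro mult_left_mono) auto
    also have "\<dots> = \<mu> * k\<^sup>2 * (\<rho> * \<bar>X\<bar>) * (\<rho> * \<bar>X\<bar> * X\<^sup>2)" by simp
    also have "\<dots> \<le> \<epsilon> * \<theta>\<^sup>2 * (\<rho> * \<bar>X\<bar> * X\<^sup>2)" using c \<rho> by (intro mult_right_mono) auto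
    finally show ?thesis using \<epsilon> \<theta> by (simp add: field_simps)
  qed
  finally show ?thesis using 1 by (simp add: z_def Y_def mult_ac)
qed
text \<open>The conclusions differ in their treatment of backflow: the first keeps it as a
  remainder, the second absorbs it into the outflow share of the dissipation and the surplus cubic
  term of \<open>Q_out\<close>.\<close>

lemma stability_estimates:
  fixes G :: "('d::finite) geometry" and P :: flow_par and \<theta> :: "'d weight"
  assumes G: "meshed_domain G" and V: "fe_space G V" and v: "v \<in> V" and p: "continuous_on (closure (Omega G)) p"
    and \<epsilon>: "\<And>K. K \<in> mesh G \<Longrightarrow> \<epsilon> K > 0"
    and diss: "\<And>\<Gamma>. \<Gamma> \<subseteq> frontier (Omega G) \<Longrightarrow> \<Gamma> \<in> sets borel \<Longrightarrow>
      3 * bdint G \<Gamma> (\<lambda>K x. \<epsilon> K * (norm (dn G K v x))\<^sup>2) \<le> (LINT x:Omega G|lebesgue. grad_prod v v x)"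
    and \<rho>: "rho P > 0" and \<mu>: "mu P \<ge> 0"
    and th: "\<And>K. K \<in> mesh G \<Longrightarrow> continuous_on K (\<theta> (v, p) K)" "\<And>K x. K \<in> mesh G \<Longrightarrow> x \<in> K \<Longrightarrow> \<theta> (v, p) K x > 0"
    and gam: "\<And>K. K \<in> mesh G \<Longrightarrow> 1 / \<epsilon> K \<le> gam P / diameter K"
    and th_v: "\<And>K x. K \<in> mesh G \<Longrightarrow> x \<in> K \<Longrightarrow> rho P * norm (v x) \<le> \<theta> (v, p) K x"
  shows "- a_NaSt \<kappa> G P \<theta> (v, p) (v, p) \<le> - (1 - \<kappa>) * mu P * backflow G P \<theta> (v, p) (v, p)"
    and "(\<And>K x. K \<in> mesh G \<Longrightarrow> x \<in> G_out G \<Longrightarrow> x \<in> K \<Longrightarrow>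
        mu P * (1 - \<kappa>)\<^sup>2 * (rho P * \<bar>v x \<bullet> nrm G x\<bar>) \<le> \<epsilon> K * (\<theta> (v, p) K x)\<^sup>2)
      \<Longrightarrow> - a_NaSt \<kappa> G P \<theta> (v, p) (v, p) \<le> 0"
proof -
  define th where "th = \<theta> (v, p)"
  note th' = th[folded th_def] and th_v' = th_v[folded th_def]
  \<comment> \<open>With zero data \<open>l_NaSt\<close> vanishes, and the general identity becomes
    a formula for \<open>- a_NaSt\<close> alone.\<close>
  define D :: "'d flow_data" where "D = \<lparr>src = \<lambda>_ _. 0, vD = \<lambda>_ _. 0, pD = \<lambda>_ _. 0\<rparr>"
  have D: "src D = (\<lambda>_ _. 0)" "vD D = (\<lambda>_ _. 0)" "pD D = (\<lambda>_ _. 0)" by (simp_all add: D_def)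
  note bp = boundary_parts[OF G] and nn = norm_nrm[OF G]
  have bpu: "G_wall G \<union> G_in G \<subseteq> frontier (Omega G)" "G_wall G \<union> G_in G \<in> sets borel" using bp by auto
  have fe: "fe_function G v" by (rule fe_space_fe_function[OF V v])
  note state = bdd_meas_state[OF G fe p th']
  note weight = bdd_meas_divide_weight[OF G fe p th']
  note bi = bdd_meas_intros weight state bdd_meas_dn[OF G fe] bdd_meas_nrm[OF G]
  let ?n = "nrm G" and ?\<rho> = "rho P" and ?\<mu> = "mu P" and ?\<gamma> = "gam P"
  let ?E = "\<lambda>K x. \<epsilon> K * (norm (dn G K v x))\<^sup>2"
  let ?g = "LINT x:Omega G|lebesgue. grad_prod v v x"
  let ?AA = "\<lambda>K x. ((1/2) *\<^sub>R (A_abs ?\<rho> (th K x) (?n x) (v x) *v vp (v x) (p x))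
      + A_neg ?\<rho> (th K x) (?n x) (v x) *v vp 0 0) \<bullet> vp (v x) (p x)"
  let ?A0 = "\<lambda>K x. (A_abs ?\<rho> (th K x) (?n x) (v x) *v vp (v x) 0) \<bullet> vp (v x) 0"
  let ?T1 = "\<lambda>K x. (v x - 0) \<bullet> ((?\<gamma> / diameter K) *\<^sub>R v x - dn G K v x) - v x \<bullet> dn G K v x"
  let ?T2 = "\<lambda>K x. (v x \<bullet> ?n x) * (?\<gamma> / diameter K * (v x \<bullet> ?n x) - 2 * dnn G K v x)"
  let ?TQ = "\<lambda>K x. ?\<rho> / 2 * \<bar>v x \<bullet> ?n x\<bar> * ((v x - (v x \<bullet> ?n x) *\<^sub>R ?n x) \<bullet> (v x - (v x \<bullet> ?n x) *\<^sub>R ?n x))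
       + Q_out ?\<rho> (th K x) (?n x) (v x) (p x - ?\<mu> * dnn G K v x) 1"
  let ?B = "\<lambda>K x. 1 / th K x * dnn G K v x * (?\<rho> * neg_part (v x \<bullet> ?n x) * (v x \<bullet> ?n x))"
  have bf: "backflow G P \<theta> (v, p) (v, p) = bdint G (G_out G) ?B"
    by (simp add: backflow_def Let_def th_def)
  have l0: "l_NaSt G P \<theta> D 0 (v, p) (v, p) = 0"
    by (rule vanishing_data_l_NaSt[of G "{0}"]) (simp_all add: vanishing_data_def D)
  have id: "- a_NaSt \<kappa> G P \<theta> (v, p) (v, p) = - ?\<mu> * ?g - bdint G (G_char G) ?AA
      - ?\<mu> * bdint G (G_wall G \<union> G_in G) ?T1 - ?\<mu> * bdint G (G_sym G) ?T2
      - 1/2 * bdint G (G_wall G \<union> G_sym G \<union> G_in G) ?A0 - bdint G (G_out G) ?TQ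
      - (1 - \<kappa>) * ?\<mu> * bdint G (G_out G) ?B"
    using a_l_NaSt_identity[OF G fe p th', of P D 0 \<theta> \<kappa>] \<rho> l0
    by (simp add: D th_def set_integrable_def bdint_eq_0 bf set_lebesgue_integral_def)
  have AA: "bdint G (G_char G) ?AA \<ge> 0"
  proof (rule bdint_nonneg)
    fix K x assume "K \<in> mesh G" "x \<in> G_char G" "x \<in> K"
    then show "0 \<le> ?AA K x"
      using A_abs_nonneg[of "?n x" "th K x" ?\<rho> "v x" "v x" "p x"] nn bp th'(2) by (auto simp: vp_0_0)
  qed
  have A0: "bdint G (G_wall G \<union> G_sym G \<union> G_in G) ?A0 \<ge> 0"
  proof (rule bdint_nonneg)
    fix K x assume "K \<in> mesh G" "x \<in> G_wall G \<union> G_sym G \<union> G_in G" "x \<in> K"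
    then show "0 \<le> ?A0 K x"
      using A_abs_nonneg[of "?n x" "th K x" ?\<rho> "v x" "v x" 0] nn bp th'(2) by auto
  qed
  have E: "bd_integrable G \<Gamma> ?E" if "\<Gamma> \<subseteq> frontier (Omega G)" "\<Gamma> \<in> sets borel" for \<Gamma>
    by (rule bd_integrableI[OF G]) (use fe that in \<open>auto intro!: bdd_meas_intros bdd_meas_dn[OF G]\<close>)
  have dnn_le: "(dnn G K v x)\<^sup>2 \<le> (norm (dn G K v x))\<^sup>2" if "x \<in> frontier (Omega G)" for K x
    using Cauchy_Schwarz_ineq2[of "dn G K v x" "?n x"] nn[OF that] unfolding dnn_def
    by (metis abs_le_square_iff abs_norm_cancel mult.right_neutral)
  have T1: "- bdint G (G_wall G \<union> G_in G) ?E \<le> bdint G (G_wall G \<union> G_in G) ?T1"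
    unfolding bdint_minus[symmetric]
  proof (rule bdint_mono)
    show "bd_integrable G (G_wall G \<union> G_in G) (\<lambda>K x. - ?E K x)"
      using bd_integrable_cmult[OF E[OF bpu], of "-1"] by simp
    show "bd_integrable G (G_wall G \<union> G_in G) ?T1"
      by (assumption | rule bpu Int_lower2 le_infI1 | rule bd_integrableI[OF G] bi)+
    fix K x assume K: "K \<in> mesh G"
    show "- ?E K x \<le> ?T1 K x"
      using young_scaled[OF \<epsilon>[OF K] gam[OF K], of "dn G K v x" "v x"]
      by (simp add: inner_diff_right power2_norm_eq_inner)
  qed
  have T2: "- bdint G (G_sym G) ?E \<le> bdint G (G_sym G) ?T2"
    unfolding bdint_minus[symmetric]
  proof (rule bdint_mono)
    show "bd_integrable G (G_sym G) (\<lambda>K x. - ?E K x)"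
      using bd_integrable_cmult[OF E[OF bp(4,9)], of "-1"] by simp
    show "bd_integrable G (G_sym G) ?T2"
      by (assumption | rule bp Int_lower2 le_infI1 | rule bd_integrableI[OF G] bi)+
    fix K x assume K: "K \<in> mesh G" and x: "x \<in> G_sym G"
    have "\<epsilon> K * (dnn G K v x)\<^sup>2 \<le> ?E K x"
      using \<epsilon>[OF K] bp x by (intro mult_left_mono dnn_le) auto
    then show "- ?E K x \<le> ?T2 K x"
      using young_scaled[OF \<epsilon>[OF K] gam[OF K], of "dnn G K v x" "v x \<bullet> ?n x"]
      by (simp add: power2_eq_square algebra_simps)
  qed
  have Q: "?\<rho> * \<bar>v x \<bullet> ?n x\<bar> * (v x \<bullet> ?n x)\<^sup>2 / 4 \<le> ?TQ K x"
    if K: "K \<in> mesh G" and x: "x \<in> G_out G" "x \<in> K" for K x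
  proof -
    have "\<bar>v x \<bullet> ?n x\<bar> \<le> norm (v x)"
      using Cauchy_Schwarz_ineq2[of "v x" "?n x"] nn[of x] x bp by auto
    then have "?\<rho> * \<bar>v x \<bullet> ?n x\<bar> \<le> ?\<rho> * norm (v x)" using \<rho> by (intro mult_left_mono) auto
    also have "\<dots> \<le> th K x" by (rule th_v'[OF K x(2)])
    finally have "?\<rho> * \<bar>v x \<bullet> ?n x\<bar> * (v x \<bullet> ?n x)\<^sup>2 / 4 \<le> Q_out ?\<rho> (th K x) (?n x) (v x) (p x - ?\<mu> * dnn G K v x) 1"
      using \<rho> th'(2)[OF K x(2)] by (intro Q_out_lower_bound) auto
    moreover have "0 \<le> ?\<rho> / 2 * \<bar>v x \<bullet> ?n x\<bar> * ((v x - (v x \<bullet> ?n x) *\<^sub>R ?n x) \<bullet> (v x - (v x \<bullet> ?n x) *\<^sub>R ?n x))"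
      using \<rho> by (intro mult_nonneg_nonneg inner_ge_zero) auto
    ultimately show ?thesis by linarith
  qed
  have TQ0: "0 \<le> bdint G (G_out G) ?TQ"
  proof (rule bdint_nonneg)
    fix K x assume "K \<in> mesh G" "x \<in> G_out G" "x \<in> K"
    from Q[OF this] show "0 \<le> ?TQ K x" by (rule order_trans[rotated]) (use \<rho> in simp)
  qed
  have g0: "0 \<le> ?g"
    unfolding set_lebesgue_integral_def
    by (intro Bochner_Integration.integral_nonneg) (auto simp: grad_prod_def intro!: mult_nonneg_nonneg sum_nonneg)
  \<comment> \<open>Each boundary integral uses at most a third of the dissipation;
    \<open>diss1\<close> leaves the outflow third unspent.\<close>
  have diss2: "0 \<le> ?\<mu> * (?g - bdint G (G_wall G \<union> G_in G) ?E - bdint G (G_sym G) ?E - bdint G (G_out G) ?E)"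
    using diss[OF bpu] diss[OF bp(4,9)] diss[OF bp(3,8)] \<mu> by (intro mult_nonneg_nonneg) auto
  have diss1: "0 \<le> ?\<mu> * (?g - bdint G (G_wall G \<union> G_in G) ?E - bdint G (G_sym G) ?E)"
    using diss[OF bpu] diss[OF bp(4,9)] g0 \<mu> by (intro mult_nonneg_nonneg) auto
  note T = mult_left_mono[OF T1 \<mu>] mult_left_mono[OF T2 \<mu>]
  show "- a_NaSt \<kappa> G P \<theta> (v, p) (v, p) \<le> - (1 - \<kappa>) * mu P * backflow G P \<theta> (v, p) (v, p)"
    unfolding id bf using AA A0 TQ0 diss1 T by (simp add: algebra_simps)
  assume c: "\<And>K x. K \<in> mesh G \<Longrightarrow> x \<in> G_out G \<Longrightarrow> x \<in> K \<Longrightarrow>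
        mu P * (1 - \<kappa>)\<^sup>2 * (rho P * \<bar>v x \<bullet> nrm G x\<bar>) \<le> \<epsilon> K * (\<theta> (v, p) K x)\<^sup>2"
  have TQi: "bd_integrable G (G_out G) ?TQ"
    unfolding Q_out_def by (assumption | rule bp Int_lower2 le_infI1 | rule bd_integrableI[OF G] bi)+
  have Bi: "bd_integrable G (G_out G) ?B"
    by (assumption | rule bp Int_lower2 le_infI1 | rule bd_integrableI[OF G] bi)+
  note cB = bd_integrable_cmult[OF Bi, of "(1 - \<kappa>) * ?\<mu>"]
  \<comment> \<open>The quarter of the cubic term left over by \<open>Q\<close> is what
    \<open>backflow_bound\<close> consumes; only the square of the normal derivative remains, to be
    paid by dissipation.\<close>
  have "- ?\<mu> * bdint G (G_out G) ?E \<le> bdint G (G_out G) ?TQ + (1 - \<kappa>) * ?\<mu> * bdint G (G_out G) ?B"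
    unfolding bdint_cmult[symmetric] bdint_add(2)[OF TQi cB, symmetric]
  proof (rule bdint_mono[OF _ bdint_add(1)[OF TQi cB]])
    show "bd_integrable G (G_out G) (\<lambda>K x. - ?\<mu> * ?E K x)"
      by (rule bd_integrable_cmult[OF E[OF bp(3,8)]])
    fix K x assume K: "K \<in> mesh G" and x: "x \<in> G_out G" "x \<in> K"
    have "?\<mu> * (\<epsilon> K * (dnn G K v x)\<^sup>2) \<le> ?\<mu> * ?E K x"
      using \<epsilon>[OF K] \<mu> bp x by (intro mult_left_mono dnn_le) auto
    then show "- ?\<mu> * ?E K x \<le> ?TQ K x + (1 - \<kappa>) * ?\<mu> * ?B K x"
      using backflow_bound[OF less_imp_le[OF \<rho>] \<mu> th'(2)[OF K x(2)] \<epsilon>[OF K] c[OF K x, folded th_def], of "dnn G K v x"]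
        Q[OF K x] by (simp add: algebra_simps)
  qed
  then show "- a_NaSt \<kappa> G P \<theta> (v, p) (v, p) \<le> 0"
    unfolding id using AA A0 diss2 T by (simp add: algebra_simps)
qed

text \<open>\<open>fe_curve\<close> allows each curve its own elements of \<open>V\<close>;
  expanding them in the global generators puts the value back into \<open>V\<close>.\<close>

lemma fe_curve_mem:
  assumes "fe_curve I V \<phi>" "V = range (lincomb B)" "t \<in> I"
  shows "\<phi> t \<in> V"
proof -
  obtain B' c where B': "B' \<subseteq> V" "\<phi> t = lincomb B' (c t)" using assms unfolding fe_curve_def by blast
  then have "\<forall>b'\<in>B'. \<exists>a. b' = lincomb B a" using assms(2) by blast
  then obtain a where a: "\<And>b'. b' \<in> B' \<Longrightarrow> b' = lincomb B (a b')" by metis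
  have "\<phi> t x = lincomb B (\<lambda>b. \<Sum>b'\<in>B'. c t b' * a b' b) x" for x
  proof -
    have "\<phi> t x = (\<Sum>b'\<in>B'. c t b' *\<^sub>R lincomb B (a b') x)"
      unfolding B'(2) lincomb_def[of B'] using a by (intro sum.cong refl) metis
    also have "\<dots> = (\<Sum>b'\<in>B'. \<Sum>b\<in>B. (c t b' * a b' b) *\<^sub>R b x)"
      by (simp add: lincomb_def scaleR_sum_right)
    also have "\<dots> = (\<Sum>b\<in>B. \<Sum>b'\<in>B'. (c t b' * a b' b) *\<^sub>R b x)" by (rule sum.swap)
    finally show ?thesis by (simp add: lincomb_def scaleR_sum_left)
  qed
  then have "\<phi> t = lincomb B (\<lambda>b. \<Sum>b'\<in>B'. c t b' * a b' b)" by (rule ext)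
  then show ?thesis using assms(2) by blast
qed

theorem theorem2:
  fixes G :: "('d::finite) geometry"
    and V :: "(real ^ 'd \<Rightarrow> real ^ 'd) set"
    and W :: "(real ^ 'd \<Rightarrow> real) set"
  assumes "CARD('d) = 2 \<or> CARD('d) = 3"
    and "meshed_domain G" and "fe_space G V" and "fe_space G W"
  shows
    "(\<forall>\<kappa> P \<theta> D I u. discrete_solution \<kappa> G V W P \<theta> D I u \<longrightarrow> (\<forall>t\<in>I.
        (let \<rho> = rho P; \<mu> = mu P; \<gamma> = gam P; n = nrm G;
             f = src D t; v\<^sub>D = vD D t; p\<^sub>D = pD D t; th = \<theta> (u t);
             v = fst (u t); p = snd (u t)
         in
          (kinetic_energy G P u has_real_derivative
            (- \<mu> * (LINT x:Omega G|lebesgue. grad_prod v v x)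
             + (LINT x:Omega G|lebesgue. f x \<bullet> v x)
             - (a_stab G P \<theta> t u u - l_stab G P \<theta> D t u u)
             - bdint G (G_char G) (\<lambda>K x.
                 ((1/2) *\<^sub>R (A_abs \<rho> (th K x) (n x) (v x) *v vp (v x) (p x))
                   + A_neg \<rho> (th K x) (n x) (v x) *v vp (v\<^sub>D x) (p\<^sub>D x)) \<bullet> vp (v x) (p x))
             - \<mu> * bdint G (G_wall G \<union> G_in G) (\<lambda>K x.
                 (v x - v\<^sub>D x) \<bullet> ((\<gamma> / diameter K) *\<^sub>R v x - dn G K v x) - v x \<bullet> dn G K v x)
             - \<mu> * bdint G (G_sym G) (\<lambda>K x.
                 (v x \<bullet> n x) * (\<gamma> / diameter K * (v x \<bullet> n x) - 2 * dnn G K v x))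
             - 1/2 * bdint G (G_wall G \<union> G_sym G \<union> G_in G) (\<lambda>K x.
                 (A_abs \<rho> (th K x) (n x) (v x) *v vp (v x) 0) \<bullet> vp (v x) 0)
             - bdint G (G_in G) (\<lambda>K x.
                 \<rho> * neg_part (v x \<bullet> n x) * (v\<^sub>D x \<bullet> v x)
                 + (v\<^sub>D x \<bullet> n x) * (p x - alpha \<rho> (th K x) (n x) (v x) * (v x \<bullet> n x)))
             - bdint G (G_out G) (\<lambda>K x.
                 \<rho> / 2 * \<bar>v x \<bullet> n x\<bar> * ((v x - (v x \<bullet> n x) *\<^sub>R n x) \<bullet> (v x - (v x \<bullet> n x) *\<^sub>R n x))
                 + Q_out \<rho> (th K x) (n x) (v x) (p x - \<mu> * dnn G K v x) 1)
             + bdint G (G_out G) (\<lambda>K x.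
                 (1 / th K x * (p x - \<mu> * dnn G K v x) - v x \<bullet> n x) * p\<^sub>D x)
             - (1 - \<kappa>) * \<mu> * backflow G P \<theta> (u t) (u t))) (at t))
        \<and> (vanishing_data G I D \<longrightarrow>
            (kinetic_energy G P u has_real_derivative
              (- a_NaSt \<kappa> G P \<theta> (u t) (u t) - a_stab G P \<theta> t u u)) (at t))))
     \<and>
     (\<exists>\<gamma>\<^sub>0 c\<^sub>0. \<forall>\<kappa> P \<theta> D I u c_dt c_St d_t.
        discrete_solution \<kappa> G V W P \<theta> D I u \<and> vanishing_data G I D \<and> gam P \<ge> \<gamma>\<^sub>0
        \<and> d_t > 0 \<and> c_dt\<^sup>2 + c_St\<^sup>2 > 0
        \<and> (\<forall>t\<in>I. \<forall>K\<in>mesh G. \<forall>x\<in>K. (\<theta> (u t) K x)\<^sup>2 =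
              (rho P)\<^sup>2 * (fst (u t) x \<bullet> fst (u t) x)
              + c_dt\<^sup>2 * (rho P * diameter K / d_t)\<^sup>2 + c_St\<^sup>2 * (mu P / diameter K)\<^sup>2)
        \<longrightarrow> (\<forall>t\<in>I. \<exists>E'. (kinetic_energy G P u has_real_derivative E') (at t)
              \<and> E' \<le> - (1 - \<kappa>) * mu P * backflow G P \<theta> (u t) (u t)
              \<and> (\<kappa> = 1 \<or> mu P = 0 \<or> (\<forall>x\<in>G_out G. fst (u t) x \<bullet> nrm G x \<ge> 0)
                   \<or> c_St \<ge> c\<^sub>0 * (1 - \<kappa>)\<^sup>2 \<longrightarrow> E' \<le> 0)))"
proof -
  note G = assms(2) and V = assms(3) and W = assms(4)
  have state: "fst (u t) \<in> V" "fe_function G (fst (u t))" "continuous_on (closure (Omega G)) (snd (u t))" "rho P > 0" "mu P \<ge> 0"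
    "\<And>K. K \<in> mesh G \<Longrightarrow> continuous_on K (\<theta> (u t) K)" "\<And>K x. K \<in> mesh G \<Longrightarrow> x \<in> K \<Longrightarrow> \<theta> (u t) K x > 0"
    "set_integrable surface (G_in G \<union> G_char G) (vD D t)" "set_integrable surface (G_out G \<union> G_char G) (pD D t)"
    "\<And>x. x \<in> G_wall G \<Longrightarrow> vD D t x = 0" "gam1 P > 0" "gam2 P > 0"
    if sol: "discrete_solution \<kappa> G V W P \<theta> D I u" and t: "t \<in> I" for \<kappa> P \<theta> D I u t
  proof -
    obtain B where "V = range (lincomb B)" using V unfolding fe_space_def by blast
    moreover have u: "fe_curve I V (\<lambda>t. fst (u t))" and W': "snd (u t) \<in> W"
      and par: "admissible_par P" and data: "admissible_data G I D" and weight: "admissible_weight G I u \<theta>"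
      using sol t by (simp_all add: discrete_solution_def)
    ultimately show v: "fst (u t) \<in> V" using t fe_curve_mem by blast
    show "fe_function G (fst (u t))" by (rule fe_space_fe_function[OF V v])
    show "continuous_on (closure (Omega G)) (snd (u t))"
      using fe_space_fe_function[OF W W'] by (simp add: fe_function_def)
    show "rho P > 0" "mu P \<ge> 0" "gam1 P > 0" "gam2 P > 0" using par by (simp_all add: admissible_par_def)
    show "\<And>K. K \<in> mesh G \<Longrightarrow> continuous_on K (\<theta> (u t) K)" "\<And>K x. K \<in> mesh G \<Longrightarrow> x \<in> K \<Longrightarrow> \<theta> (u t) K x > 0"
      using weight t by (simp_all add: admissible_weight_def)
    show "set_integrable surface (G_in G \<union> G_char G) (vD D t)" "set_integrable surface (G_out G \<union> G_char G) (pD D t)"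
      "\<And>x. x \<in> G_wall G \<Longrightarrow> vD D t x = 0"
      using data t by (simp_all add: admissible_data_def)
  qed
  obtain \<epsilon> where \<epsilon>: "\<And>K. K \<in> mesh G \<Longrightarrow> \<epsilon> K > 0"
    and diss: "\<And>v \<Gamma>. v \<in> V \<Longrightarrow> \<Gamma> \<subseteq> frontier (Omega G) \<Longrightarrow> \<Gamma> \<in> sets borel \<Longrightarrow>
      3 * bdint G \<Gamma> (\<lambda>K x. \<epsilon> K * (norm (dn G K v x))\<^sup>2) \<le> (LINT x:Omega G|lebesgue. grad_prod v v x)"
    using boundary_dissipation[OF G V] by blast
  \<comment> \<open>One number dominating all \<open>diameter K / \<epsilon> K\<close> becomes both
    witnesses. As \<open>\<gamma>\<^sub>0\<close> it gives
    \<open>1 / \<epsilon> K \<le> gam P / diameter K\<close>; as \<open>c\<^sub>0\<close> it gives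
    \<open>(1 - \<kappa>)^2 * mu P / \<epsilon> K \<le> c_St * (mu P / diameter K)\<close>.\<close>
  define g where "g = (\<Sum>K\<in>mesh G. diameter K / \<epsilon> K)"
  have d: "diameter K > 0" if "K \<in> mesh G" for K by (rule mesh_facts(7)[OF G that])
  have g: "diameter K / \<epsilon> K \<le> g" if "K \<in> mesh G" for K
    unfolding g_def using \<epsilon> d by (intro member_le_sum that finite_mesh[OF G]) (auto intro: less_imp_le)
  show ?thesis
  proof (rule conjI, goal_cases)
    case 1
    show ?case
      unfolding Let_def
    proof (intro allI impI ballI conjI, goal_cases)
      case (1 \<kappa> P \<theta> D I u t)
      note st = state[OF 1]
      note id = a_l_NaSt_identity[OF G st(2,3), of "\<theta> (u t)" P D t \<theta> \<kappa>, unfolded prod.collapse,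
          OF st(6,7) less_imp_le[OF st(4)] st(8-10) refl]
      show ?case
        by (rule DERIV_cong[OF discrete_solution_energy[OF G V 1]]) (simp add: id)
    next
      case (2 \<kappa> P \<theta> D I u t)
      then show ?case
        using discrete_solution_energy[OF G V 2(1,2)] by (simp add: vanishing_data_l_NaSt vanishing_data_l_stab[OF G])
    qed
  next
    case 2
    show ?case
    proof (rule exI[of _ g], rule exI[of _ g], intro allI impI ballI)
      fix \<kappa> P \<theta> D I u c_dt c_St d_t t
      assume A: "discrete_solution \<kappa> G V W P \<theta> D I u \<and> vanishing_data G I D \<and> gam P \<ge> g
          \<and> d_t > 0 \<and> c_dt\<^sup>2 + c_St\<^sup>2 > 0
          \<and> (\<forall>t\<in>I. \<forall>K\<in>mesh G. \<forall>x\<in>K. (\<theta> (u t) K x)\<^sup>2 =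
                (rho P)\<^sup>2 * (fst (u t) x \<bullet> fst (u t) x)
                + c_dt\<^sup>2 * (rho P * diameter K / d_t)\<^sup>2 + c_St\<^sup>2 * (mu P / diameter K)\<^sup>2)"
        and t: "t \<in> I"
      then have sol: "discrete_solution \<kappa> G V W P \<theta> D I u" and D: "vanishing_data G I D" and gam: "gam P \<ge> g"
        and th2: "\<And>K x. K \<in> mesh G \<Longrightarrow> x \<in> K \<Longrightarrow> (\<theta> (u t) K x)\<^sup>2 =
                (rho P)\<^sup>2 * (fst (u t) x \<bullet> fst (u t) x)
                + c_dt\<^sup>2 * (rho P * diameter K / d_t)\<^sup>2 + c_St\<^sup>2 * (mu P / diameter K)\<^sup>2"
        by blast+
      note st = state[OF sol t]
      let ?E = "- a_NaSt \<kappa> G P \<theta> (u t) (u t) - a_stab G P \<theta> t u u"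
      have E: "(kinetic_energy G P u has_real_derivative ?E) (at t)"
        using discrete_solution_energy[OF G V sol t] D t by (simp add: vanishing_data_l_NaSt vanishing_data_l_stab[OF G])
      \<comment> \<open>Tested with the solution, both stabilisation integrands are squares with
        nonnegative weights.\<close>
      have stab: "a_stab G P \<theta> t u u \<ge> 0"
        unfolding a_stab_def set_lebesgue_integral_def
      proof (intro sum_nonneg add_nonneg_nonneg Bochner_Integration.integral_nonneg)
        fix K x assume K: "K \<in> mesh G"
        show "0 \<le> indicator K x *\<^sub>R (gam1 P * diameter K / \<theta> (u t) K x * (E_op P u u t x \<bullet> E_op P u u t x))"
          using st(7)[OF K, of x] st(11) d[OF K] by (auto simp: indicator_def)
        show "0 \<le> indicator K x *\<^sub>R (gam2 P * diameter K * \<theta> (u t) K x * (dv (fst (u t)) x * dv (fst (u t)) x))"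
          using st(7)[OF K, of x] st(12) d[OF K] by (auto simp: indicator_def)
      qed
      have gK: "1 / \<epsilon> K \<le> gam P / diameter K" if K: "K \<in> mesh G" for K
        using order_trans[OF g[OF K] gam] \<epsilon>[OF K] d[OF K] by (simp add: field_simps)
      have th_v: "rho P * norm (fst (u t) x) \<le> \<theta> (u t) K x" if "K \<in> mesh G" "x \<in> K" for K x
      proof (rule power2_le_imp_le)
        show "(rho P * norm (fst (u t) x))\<^sup>2 \<le> (\<theta> (u t) K x)\<^sup>2"
          unfolding th2[OF that] by (simp add: power_mult_distrib power2_norm_eq_inner)
        show "0 \<le> \<theta> (u t) K x" using st(7)[OF that] by simp
      qed
      note est = stability_estimates[OF G V st(1) st(3) \<epsilon> diss[OF st(1)] st(4,5), of \<theta>, unfolded prod.collapse,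
          OF _ _ _ st(6,7) gK th_v, where \<kappa>=\<kappa>]
      have 1: "?E \<le> - (1 - \<kappa>) * mu P * backflow G P \<theta> (u t) (u t)" 
      proof -
        have "- a_NaSt \<kappa> G P \<theta> (u t) (u t) \<le> - (1 - \<kappa>) * mu P * backflow G P \<theta> (u t) (u t)"
          by (rule est(1))
        then show ?thesis using stab by linarith
      qed
      \<comment> \<open>Each of the first three alternatives makes the backflow remainder zero, so
        the first estimate suffices; the last one requires absorption.\<close>
      have 2: "?E \<le> 0" if "\<kappa> = 1 \<or> mu P = 0 \<or> (\<forall>x\<in>G_out G. fst (u t) x \<bullet> nrm G x \<ge> 0) \<or> c_St \<ge> g * (1 - \<kappa>)\<^sup>2"
      proof (cases "\<kappa> = 1 \<or> mu P = 0 \<or> (\<forall>x\<in>G_out G. fst (u t) x \<bullet> nrm G x \<ge> 0)")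
        case True
        have "backflow G P \<theta> (u t) (u t) = 0" if "\<forall>x\<in>G_out G. fst (u t) x \<bullet> nrm G x \<ge> 0"
          unfolding backflow_def Let_def using that by (intro bdint_eq_0) (auto simp: neg_part_def)
        then show ?thesis using True 1 by auto
      next
        case False
        then have c: "c_St \<ge> g * (1 - \<kappa>)\<^sup>2" using that by blast
        have weight: "mu P * (1 - \<kappa>)\<^sup>2 * (rho P * \<bar>fst (u t) x \<bullet> nrm G x\<bar>) \<le> \<epsilon> K * (\<theta> (u t) K x)\<^sup>2"
          if K: "K \<in> mesh G" and x: "x \<in> G_out G" "x \<in> K" for K x
        proof -
          \<comment> \<open>The weight contains both squares, so
            \<open>2 * (?a * ?b) \<le> ?a^2 + ?b^2 \<le> \<theta>^2\<close> bounds the product of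
            the convective and viscous scales; the size of \<open>c_St\<close> then replaces
            \<open>?b\<close> by \<open>(1 - \<kappa>)^2 * mu P / \<epsilon> K\<close>.\<close>
          let ?a = "rho P * \<bar>fst (u t) x \<bullet> nrm G x\<bar>" and ?b = "c_St * (mu P / diameter K)"
          have "\<bar>fst (u t) x \<bullet> nrm G x\<bar> \<le> norm (fst (u t) x)"
            using Cauchy_Schwarz_ineq2[of "fst (u t) x" "nrm G x"] norm_nrm[OF G, of x] x boundary_parts(3)[OF G] by auto
          then have "?a\<^sup>2 \<le> (rho P * norm (fst (u t) x))\<^sup>2"
            using st(4) by (intro power_mono mult_left_mono) auto
          also have "\<dots> = (rho P)\<^sup>2 * (fst (u t) x \<bullet> fst (u t) x)"
            by (simp add: power_mult_distrib power2_norm_eq_inner)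
          finally have ab: "?a\<^sup>2 + ?b\<^sup>2 \<le> (\<theta> (u t) K x)\<^sup>2"
            unfolding th2[OF K x(2)] power_mult_distrib[of c_St] by (simp add: add_mono add_increasing2)
          have "0 \<le> (?a - ?b)\<^sup>2" by simp
          then have ab2: "2 * (?a * ?b) \<le> ?a\<^sup>2 + ?b\<^sup>2" by (simp only: power2_diff)
          have a0: "0 \<le> ?a" using st(4) by simp
          have gk: "(1 - \<kappa>)\<^sup>2 * (diameter K / \<epsilon> K) \<le> c_St"
            using mult_right_mono[OF g[OF K], of "(1 - \<kappa>)\<^sup>2"] c by (simp add: mult.commute)
          have "(1 - \<kappa>)\<^sup>2 * mu P / \<epsilon> K = (1 - \<kappa>)\<^sup>2 * (diameter K / \<epsilon> K) * (mu P / diameter K)"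
            using d[OF K] by simp
          also have "\<dots> \<le> ?b" using gk st(5) d[OF K] by (intro mult_right_mono) auto
          finally have b: "(1 - \<kappa>)\<^sup>2 * mu P / \<epsilon> K \<le> ?b" .
          have "0 \<le> (1 - \<kappa>)\<^sup>2 * mu P / \<epsilon> K" using st(5) \<epsilon>[OF K] by simp
          then have "0 \<le> ?a * ?b" by (rule mult_nonneg_nonneg[OF a0 order_trans[OF _ b]])
          then have "?a * ((1 - \<kappa>)\<^sup>2 * mu P / \<epsilon> K) \<le> (\<theta> (u t) K x)\<^sup>2"
            using ab ab2 mult_left_mono[OF b a0] by linarith
          then show ?thesis using \<epsilon>[OF K] by (simp add: field_simps)
        qed
        have "- a_NaSt \<kappa> G P \<theta> (u t) (u t) \<le> 0"
          by (rule est(2)) (assumption | erule (2) weight)+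
        then show ?thesis using stab by linarith
      qed
      show "\<exists>E'. (kinetic_energy G P u has_real_derivative E') (at t)
                \<and> E' \<le> - (1 - \<kappa>) * mu P * backflow G P \<theta> (u t) (u t)
                \<and> (\<kappa> = 1 \<or> mu P = 0 \<or> (\<forall>x\<in>G_out G. fst (u t) x \<bullet> nrm G x \<ge> 0)
                     \<or> c_St \<ge> g * (1 - \<kappa>)\<^sup>2 \<longrightarrow> E' \<le> 0)"
        by (intro exI[of _ ?E] conjI impI E 1 2)
    qed
  qed
qed

end
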